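(* Let $S$ be an inverse semigroup whose $\mathscr D$-classes each contain finitely many idempotents and let $K$ be a commutative ring with unit. Then the semigroup algebra $KS$ is stably finite if and only if the group algebra $KG$ is stably finite for each maximal subgroup $G$ of $S$. In particular, $KS$ is stably finite if $K$ is any integral domain of characteristic zero, or if each maximal subgroup of $S$ is sofic.
   Context: Rings are not assumed unital. A ring $R$ is Dedekind finite if for every idempotent $e\in R$ and all $u,v\in eRe$, $uv=e$ implies $vu=e$; $R$ is stably finite if $M_n(R)$ is Dedekind finite for all $n\geq 1$. An inverse semigroup is a semigroup $S$ such that for each $s\in S$ there is a unique $s^\ast\in S$ with $ss^\ast s=s$ and $s^\ast ss^\ast=s^\ast$; $E(S)$ is its set of idempotents. Two idempotents $e,f$ are $\mathscr D$-equivalent if there is $s\in S$ with $s^\ast s=e$ and $ss^\ast=f$ (so each $\mathscr D$-class containing finitely many idempotents means each $\mathscr D$-equivalence class of idempotents is finite). The maximal subgroup at $e\in E(S)$ is $G_e=\{s\in S\mid ss^\ast=e=s^\ast s\}$. $KS$ is the usual semigroup algebra with $K$-basis $S$ (if $S$ has a zero, it is not identified with the zero of $KS$). A group $G$ is sofic if for every finite $F\subseteq G$ and $\varepsilon>0$ there are $n\ge 1$ and a map $\sigma\colon G\to \mathrm{Sym}(n)$ such that for all $g,h\in F$, $\sigma(g)\sigma(h)$ and $\sigma(gh)$ agree on at least $(1-\varepsilon)n$ points, and for all $1\ne g\in F$, $\sigma(g)$ has at most $\varepsilon n$ fixed points. *)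

theory Defs
  imports
    Complex_Main
    "HOL-Algebra.Ring"
    "HOL-Algebra.Sym_Groups"
    "Jordan_Normal_Form.Matrix"
begin

text \<open>
  Semigroups and possibly non-unital rings are represented by the records \<open>monoid\<close> and \<open>ring\<close>
  of HOL-Algebra. The field \<open>one\<close> of such a structure may be junk, and no notion below that is
  defined for semigroups or rings without unit refers to it.
\<close>


section \<open>Dedekind finite and stably finite rings\<close>

definition corner :: "('a, 'm) ring_scheme \<Rightarrow> 'a \<Rightarrow> 'a set" where
  "corner R e = {e \<otimes>\<^bsub>R\<^esub> x \<otimes>\<^bsub>R\<^esub> e | x. x \<in> carrier R}"

definition dedekind_finite :: "('a, 'm) ring_scheme \<Rightarrow> bool" where
  "dedekind_finite R \<longleftrightarrow>
    (\<forall>e\<in>carrier R. e \<otimes>\<^bsub>R\<^esub> e = e \<longrightarrow>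
      (\<forall>u\<in>corner R e. \<forall>v\<in>corner R e. u \<otimes>\<^bsub>R\<^esub> v = e \<longrightarrow> v \<otimes>\<^bsub>R\<^esub> u = e))"

text \<open>
  The arithmetic of type \<open>'a mat\<close> in Jordan_Normal_Form is tied to type classes on \<open>'a\<close>; here the
  entries lie in the carrier of a ring record and the operations are those of that record.
\<close>
definition matrix_ring :: "nat \<Rightarrow> ('a, 'm) ring_scheme \<Rightarrow> 'a mat ring" where
  "matrix_ring n R =
    \<lparr> carrier = {A \<in> carrier_mat n n. \<forall>i<n. \<forall>j<n. A $$ (i, j) \<in> carrier R},
      mult = (\<lambda>A B. mat n n (\<lambda>(i, j). \<Oplus>\<^bsub>R\<^esub>k\<in>{..<n}. A $$ (i, k) \<otimes>\<^bsub>R\<^esub> B $$ (k, j))),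
      one = mat n n (\<lambda>(i, j). if i = j then \<one>\<^bsub>R\<^esub> else \<zero>\<^bsub>R\<^esub>),
      zero = mat n n (\<lambda>_. \<zero>\<^bsub>R\<^esub>),
      add = (\<lambda>A B. mat n n (\<lambda>(i, j). A $$ (i, j) \<oplus>\<^bsub>R\<^esub> B $$ (i, j))) \<rparr>"

definition stably_finite :: "('a, 'm) ring_scheme \<Rightarrow> bool" where
  "stably_finite R \<longleftrightarrow> (\<forall>n\<ge>1. dedekind_finite (matrix_ring n R))"

definition char_zero :: "('a, 'm) ring_scheme \<Rightarrow> bool" where
  "char_zero R \<longleftrightarrow> (\<forall>n::nat. n > 0 \<longrightarrow> [n] \<cdot>\<^bsub>R\<^esub> \<one>\<^bsub>R\<^esub> \<noteq> \<zero>\<^bsub>R\<^esub>)"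


section \<open>Inverse semigroups\<close>

locale inverse_semigroup =
  fixes S (structure)
  assumes m_closed: "\<lbrakk>s \<in> carrier S; t \<in> carrier S\<rbrakk> \<Longrightarrow> s \<otimes> t \<in> carrier S"
    and m_assoc: "\<lbrakk>s \<in> carrier S; t \<in> carrier S; u \<in> carrier S\<rbrakk>
      \<Longrightarrow> (s \<otimes> t) \<otimes> u = s \<otimes> (t \<otimes> u)"
    and ex1_star: "s \<in> carrier S
      \<Longrightarrow> \<exists>!t. t \<in> carrier S \<and> s \<otimes> t \<otimes> s = s \<and> t \<otimes> s \<otimes> t = t"

definition star :: "('s, 'm) monoid_scheme \<Rightarrow> 's \<Rightarrow> 's" where
  "star S s = (THE t. t \<in> carrier S \<and> s \<otimes>\<^bsub>S\<^esub> t \<otimes>\<^bsub>S\<^esub> s = s \<and> t \<otimes>\<^bsub>S\<^esub> s \<otimes>\<^bsub>S\<^esub> t = t)"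

definition idempotents :: "('s, 'm) monoid_scheme \<Rightarrow> 's set" where
  "idempotents S = {e \<in> carrier S. e \<otimes>\<^bsub>S\<^esub> e = e}"

definition D_equivalent :: "('s, 'm) monoid_scheme \<Rightarrow> 's \<Rightarrow> 's \<Rightarrow> bool" where
  "D_equivalent S e f \<longleftrightarrow>
    (\<exists>s\<in>carrier S. star S s \<otimes>\<^bsub>S\<^esub> s = e \<and> s \<otimes>\<^bsub>S\<^esub> star S s = f)"

definition maximal_subgroup :: "('s, 'm) monoid_scheme \<Rightarrow> 's \<Rightarrow> 's monoid" where
  "maximal_subgroup S e =
    \<lparr> carrier = {s \<in> carrier S. s \<otimes>\<^bsub>S\<^esub> star S s = e \<and> star S s \<otimes>\<^bsub>S\<^esub> s = e},
      mult = mult S,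
      one = e \<rparr>"

text \<open>
  Elements of \<open>KS\<close> are functions on the whole type of \<open>S\<close> with finite support contained in
  \<open>carrier S\<close>; \<open>s\<close> corresponds to the function that is one at \<open>s\<close> and zero elsewhere. Restricting
  the convolution sum to the supports makes its index set finite, which matters because a
  \<open>finsum\<close> over an infinite set is zero.
\<close>
definition semigroup_algebra ::
  "('k, 'm) ring_scheme \<Rightarrow> ('s, 'n) monoid_scheme \<Rightarrow> ('s \<Rightarrow> 'k) ring" where
  "semigroup_algebra K S =
    \<lparr> carrier = {a. range a \<subseteq> carrier K \<and> {s. a s \<noteq> \<zero>\<^bsub>K\<^esub>} \<subseteq> carrier S \<and> finite {s. a s \<noteq> \<zero>\<^bsub>K\<^esub>}},
      mult = (\<lambda>a b s.
        \<Oplus>\<^bsub>K\<^esub>p\<in>{(t, u). a t \<noteq> \<zero>\<^bsub>K\<^esub> \<and> b u \<noteq> \<zero>\<^bsub>K\<^esub> \<and> t \<otimes>\<^bsub>S\<^esub> u = s}. a (fst p) \<otimes>\<^bsub>K\<^esub> b (snd p)),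
      one = (\<lambda>s. if s = \<one>\<^bsub>S\<^esub> then \<one>\<^bsub>K\<^esub> else \<zero>\<^bsub>K\<^esub>),
      zero = (\<lambda>_. \<zero>\<^bsub>K\<^esub>),
      add = (\<lambda>a b s. a s \<oplus>\<^bsub>K\<^esub> b s) \<rparr>"


section \<open>Sofic groups\<close>

definition sofic :: "('g, 'm) monoid_scheme \<Rightarrow> bool" where
  "sofic G \<longleftrightarrow>
    (\<forall>F \<epsilon>::real. finite F \<and> F \<subseteq> carrier G \<and> \<epsilon> > 0 \<longrightarrow>
      (\<exists>n\<ge>1. \<exists>\<sigma>\<in>carrier G \<rightarrow> carrier (sym_group n).
        (\<forall>g\<in>F. \<forall>h\<in>F.
          real (card {x \<in> {1..n}. (\<sigma> g \<otimes>\<^bsub>sym_group n\<^esub> \<sigma> h) x = \<sigma> (g \<otimes>\<^bsub>G\<^esub> h) x}) \<ge> (1 - \<epsilon>) * real n) \<and>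
        (\<forall>g\<in>F. g \<noteq> \<one>\<^bsub>G\<^esub> \<longrightarrow> real (card {x \<in> {1..n}. \<sigma> g x = x}) \<le> \<epsilon> * real n)))"

end

theory Submission
  imports Defs "HOL-Library.Poly_Mapping" "HOL-Library.Nat_Bijection"
    "HOL-Computational_Algebra.Fundamental_Theorem_Algebra" "HOL-Analysis.Continuum_Not_Denumerable"
begin

text \<open>
  Since Dedekind finiteness is tested on all idempotents, \<open>KS\<close> is stably finite iff the ring of finitary
  infinite matrices over \<open>KS\<close> is Dedekind finite, and the property passes to subrings. For the converse
  direction, \<open>S\<close> acts on the \<open>\<L>\<close>-class of each idempotent \<open>e\<close>, a free right \<open>G\<^sub>e\<close>-set with finitely many
  orbits; this gives homomorphisms from \<open>KS\<close> to matrices over \<open>KG\<^sub>e\<close>, which jointly separate points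
  because a maximal element of a support survives in one of them.

  For sofic \<open>G\<close>, almost-actions turn \<open>AB = 1\<close> into square matrices over \<open>K\<close> with \<open>1 - AB\<close> of small rank,
  whence \<open>1 - BA\<close> has small rank too; over a general commutative ring, elimination modulo nilpotents shows
  that all coefficients of the idempotent \<open>1 - BA\<close> are nilpotent, so it vanishes.

  For a domain of characteristic zero, the finitely many coefficients lie in a subring that embeds into
  \<open>\<complex>\<close>, and there Kaplansky's trace argument applies: the trace of an idempotent \<open>e\<close> is
  the squared norm of the projection of the unit to the right ideal of \<open>e\<close>, which can be computed with
  almost best approximations, without completing the group algebra.
\<close>

abbreviation lkp :: "('x \<Rightarrow>\<^sub>0 'a::zero) \<Rightarrow> 'x \<Rightarrow> 'a" where "lkp \<equiv> Poly_Mapping.lookup"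
abbreviation supp :: "('x \<Rightarrow>\<^sub>0 'a::zero) \<Rightarrow> 'x set" where "supp \<equiv> Poly_Mapping.keys"
abbreviation sng :: "'x \<Rightarrow> 'a::zero \<Rightarrow> ('x \<Rightarrow>\<^sub>0 'a)" where "sng \<equiv> Poly_Mapping.single"

section \<open>Finitely supported functions and additive extension from monomials\<close>

lemma sum_single_lookup:
  assumes "finite A" "supp f \<subseteq> A"
  shows "f = (\<Sum>x\<in>A. sng x (lkp f x))"
proof (rule poly_mapping_eqI)
  fix k
  have "lkp (\<Sum>x\<in>A. sng x (lkp f x)) k = (\<Sum>x\<in>A. if x = k then lkp f x else 0)"
    by (simp add: lookup_sum lookup_single when_def)
  also have "\<dots> = lkp f k"
    using assms by (auto simp: sum.delta' in_keys_iff)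
  finally show "lkp f k = lkp (\<Sum>x\<in>A. sng x (lkp f x)) k" by simp
qed

text \<open>The coefficient is an argument of \<open>h\<close>, so the target needs no scalar
  multiplication; additivity in the coefficient is assumed lemma by lemma.\<close>

definition lin_ext :: "('x \<Rightarrow> 'a \<Rightarrow> 'b::comm_monoid_add) \<Rightarrow> ('x \<Rightarrow>\<^sub>0 'a::zero) \<Rightarrow> 'b" where
  "lin_ext h f = (\<Sum>x\<in>supp f. h x (lkp f x))"

lemma lin_ext_superset:
  assumes "\<And>x. h x 0 = 0" "finite A" "supp f \<subseteq> A"
  shows "lin_ext h f = (\<Sum>x\<in>A. h x (lkp f x))"
  unfolding lin_ext_def
  by (rule sum.mono_neutral_left) (use assms in \<open>auto simp: in_keys_iff\<close>)

lemma lin_ext_0 [simp]: "lin_ext h 0 = 0"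
  by (simp add: lin_ext_def)

lemma lin_ext_single:
  assumes "\<And>x. h x 0 = 0"
  shows "lin_ext h (sng x c) = h x c"
  using assms by (cases "c = 0") (auto simp: lin_ext_def)

lemma lin_ext_add:
  fixes h :: "'x \<Rightarrow> 'a::comm_monoid_add \<Rightarrow> 'b::comm_monoid_add"
  assumes "\<And>x. h x 0 = 0" "\<And>x c d. h x (c + d) = h x c + h x d"
  shows "lin_ext h (f + g) = lin_ext h f + lin_ext h g"
proof -
  let ?A = "supp f \<union> supp g"
  have 1: "supp (f + g) \<subseteq> ?A" by (rule Poly_Mapping.keys_add)
  show ?thesis
    using lin_ext_superset[of h ?A "f + g", OF assms(1) _ 1]
      lin_ext_superset[of h ?A f, OF assms(1)] lin_ext_superset[of h ?A g, OF assms(1)]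
    by (simp add: lookup_add assms(2) sum.distrib)
qed

lemma lin_ext_sum:
  fixes h :: "'x \<Rightarrow> 'a::comm_monoid_add \<Rightarrow> 'b::comm_monoid_add"
  assumes "\<And>x. h x 0 = 0" "\<And>x c d. h x (c + d) = h x c + h x d"
  shows "lin_ext h (\<Sum>i\<in>I. F i) = (\<Sum>i\<in>I. lin_ext h (F i))"
  by (induction I rule: infinite_finite_induct) (simp_all add: lin_ext_add assms)

lemma lin_ext_diff:
  fixes h :: "'x \<Rightarrow> 'a::ab_group_add \<Rightarrow> 'b::ab_group_add"
  assumes "\<And>x. h x 0 = 0" "\<And>x c d. h x (c + d) = h x c + h x d"
  shows "lin_ext h (f - g) = lin_ext h f - lin_ext h g"
  using lin_ext_add[where h=h and f="f - g" and g=g, OF assms] by (simp add: algebra_simps)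

section \<open>Finitary matrices over semigroup algebras\<close>

text \<open>Row, column and semigroup element are flattened into one index: a monomial is a matrix
  unit carrying one semigroup element. Indices range over all naturals, so that the matrices of all
  sizes lie in a single ring.\<close>

type_synonym ('s, 'a) fin_mat = "nat \<times> nat \<times> 's \<Rightarrow>\<^sub>0 'a"

fun unit_mult :: "('s, 'm) monoid_scheme \<Rightarrow> nat \<times> nat \<times> 's \<Rightarrow> nat \<times> nat \<times> 's \<Rightarrow> 'a
    \<Rightarrow> ('s, 'a::zero) fin_mat" where
  "unit_mult S (i, j, s) (k, l, t) c = (if j = k then sng (i, l, s \<otimes>\<^bsub>S\<^esub> t) c else 0)"

definition conv :: "('s, 'm) monoid_scheme \<Rightarrow> ('s, 'a::comm_ring_1) fin_mat
    \<Rightarrow> ('s, 'a) fin_mat \<Rightarrow> ('s, 'a) fin_mat" where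
  "conv S f g = lin_ext (\<lambda>x c. lin_ext (\<lambda>y d. unit_mult S x y (c * d)) g) f"

lemma unit_mult_0 [simp]: "unit_mult S x y 0 = 0"
  by (cases x; cases y) auto

lemma unit_mult_add: "unit_mult S x y (c + d) = unit_mult S x y c + unit_mult S x y (d::'a::monoid_add)"
  by (cases x; cases y) (auto simp: single_add)

lemma lin_ext_fun_0: "(\<And>x c. h x c = 0) \<Longrightarrow> lin_ext h f = 0"
  by (simp add: lin_ext_def)

lemma lin_ext_fun_add: "lin_ext (\<lambda>x c. h x c + h' x c) f = lin_ext h f + lin_ext h' f"
  by (simp add: lin_ext_def sum.distrib)

lemma conv_add_left: "conv S (f + g) h = conv S f h + conv S g h"
  unfolding conv_def
  by (rule lin_ext_add)
    (simp_all add: lin_ext_fun_0 lin_ext_fun_add[symmetric] unit_mult_add algebra_simps)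

lemma conv_add_right: "conv S h (f + g) = conv S h f + conv S h g"
  unfolding conv_def
  by (subst lin_ext_add) (simp_all add: lin_ext_fun_add unit_mult_add algebra_simps)

lemma conv_0_left [simp]: "conv S 0 f = 0"
  by (simp add: conv_def)

lemma conv_0_right [simp]: "conv S f 0 = 0"
  by (simp add: conv_def lin_ext_fun_0)

lemma conv_diff_left: "conv S (f - g) h = conv S f h - conv S g h"
  using conv_add_left[of S "f - g" g h] by (simp add: algebra_simps)

lemma conv_diff_right: "conv S h (f - g) = conv S h f - conv S h g"
  using conv_add_right[of S h "f - g" g] by (simp add: algebra_simps)

lemma conv_sum_left: "conv S (\<Sum>i\<in>I. f i) h = (\<Sum>i\<in>I. conv S (f i) h)"
  by (induction I rule: infinite_finite_induct) (auto simp: conv_add_left)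

lemma conv_sum_right: "conv S h (\<Sum>i\<in>I. f i) = (\<Sum>i\<in>I. conv S h (f i))"
  by (induction I rule: infinite_finite_induct) (auto simp: conv_add_right)

lemma conv_single: "conv S (sng x c) (sng y d) = unit_mult S x y (c * d)"
  unfolding conv_def by (subst lin_ext_single; (subst lin_ext_single)?) (auto simp: lin_ext_fun_0)

lemma conv_single' [simp]:
  "conv S (sng (i, j, s) c) (sng (k, l, t) d) = (if j = k then sng (i, l, s \<otimes>\<^bsub>S\<^esub> t) (c * d) else 0)"
  by (simp add: conv_single)

lemma conv_expand:
  assumes "finite A" "supp f \<subseteq> A" "finite B" "supp g \<subseteq> B"
  shows "conv S f g = (\<Sum>x\<in>A. \<Sum>y\<in>B. unit_mult S x y (lkp f x * lkp g y))"
  by (subst sum_single_lookup[OF assms(1,2)], subst sum_single_lookup[OF assms(3,4)])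
    (simp only: conv_sum_left, simp only: conv_sum_right conv_single)

lemma lookup_conv:
  assumes "finite A" "supp f \<subseteq> A" "finite B" "supp g \<subseteq> B"
  shows "lkp (conv S f g) (i, l, u) =
    (\<Sum>x\<in>A. \<Sum>y\<in>B. if fst x = i \<and> fst (snd x) = fst y \<and> fst (snd y) = l \<and> snd (snd x) \<otimes>\<^bsub>S\<^esub> snd (snd y) = u
       then lkp f x * lkp g y else 0)"
  unfolding conv_expand[OF assms] lookup_sum
  by (intro sum.cong refl) (auto simp: lookup_single when_def split: prod.splits)

section \<open>Restricting supports and coefficients\<close>

definition coeffs_in :: "'x set \<Rightarrow> 'a set \<Rightarrow> ('x \<Rightarrow>\<^sub>0 'a::zero) set" where
  "coeffs_in X D = {f. supp f \<subseteq> X \<and> (\<forall>x. lkp f x \<in> D)}"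

lemma coeffs_in_mono: "X \<subseteq> Y \<Longrightarrow> D \<subseteq> D' \<Longrightarrow> coeffs_in X D \<subseteq> coeffs_in Y D'"
  by (auto simp: coeffs_in_def)

text \<open>Closure under \<open>1\<close> is left out on purpose: the image of \<open>K\<close> in
  the ambient ring has its own unit, which is not the \<open>1\<close> of the type.\<close>

definition add_mult_closed :: "'a::comm_ring_1 set \<Rightarrow> bool" where
  "add_mult_closed D \<longleftrightarrow> 0 \<in> D \<and> (\<forall>a\<in>D. \<forall>b\<in>D. a + b \<in> D \<and> a * b \<in> D)"

lemma add_mult_closed_UNIV [simp]: "add_mult_closed UNIV"
  by (simp add: add_mult_closed_def)

lemma sum_in_closed:
  assumes "add_mult_closed D" "\<And>i. i \<in> I \<Longrightarrow> f i \<in> D"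
  shows "sum f I \<in> D"
  using assms(2) by (induction I rule: infinite_finite_induct)
    (use assms(1) in \<open>auto simp: add_mult_closed_def\<close>)

abbreviation block :: "nat \<Rightarrow> 's set \<Rightarrow> (nat \<times> nat \<times> 's) set" where
  "block d T \<equiv> {..<d} \<times> {..<d} \<times> T"

abbreviation entries :: "('s, 'm) monoid_scheme \<Rightarrow> (nat \<times> nat \<times> 's) set" where
  "entries S \<equiv> UNIV \<times> UNIV \<times> carrier S"

abbreviation fin_mats :: "('s, 'm) monoid_scheme \<Rightarrow> 'a set \<Rightarrow> ('s, 'a::zero) fin_mat set" where
  "fin_mats S D \<equiv> coeffs_in (entries S) D"

lemma coeffs_in_sum:
  assumes "add_mult_closed D" "\<And>i. i \<in> I \<Longrightarrow> f i \<in> coeffs_in X D"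
  shows "sum f I \<in> coeffs_in X D"
proof -
  have "supp (sum f I) \<subseteq> X"
    using assms(2) keys_sum[of f I] by (fastforce simp: coeffs_in_def)
  moreover have "lkp (sum f I) x \<in> D" for x
    unfolding lookup_sum using assms by (intro sum_in_closed) (auto simp: coeffs_in_def)
  ultimately show ?thesis by (simp add: coeffs_in_def)
qed

lemma coeffs_in_single: "0 \<in> D \<Longrightarrow> x \<in> X \<Longrightarrow> c \<in> D \<Longrightarrow> sng x c \<in> coeffs_in X D"
  by (auto simp: coeffs_in_def lookup_single when_def split: if_splits)

lemma coeffs_in_0: "0 \<in> D \<Longrightarrow> 0 \<in> coeffs_in X D"
  by (auto simp: coeffs_in_def)

locale semigroup_on =
  fixes S (structure)
  assumes mclosed: "\<lbrakk>s \<in> carrier S; t \<in> carrier S\<rbrakk> \<Longrightarrow> s \<otimes> t \<in> carrier S"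
    and massoc: "\<lbrakk>s \<in> carrier S; t \<in> carrier S; u \<in> carrier S\<rbrakk>
      \<Longrightarrow> (s \<otimes> t) \<otimes> u = s \<otimes> (t \<otimes> u)"
begin

lemma conv_closed:
  assumes "add_mult_closed D" "f \<in> fin_mats S D" "g \<in> fin_mats S D"
  shows "conv S f g \<in> fin_mats S D"
proof -
  have "unit_mult S x y (lkp f x * lkp g y) \<in> fin_mats S D"
    if "x \<in> supp f" "y \<in> supp g" for x y
  proof -
    obtain i j s k l t where [simp]: "x = (i,j,s)" "y = (k,l,t)" by (metis surj_pair)
    have "s \<in> carrier S" "t \<in> carrier S" using that assms by (auto simp: coeffs_in_def)
    then have "s \<otimes> t \<in> carrier S" by (rule mclosed)
    moreover have "0 \<in> D" "lkp f x * lkp g y \<in> D" using assms by (auto simp: add_mult_closed_def coeffs_in_def)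
    ultimately show ?thesis by (auto intro!: coeffs_in_single coeffs_in_0)
  qed
  then show ?thesis
    unfolding conv_expand[OF finite_keys order.refl finite_keys order.refl]
    by (intro coeffs_in_sum assms(1))
qed

lemma conv_assoc:
  assumes "supp f \<subseteq> entries S" "supp g \<subseteq> entries S" "supp h \<subseteq> entries S"
  shows "conv S (conv S f g) h = conv S f (conv S g h)"
proof -
  let ?f = "\<lambda>x. sng x (lkp f x)" and ?g = "\<lambda>x. sng x (lkp g x)" and ?h = "\<lambda>x. sng x (lkp h x)"
  have e: "f = sum ?f (supp f)" "g = sum ?g (supp g)" "h = sum ?h (supp h)"
    by (rule sum_single_lookup; simp)+
  have *: "conv S (conv S (?f x) (?g y)) (?h z) = conv S (?f x) (conv S (?g y) (?h z))"
    if "x \<in> supp f" "y \<in> supp g" "z \<in> supp h" for x y z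
  proof -
    obtain i j s k l t m n u where [simp]: "x = (i,j,s)" "y = (k,l,t)" "z = (m,n,u)" by (metis surj_pair)
    have "s \<in> carrier S" "t \<in> carrier S" "u \<in> carrier S" using that assms by auto
    then show ?thesis by (simp add: massoc mult.assoc)
  qed
  have "conv S (conv S (sum ?f (supp f)) (sum ?g (supp g))) (sum ?h (supp h))
     = conv S (sum ?f (supp f)) (conv S (sum ?g (supp g)) (sum ?h (supp h)))"
    unfolding conv_sum_left conv_sum_right
    by (rule sum.cong[OF refl])+ (simp add: *)
  then show ?thesis using e by simp
qed

end

text \<open>Being in the corner of \<open>e\<close> is expressed by \<open>e\<close> acting as a
  two-sided unit. Three finitely supported elements always share a finite block, so this one
  statement covers the matrix rings of every size.\<close>

definition dedekind_conv :: "('s, 'm) monoid_scheme \<Rightarrow> 'a::comm_ring_1 set \<Rightarrow> bool" where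
  "dedekind_conv S D \<longleftrightarrow> (\<forall>e\<in>fin_mats S D. \<forall>u\<in>fin_mats S D. \<forall>v\<in>fin_mats S D.
     conv S e e = e \<and> conv S e u = u \<and> conv S u e = u \<and> conv S e v = v \<and> conv S v e = v
       \<and> conv S u v = e \<longrightarrow> conv S v u = e)"

lemma dedekind_conv_mono:
  "dedekind_conv S D \<Longrightarrow> D' \<subseteq> D \<Longrightarrow> dedekind_conv S D'"
  unfolding dedekind_conv_def using coeffs_in_mono[of "entries S" "entries S" D' D] by blast

text \<open>Two monomials contribute only if they share the middle index \<open>k\<close>, so the
  sum over pairs of monomials becomes a sum over \<open>k\<close> and two semigroup elements. In
  this shape it can be compared with the product in \<open>matrix_ring\<close> and with products of
  permutation-like matrices.\<close>

lemma lookup_conv_mat: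
  assumes F: "finite F" and f: "supp f \<subseteq> UNIV \<times> {..<d} \<times> F" and g: "supp g \<subseteq> {..<d} \<times> UNIV \<times> F"
  shows "lkp (conv S f g) (i, l, u) =
    (\<Sum>(k, s, t)\<in>{..<d} \<times> F \<times> F. if s \<otimes>\<^bsub>S\<^esub> t = u then lkp f (i, k, s) * lkp g (k, l, t) else 0)"
proof -
  let ?L = "\<lambda>(x, y). if fst x = i \<and> fst (snd x) = fst y \<and> fst (snd y) = l \<and> snd (snd x) \<otimes>\<^bsub>S\<^esub> snd (snd y) = u
       then lkp f x * lkp g y else 0"
  let ?R = "\<lambda>(k, s, t). if s \<otimes>\<^bsub>S\<^esub> t = u then lkp f (i, k, s) * lkp g (k, l, t) else 0"
  have "lkp (conv S f g) (i, l, u) = sum ?L (supp f \<times> supp g)"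
    by (simp add: lookup_conv[OF finite_keys order.refl finite_keys order.refl] sum.cartesian_product)
  also have "\<dots> = sum ?L {a \<in> supp f \<times> supp g. ?L a \<noteq> 0}"
    by (rule sum.mono_neutral_right) auto
  also have "\<dots> = sum ?R {a \<in> {..<d} \<times> F \<times> F. ?R a \<noteq> 0}"
    by (rule sum.reindex_bij_witness[where
        i = "\<lambda>(k, s, t). ((i, k, s), (k, l, t))" and j = "\<lambda>(x, y). (fst (snd x), snd (snd x), snd (snd y))"])
      (use f g in \<open>auto simp: in_keys_iff split: if_splits\<close>)
  also have "\<dots> = sum ?R ({..<d} \<times> F \<times> F)"
    by (rule sum.mono_neutral_left) (use F in auto)
  finally show ?thesis .
qed

lemma finite_entries_bounded:
  assumes "finite X" "X \<subseteq> UNIV \<times> UNIV \<times> T"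
  shows "\<exists>d::nat. X \<subseteq> block d T"
proof -
  have "finite (fst ` X \<union> (fst \<circ> snd) ` X)" using assms(1) by simp
  then obtain d where d: "fst ` X \<union> (fst \<circ> snd) ` X \<subseteq> {..<d}" using finite_nat_bounded by blast
  have "x \<in> block d T" if "x \<in> X" for x
  proof -
    have "fst x \<in> {..<d}" "fst (snd x) \<in> {..<d}" using d that by auto
    then show ?thesis using assms(2) that by (cases x) auto
  qed
  then show ?thesis by blast
qed

text \<open>From \<open>uv = e\<close> it follows that \<open>vu\<close> is an idempotent below
  \<open>e\<close>, hence \<open>z = e - vu\<close> is idempotent as well. Both theorems about
  groups are proved by showing that this idempotent vanishes, inside a block that contains all the
  supports.\<close>

lemma (in semigroup_on) dedekind_convI:
  assumes "\<And>d (e :: ('a, 'c::comm_ring_1) fin_mat) u v z. \<lbrakk>supp e \<subseteq> block d (carrier S); supp u \<subseteq> block d (carrier S);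
      supp v \<subseteq> block d (carrier S); supp z \<subseteq> block d (carrier S);
      conv S e e = e; conv S e u = u; conv S u e = u; conv S e v = v; conv S v e = v; conv S u v = e;
      z = e - conv S v u; conv S z z = z\<rbrakk> \<Longrightarrow> z = 0"
  shows "dedekind_conv S (UNIV :: 'c set)"
  unfolding dedekind_conv_def
proof (intro ballI impI, elim conjE)
  fix e u v :: "('a, 'c) fin_mat"
  assume "e \<in> fin_mats S UNIV" "u \<in> fin_mats S UNIV" "v \<in> fin_mats S UNIV"
  then have supps: "supp e \<subseteq> entries S" "supp u \<subseteq> entries S" "supp v \<subseteq> entries S"
    by (auto simp: coeffs_in_def)
  assume r: "conv S e e = e" "conv S e u = u" "conv S u e = u" "conv S e v = v" "conv S v e = v" "conv S u v = e"
  define z where "z = e - conv S v u"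
  have vu: "supp (conv S v u) \<subseteq> entries S"
    using conv_closed[OF add_mult_closed_UNIV, of v u] supps by (auto simp: coeffs_in_def)
  then have supz: "supp z \<subseteq> entries S"
    using keys_diff[of e "conv S v u"] supps by (auto simp: z_def)
  have "conv S u (conv S v u) = u"
    using conv_assoc[OF supps(2,3,2)] r by simp
  then have 1: "conv S (conv S v u) (conv S v u) = conv S v u"
    using conv_assoc[OF supps(3,2) vu] by simp
  have 2: "conv S e (conv S v u) = conv S v u"
    using conv_assoc[OF supps(1,3,2)] r by simp
  have 3: "conv S (conv S v u) e = conv S v u"
    using conv_assoc[OF supps(3,2,1)] r by simp
  have zz: "conv S z z = z"
    using r(1) 1 2 3 by (simp add: z_def conv_diff_left conv_diff_right)
  have "\<exists>d. supp e \<union> supp u \<union> supp v \<union> supp z \<subseteq> block d (carrier S)"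
    using supps supz by (intro finite_entries_bounded) auto
  then obtain d where d: "supp e \<union> supp u \<union> supp v \<union> supp z \<subseteq> block d (carrier S)" by blast
  have "z = 0"
    by (rule assms[OF _ _ _ _ r z_def zz, of d]) (use d in blast)+
  then show "conv S v u = e" by (simp add: z_def)
qed

lemma conv_cong:
  fixes f g :: "('s, 'c::comm_ring_1) fin_mat"
  assumes "mult S = mult T"
  shows "conv S f g = conv T f g"
proof -
  have "unit_mult S x y c = unit_mult T x y c" for x y and c :: 'c
    by (cases x; cases y) (simp add: assms)
  then show ?thesis by (simp add: conv_def)
qed

lemma dedekind_conv_subsemigroup:
  assumes "dedekind_conv S D" "mult T = mult S" "carrier T \<subseteq> carrier S"
  shows "dedekind_conv T D"
  unfolding dedekind_conv_def conv_cong[OF assms(2)]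
proof (intro ballI impI)
  fix e u v assume in': "e \<in> fin_mats T D" "u \<in> fin_mats T D" "v \<in> fin_mats T D"
    and r: "conv S e e = e \<and> conv S e u = u \<and> conv S u e = u \<and> conv S e v = v \<and> conv S v e = v \<and> conv S u v = e"
  have "fin_mats T D \<subseteq> fin_mats S D"
    using assms(3) by (intro coeffs_in_mono) auto
  then have "e \<in> fin_mats S D" "u \<in> fin_mats S D" "v \<in> fin_mats S D"
    using in' by auto
  then show "conv S v u = e"
    using assms(1)[unfolded dedekind_conv_def] r by blast
qed

lemma (in group) is_semigroup_on: "semigroup_on G"
  by unfold_locales (auto simp: m_assoc)

text \<open>A local unit: the identity of one block. Paired with it, the inner product of the
  complex case becomes the trace.\<close>

definition unit_mat :: "('s, 'm) monoid_scheme \<Rightarrow> nat \<Rightarrow> ('s, 'a::comm_ring_1) fin_mat" where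
  "unit_mat S d = (\<Sum>i<d. sng (i, i, \<one>\<^bsub>S\<^esub>) 1)"

lemma lookup_unit_mat:
  "lkp (unit_mat S d) (i, j, s) = (if i < d \<and> i = j \<and> s = \<one>\<^bsub>S\<^esub> then 1 else 0)"
proof -
  have "lkp (unit_mat S d) (i, j, s) = (\<Sum>k<d. if k = i then (if i = j \<and> s = \<one>\<^bsub>S\<^esub> then 1 else 0) else 0)"
    unfolding unit_mat_def lookup_sum by (intro sum.cong) (auto simp: lookup_single when_def)
  then show ?thesis by (auto simp: sum.delta')
qed

context group begin

lemma conv_unit_mat_left:
  assumes "supp f \<subseteq> {..<d} \<times> UNIV \<times> carrier G"
  shows "conv G (unit_mat G d) f = f"
proof -
  have "conv G (unit_mat G d) (sng x (lkp f x)) = sng x (lkp f x)" if "x \<in> supp f" for x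
  proof -
    obtain i j s where [simp]: "x = (i, j, s)" by (metis surj_pair)
    have ij: "i < d" "s \<in> carrier G" using assms that by auto
    have "conv G (unit_mat G d) (sng x (lkp f x)) = (\<Sum>k<d. if k = i then sng x (lkp f x) else 0)"
      unfolding unit_mat_def conv_sum_left by (intro sum.cong) (use ij in auto)
    then show ?thesis using ij by (simp add: sum.delta')
  qed
  then show ?thesis
    by (subst (1 2) sum_single_lookup[of "supp f" f]) (auto simp: conv_sum_right)
qed

lemma conv_unit_mat_right:
  assumes "supp f \<subseteq> UNIV \<times> {..<d} \<times> carrier G"
  shows "conv G f (unit_mat G d) = f"
proof -
  have "conv G (sng x (lkp f x)) (unit_mat G d) = sng x (lkp f x)" if "x \<in> supp f" for x
  proof -
    obtain i j s where [simp]: "x = (i, j, s)" by (metis surj_pair)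
    have ij: "j < d" "s \<in> carrier G" using assms that by auto
    have "conv G (sng x (lkp f x)) (unit_mat G d) = (\<Sum>k<d. if k = j then sng x (lkp f x) else 0)"
      unfolding unit_mat_def conv_sum_right by (intro sum.cong) (use ij in auto)
    then show ?thesis using ij by (simp add: sum.delta')
  qed
  then show ?thesis
    by (subst (1 2) sum_single_lookup[of "supp f" f]) (auto simp: conv_sum_left)
qed

end

section \<open>Reflecting ring records into a type class\<close>

text \<open>The product of all commutative rings whose carrier is a set of elements of \<open>'k\<close>, and of \<open>\<int>\<close> to
  keep it nontrivial, is a type of class \<open>comm_ring_1\<close>. Every ring record over \<open>'k\<close> embeds into it as a
  direct factor, so that sums over its elements can be computed in the type class.\<close>

definition pad :: "'k ring \<Rightarrow> 'k ring" where
  "pad K = (if cring K then K else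
    \<lparr>carrier = {undefined}, mult = \<lambda>_ _. undefined, one = undefined, zero = undefined, add = \<lambda>_ _. undefined\<rparr>)"

lemma cring_pad: "cring (pad K)"
proof (cases "cring K")
  case False
  have "cring \<lparr>carrier = {undefined :: 'a}, mult = \<lambda>_ _. undefined, one = undefined, zero = undefined, add = \<lambda>_ _. undefined\<rparr>"
    by (intro cringI abelian_groupI comm_monoidI) auto
  then show ?thesis using False by (simp add: pad_def)
qed (simp add: pad_def)

lemma pad_cring: "cring K \<Longrightarrow> pad K = K"
  by (simp add: pad_def)

typedef 'k prodring = "{(f :: 'k ring \<Rightarrow> 'k, z :: int). \<forall>K. f K \<in> carrier (pad K)}"
proof -
  have "(\<lambda>K. \<zero>\<^bsub>pad K\<^esub>, 0) \<in> {(f :: 'k ring \<Rightarrow> 'k, z :: int). \<forall>K. f K \<in> carrier (pad K)}"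
    using cring.cring_simprules(2)[OF cring_pad] by auto
  then show ?thesis by (rule exI)
qed

definition component :: "'k prodring \<Rightarrow> 'k ring \<Rightarrow> 'k" where "component x = fst (Rep_prodring x)"
definition int_component :: "'k prodring \<Rightarrow> int" where "int_component x = snd (Rep_prodring x)"

lemma component_closed [simp]: "component x K \<in> carrier (pad K)"
  using Rep_prodring[of x] by (auto simp: component_def)

lemma component_Abs:
  assumes "\<And>K. f K \<in> carrier (pad K)"
  shows "component (Abs_prodring (f, z)) = f" "int_component (Abs_prodring (f, z)) = z"
  using assms by (simp_all add: component_def int_component_def Abs_prodring_inverse)

lemma prodring_eqI: "(\<And>K. component x K = component y K) \<Longrightarrow> int_component x = int_component y \<Longrightarrow> x = y"
  by (auto simp: component_def int_component_def Rep_prodring_inject[symmetric] prod_eq_iff)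

instantiation prodring :: (type) comm_ring_1
begin

definition "0 = Abs_prodring (\<lambda>K. \<zero>\<^bsub>pad K\<^esub>, 0)"
definition "1 = Abs_prodring (\<lambda>K. \<one>\<^bsub>pad K\<^esub>, 1)"
definition "x + y = Abs_prodring (\<lambda>K. component x K \<oplus>\<^bsub>pad K\<^esub> component y K, int_component x + int_component y)"
definition "x * y = Abs_prodring (\<lambda>K. component x K \<otimes>\<^bsub>pad K\<^esub> component y K, int_component x * int_component y)"
definition "- x = Abs_prodring (\<lambda>K. \<ominus>\<^bsub>pad K\<^esub> component x K, - int_component x)"
definition "x - y = x + - (y :: 'a prodring)"

lemma component_ops:
  "component 0 K = \<zero>\<^bsub>pad K\<^esub>" "int_component 0 = 0" "component 1 K = \<one>\<^bsub>pad K\<^esub>" "int_component 1 = 1"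
  "component (x + y) K = component x K \<oplus>\<^bsub>pad K\<^esub> component y K" "int_component (x + y) = int_component x + int_component y"
  "component (x * y) K = component x K \<otimes>\<^bsub>pad K\<^esub> component y K" "int_component (x * y) = int_component x * int_component y"
  "component (- x) K = \<ominus>\<^bsub>pad K\<^esub> component x K" "int_component (- x) = - int_component x"
  unfolding zero_prodring_def one_prodring_def plus_prodring_def times_prodring_def uminus_prodring_def
  by (simp_all add: component_Abs cring.cring_simprules[OF cring_pad])

instance
proof
  fix a b c :: "'a prodring"
  note r = cring.cring_simprules[OF cring_pad]
  show "a * b * c = a * (b * c)" by (rule prodring_eqI) (simp_all add: component_ops r)
  show "a * b = b * a" by (rule prodring_eqI) (simp_all add: component_ops r)
  show "1 * a = a" by (rule prodring_eqI) (simp_all add: component_ops r)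
  show "a + b + c = a + (b + c)" by (rule prodring_eqI) (simp_all add: component_ops r)
  show "a + b = b + a" by (rule prodring_eqI) (simp_all add: component_ops r)
  show "0 + a = a" by (rule prodring_eqI) (simp_all add: component_ops r)
  show "- a + a = 0" by (rule prodring_eqI) (simp_all add: component_ops r)
  show "a - b = a + - b" by (rule minus_prodring_def)
  show "(a + b) * c = a * c + b * c" by (rule prodring_eqI) (simp_all add: component_ops r distrib_right)
  show "(0::'a prodring) \<noteq> 1" by (metis component_ops(2,4) zero_neq_one)
qed

end

text \<open>The factors of the product are indexed by plain records, while \<open>K\<close> may
  carry extension fields; \<open>trunc\<close> forgets these.\<close>

definition trunc :: "('k, 'n) ring_scheme \<Rightarrow> 'k ring" where
  "trunc K = \<lparr>carrier = carrier K, mult = mult K, one = one K, zero = zero K, add = add K\<rparr>"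

lemma trunc_simps [simp]:
  "carrier (trunc K) = carrier K" "mult (trunc K) = mult K" "one (trunc K) = one K"
  "zero (trunc K) = zero K" "add (trunc K) = add K"
  by (simp_all add: trunc_def)

lemma cring_trunc:
  assumes "cring K" shows "cring (trunc K)"
proof -
  interpret cring K by fact
  show ?thesis
  proof (intro cringI abelian_groupI comm_monoidI)
    fix x assume "x \<in> carrier (trunc K)"
    then show "\<exists>y\<in>carrier (trunc K). y \<oplus>\<^bsub>trunc K\<^esub> x = \<zero>\<^bsub>trunc K\<^esub>"
      by (intro bexI[of _ "\<ominus>\<^bsub>K\<^esub> x"]) (simp_all add: l_neg)
  qed (simp_all add: a_ac m_ac l_distr r_distr)
qed

text \<open>The element is placed in one factor with zeros elsewhere, including the integer
  component. This is additive and multiplicative, but it sends the unit of \<open>K\<close> to a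
  proper idempotent.\<close>

definition embed :: "('k, 'n) ring_scheme \<Rightarrow> 'k \<Rightarrow> 'k prodring" where
  "embed K c = Abs_prodring (\<lambda>K'. if K' = trunc K then c else \<zero>\<^bsub>pad K'\<^esub>, 0)"

context cring
begin

lemma component_emb:
  assumes "c \<in> carrier R"
  shows "component (embed R c) K' = (if K' = trunc R then c else \<zero>\<^bsub>pad K'\<^esub>)" "int_component (embed R c) = 0"
proof -
  have "pad (trunc R) = trunc R" using cring_trunc[OF is_cring] by (rule pad_cring)
  then have "(if K' = trunc R then c else \<zero>\<^bsub>pad K'\<^esub>) \<in> carrier (pad K')" for K'
    using assms cring.cring_simprules(2)[OF cring_pad, of K'] by simp
  then show "component (embed R c) K' = (if K' = trunc R then c else \<zero>\<^bsub>pad K'\<^esub>)" "int_component (embed R c) = 0"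
    unfolding embed_def by (simp_all add: component_Abs)
qed

lemma pad_trunc: "pad (trunc R) = trunc R"
  using cring_trunc[OF is_cring] by (rule pad_cring)

lemma embed_ops:
  shows "embed R \<zero> = 0"
    "c \<in> carrier R \<Longrightarrow> d \<in> carrier R \<Longrightarrow> embed R (c \<oplus> d) = embed R c + embed R d"
    "c \<in> carrier R \<Longrightarrow> d \<in> carrier R \<Longrightarrow> embed R (c \<otimes> d) = embed R c * embed R d"
    "c \<in> carrier R \<Longrightarrow> embed R (\<ominus> c) = - embed R c"
proof -
  note r = cring.cring_simprules[OF cring_pad]
  show 0: "embed R \<zero> = 0"
    by (rule prodring_eqI) (simp_all add: component_emb component_ops pad_trunc)
  show add: "embed R (c \<oplus> d) = embed R c + embed R d" if "c \<in> carrier R" "d \<in> carrier R" for c d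
    using that by (intro prodring_eqI) (simp_all add: component_emb component_ops pad_trunc r)
  show "embed R (c \<otimes> d) = embed R c * embed R d" if "c \<in> carrier R" "d \<in> carrier R"
    using that by (intro prodring_eqI) (simp_all add: component_emb component_ops pad_trunc r)
  show "embed R (\<ominus> c) = - embed R c" if "c \<in> carrier R"
    using add[of "\<ominus> c" c] that 0 by (simp add: l_neg eq_neg_iff_add_eq_0)
qed

lemma inj_embed: "inj_on (embed R) (carrier R)"
proof (rule inj_onI)
  fix c d assume cd: "c \<in> carrier R" "d \<in> carrier R" "embed R c = embed R d"
  have "c = component (embed R c) (trunc R)" by (simp only: component_emb(1)[OF cd(1)] if_True simp_thms)
  also have "\<dots> = component (embed R d) (trunc R)" unfolding cd(3) ..
  also have "\<dots> = d" by (simp only: component_emb(1)[OF cd(2)] if_True simp_thms)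
  finally show "c = d" .
qed

lemma embed_finsum:
  assumes "finite A" "f \<in> A \<rightarrow> carrier R"
  shows "embed R (finsum R f A) = (\<Sum>x\<in>A. embed R (f x))"
  using assms
proof (induction A rule: finite_induct)
  case (insert x A)
  then have "finsum R f A \<in> carrier R" by (intro finsum_closed) auto
  then show ?case using insert by (simp add: finsum_insert embed_ops Pi_iff)
qed (simp add: embed_ops)

abbreviation "D \<equiv> embed R ` carrier R"

lemma add_mult_closed_embed: "add_mult_closed D"
  unfolding add_mult_closed_def
proof (intro conjI ballI)
  show "0 \<in> D" using embed_ops(1) by (metis imageI zero_closed)
  fix a b assume "a \<in> D" "b \<in> D"
  then show "a + b \<in> D" "a * b \<in> D" by (auto simp flip: embed_ops(2,3))
qed

end

section \<open>Matrix rings over \<open>KS\<close> as blocks of finitary matrices\<close>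

lemma semigroup_algebra_carrier:
  "a \<in> carrier (semigroup_algebra K S) \<longleftrightarrow>
    (\<forall>s. a s \<in> carrier K) \<and> (\<forall>s. a s \<noteq> \<zero>\<^bsub>K\<^esub> \<longrightarrow> s \<in> carrier S) \<and> finite {s. a s \<noteq> \<zero>\<^bsub>K\<^esub>}"
  by (auto simp: semigroup_algebra_def)

locale algebra_setup = cring K + semigroup_on S
  for K :: "('k, 'n) ring_scheme" (structure) and S :: "('s, 'm) monoid_scheme"
begin

abbreviation R where "R \<equiv> semigroup_algebra K S"

lemma abelian_monoid_R: "abelian_monoid R"
proof (rule abelian_monoidI)
  fix x y assume xy: "x \<in> carrier R" "y \<in> carrier R"
  have "{s. x s \<oplus> y s \<noteq> \<zero>} \<subseteq> {s. x s \<noteq> \<zero>} \<union> {s. y s \<noteq> \<zero>}" by auto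
  moreover have "finite ({s. x s \<noteq> \<zero>} \<union> {s. y s \<noteq> \<zero>})"
    using xy by (simp add: semigroup_algebra_carrier)
  ultimately have "finite {s. x s \<oplus> y s \<noteq> \<zero>}" by (rule finite_subset)
  moreover have "s \<in> carrier S" if "x s \<oplus> y s \<noteq> \<zero>" for s
    using that xy unfolding semigroup_algebra_carrier by (cases "x s = \<zero>") auto
  ultimately show "x \<oplus>\<^bsub>R\<^esub> y \<in> carrier R"
    using xy unfolding semigroup_algebra_carrier by (simp add: semigroup_algebra_def)
qed (auto simp: semigroup_algebra_def a_assoc image_subset_iff intro!: ext a_comm)

lemma finsum_R_apply:
  assumes "finite A" "f \<in> A \<rightarrow> carrier R"
  shows "finsum R f A s = (\<Oplus>\<^bsub>K\<^esub>k\<in>A. f k s)"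
  using assms
proof (induction A rule: finite_induct)
  case empty
  then show ?case
    using abelian_monoid.finsum_empty[OF abelian_monoid_R, of f] by (simp add: semigroup_algebra_def)
next
  case (insert x A)
  have "finsum R f (insert x A) = f x \<oplus>\<^bsub>R\<^esub> finsum R f A"
    using insert by (intro abelian_monoid.finsum_insert[OF abelian_monoid_R]) auto
  then have "finsum R f (insert x A) s = f x s \<oplus> finsum R f A s"
    by (simp add: semigroup_algebra_def)
  also have "\<dots> = (\<Oplus>\<^bsub>K\<^esub>k\<in>insert x A. f k s)"
    using insert by (subst finsum_insert) (auto simp: semigroup_algebra_carrier Pi_iff)
  finally show ?case .
qed

definition pairs where
  "pairs a b s = {(t, u). a t \<noteq> \<zero> \<and> b u \<noteq> \<zero> \<and> t \<otimes>\<^bsub>S\<^esub> u = s}"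

lemma mult_R: "(a \<otimes>\<^bsub>R\<^esub> b) s = (\<Oplus>\<^bsub>K\<^esub>p\<in>pairs a b s. a (fst p) \<otimes> b (snd p))"
  by (simp add: semigroup_algebra_def pairs_def)

lemma finite_pairs:
  assumes "a \<in> carrier R" "b \<in> carrier R"
  shows "finite (pairs a b s)"
proof (rule finite_subset)
  show "pairs a b s \<subseteq> {t. a t \<noteq> \<zero>} \<times> {u. b u \<noteq> \<zero>}" by (auto simp: pairs_def)
  show "finite ({t. a t \<noteq> \<zero>} \<times> {u. b u \<noteq> \<zero>})" using assms by (simp add: semigroup_algebra_carrier)
qed

lemma mult_R_closed:
  assumes ab: "a \<in> carrier R" "b \<in> carrier R"
  shows "a \<otimes>\<^bsub>R\<^esub> b \<in> carrier R"
proof -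
  have cl: "a s \<in> carrier K" "b s \<in> carrier K" for s using ab by (auto simp: semigroup_algebra_carrier)
  have ne: "pairs a b s \<noteq> {}" if "(a \<otimes>\<^bsub>R\<^esub> b) s \<noteq> \<zero>" for s using that by (auto simp: mult_R)
  have "{s. (a \<otimes>\<^bsub>R\<^esub> b) s \<noteq> \<zero>} \<subseteq> (\<lambda>(t, u). t \<otimes>\<^bsub>S\<^esub> u) ` ({t. a t \<noteq> \<zero>} \<times> {u. b u \<noteq> \<zero>})"
    using ne by (fastforce simp: pairs_def)
  moreover have "finite ((\<lambda>(t, u). t \<otimes>\<^bsub>S\<^esub> u) ` ({t. a t \<noteq> \<zero>} \<times> {u. b u \<noteq> \<zero>}))"
    using ab by (simp add: semigroup_algebra_carrier)
  ultimately have "finite {s. (a \<otimes>\<^bsub>R\<^esub> b) s \<noteq> \<zero>}" by (rule finite_subset)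
  moreover have "s \<in> carrier S" if "(a \<otimes>\<^bsub>R\<^esub> b) s \<noteq> \<zero>" for s
    using ne[OF that] ab mclosed by (auto simp: pairs_def semigroup_algebra_carrier)
  moreover have "(a \<otimes>\<^bsub>R\<^esub> b) s \<in> carrier K" for s
    unfolding mult_R using cl by (intro finsum_closed) auto
  ultimately show ?thesis by (simp add: semigroup_algebra_carrier)
qed

text \<open>For carrier matrices the function has finite support, as \<open>Abs_poly_mapping\<close>
  demands: the finitely many entries are themselves finitely supported.\<close>

definition mat_fun :: "nat \<Rightarrow> ('s \<Rightarrow> 'k) mat \<Rightarrow> (nat \<times> nat \<times> 's \<Rightarrow>\<^sub>0 'k prodring)" where
  "mat_fun n A = Abs_poly_mapping (\<lambda>(i, j, s). if i < n \<and> j < n then embed K ((A $$ (i, j)) s) else 0)"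

abbreviation M where "M n \<equiv> matrix_ring n R"

lemma M_carrier: "A \<in> carrier (M n) \<longleftrightarrow> A \<in> carrier_mat n n \<and> (\<forall>i<n. \<forall>j<n. A $$ (i, j) \<in> carrier R)"
  by (simp add: matrix_ring_def)

lemma embed_eq_0: "c \<in> carrier K \<Longrightarrow> embed K c = 0 \<longleftrightarrow> c = \<zero>"
  using inj_embed embed_ops(1) by (metis inj_onD zero_closed)

lemma lookup_mat_fun:
  assumes A: "A \<in> carrier (M n)"
  shows "lkp (mat_fun n A) (i, j, s) = (if i < n \<and> j < n then embed K ((A $$ (i, j)) s) else 0)"
proof -
  let ?f = "\<lambda>(i, j, s). if i < n \<and> j < n then embed K ((A $$ (i, j)) s) else 0"
  let ?X = "{..<n} \<times> {..<n} \<times> (\<Union>i<n. \<Union>j<n. {s. (A $$ (i, j)) s \<noteq> \<zero>})"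
  have "{x. ?f x \<noteq> 0} \<subseteq> ?X"
  proof
    fix x assume "x \<in> {x. ?f x \<noteq> 0}"
    moreover obtain i j s where x: "x = (i, j, s)" by (metis surj_pair)
    ultimately have "i < n" "j < n" "embed K ((A $$ (i, j)) s) \<noteq> 0" by (auto split: if_splits)
    moreover from this(3) have "(A $$ (i, j)) s \<noteq> \<zero>" using embed_ops(1) by metis
    ultimately show "x \<in> ?X" unfolding x by blast
  qed
  moreover have "finite ?X"
    using A by (auto simp: M_carrier semigroup_algebra_carrier)
  ultimately have "finite {x. ?f x \<noteq> 0}" by (rule finite_subset)
  then show ?thesis unfolding mat_fun_def by (subst lookup_Abs_poly_mapping) auto
qed

lemma mat_fun_closed:
  assumes A: "A \<in> carrier (M n)"
  shows "mat_fun n A \<in> fin_mats S D" "supp (mat_fun n A) \<subseteq> block n (carrier S)"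
proof -
  have "lkp (mat_fun n A) x \<in> D" for x
    using A add_mult_closed_embed
    by (cases x) (auto simp: lookup_mat_fun M_carrier semigroup_algebra_carrier add_mult_closed_def)
  moreover show "supp (mat_fun n A) \<subseteq> block n (carrier S)"
    using A by (auto simp: in_keys_iff lookup_mat_fun M_carrier semigroup_algebra_carrier embed_eq_0 split: if_splits)
  ultimately show "mat_fun n A \<in> fin_mats S D" by (auto simp: coeffs_in_def)
qed

lemma mat_fun_inj:
  assumes A: "A \<in> carrier (M n)" and B: "B \<in> carrier (M n)" and eq: "mat_fun n A = mat_fun n B"
  shows "A = B"
proof (rule eq_matI)
  show "dim_row A = dim_row B" "dim_col A = dim_col B" using A B by (auto simp: M_carrier)
  fix i j assume "i < dim_row B" "j < dim_col B"
  then have ij: "i < n" "j < n" using B by (auto simp: M_carrier)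
  show "A $$ (i, j) = B $$ (i, j)"
  proof
    fix s
    have "embed K ((A $$ (i, j)) s) = embed K ((B $$ (i, j)) s)"
      using arg_cong[OF eq, of "\<lambda>f. lkp f (i, j, s)"] ij by (simp add: lookup_mat_fun A B)
    moreover have "(A $$ (i, j)) s \<in> carrier K" "(B $$ (i, j)) s \<in> carrier K"
      using A B ij by (auto simp: M_carrier semigroup_algebra_carrier)
    ultimately show "(A $$ (i, j)) s = (B $$ (i, j)) s" using inj_embed by (auto dest: inj_onD)
  qed
qed

lemma mat_fun_surj:
  assumes f: "f \<in> fin_mats S D" "supp f \<subseteq> block n (carrier S)"
  shows "\<exists>A\<in>carrier (M n). mat_fun n A = f"
proof -
  have D: "lkp f x \<in> D" for x using f(1) unfolding coeffs_in_def by blast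
  define g where "g = inv_into (carrier K) (embed K)"
  have g: "g d \<in> carrier K" "embed K (g d) = d" if "d \<in> D" for d
    unfolding g_def using that by (rule inv_into_into, rule f_inv_into_f)
  have g0: "g 0 = \<zero>" unfolding g_def using inv_into_f_f[OF inj_embed zero_closed] by (simp add: embed_ops)
  define A where "A = mat n n (\<lambda>(i, j) s. g (lkp f (i, j, s)))"
  have "(\<lambda>s. g (lkp f (i, j, s))) \<in> carrier R" for i j
  proof -
    have "{s. g (lkp f (i, j, s)) \<noteq> \<zero>} \<subseteq> (snd \<circ> snd) ` supp f"
      proof
      fix s assume "s \<in> {s. g (lkp f (i, j, s)) \<noteq> \<zero>}"
      then have "(i, j, s) \<in> supp f" using g0 by (auto simp: in_keys_iff)
      then show "s \<in> (snd \<circ> snd) ` supp f" by (rule image_eqI[rotated]) simp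
    qed
    then have "finite {s. g (lkp f (i, j, s)) \<noteq> \<zero>}" by (rule finite_subset) simp
    moreover have "s \<in> carrier S" if "g (lkp f (i, j, s)) \<noteq> \<zero>" for s
    proof -
      have "(i, j, s) \<in> supp f" using that g0 by (auto simp: in_keys_iff)
      then show ?thesis using f(2) by auto
    qed
    ultimately show ?thesis using g(1)[OF D] by (simp add: semigroup_algebra_carrier)
  qed
  then have A: "A \<in> carrier (M n)" by (simp add: M_carrier A_def)
  have "mat_fun n A = f"
  proof (rule poly_mapping_eqI)
    fix x :: "nat \<times> nat \<times> 's"
    obtain i j s where x: "x = (i, j, s)" by (metis surj_pair)
    show "lkp (mat_fun n A) x = lkp f x"
    proof (cases "i < n \<and> j < n")
      case True
      then have "A $$ (i, j) = (\<lambda>s. g (lkp f (i, j, s)))" by (simp add: A_def)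
      then show ?thesis using True g(2)[OF D] by (simp add: x lookup_mat_fun[OF A])
    next
      case False
      then have "x \<notin> supp f" using f(2) x by auto
      then show ?thesis using False by (auto simp: x lookup_mat_fun[OF A] in_keys_iff)
    qed
  qed
  then show ?thesis using A by blast
qed

lemma M_mult_closed:
  assumes A: "A \<in> carrier (M n)" and B: "B \<in> carrier (M n)"
  shows "A \<otimes>\<^bsub>M n\<^esub> B \<in> carrier (M n)"
proof -
  have "(\<Oplus>\<^bsub>R\<^esub>k\<in>{..<n}. A $$ (i, k) \<otimes>\<^bsub>R\<^esub> B $$ (k, j)) \<in> carrier R" if "i < n" "j < n" for i j
    using A B that by (intro abelian_monoid.finsum_closed[OF abelian_monoid_R]) (auto simp: M_carrier mult_R_closed)
  then show ?thesis unfolding M_carrier by (simp add: matrix_ring_def)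
qed

lemma mat_fun_mult:
  assumes A: "A \<in> carrier (M n)" and B: "B \<in> carrier (M n)"
  shows "mat_fun n (A \<otimes>\<^bsub>M n\<^esub> B) = conv S (mat_fun n A) (mat_fun n B)"
proof (rule poly_mapping_eqI)
  fix x :: "nat \<times> nat \<times> 's"
    obtain i j s where x: "x = (i, j, s)" by (metis surj_pair)
  \<comment> \<open>The convolution in \<open>semigroup_algebra\<close> sums over pairs with nonzero
    coefficients, a set that varies with \<open>k\<close> and \<open>s\<close>. All these sums are
    extended by zeros to the fixed square of \<open>F\<close>.\<close>
  define F where "F = (snd \<circ> snd) ` (supp (mat_fun n A) \<union> supp (mat_fun n B))"
  have F: "finite F" by (simp add: F_def)
  have inF: "a \<in> block n F" if "a \<in> supp (mat_fun n A) \<union> supp (mat_fun n B)" for a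
  proof -
    have "a \<in> block n (carrier S)" using that mat_fun_closed(2)[OF A] mat_fun_closed(2)[OF B] by blast
    moreover have "snd (snd a) \<in> F" unfolding F_def using that by (intro image_eqI[of _ _ a]) auto
    ultimately show ?thesis by (cases a) auto
  qed
  have sA: "supp (mat_fun n A) \<subseteq> UNIV \<times> {..<n} \<times> F" and sB: "supp (mat_fun n B) \<subseteq> {..<n} \<times> UNIV \<times> F"
    using inF by fast+
  have cl: "(A $$ (i, k)) t \<in> carrier K" "(B $$ (k, j)) t \<in> carrier K" if "i < n" "j < n" "k < n" for i j k t
    using A B that by (auto simp: M_carrier semigroup_algebra_carrier)
  show "lkp (mat_fun n (A \<otimes>\<^bsub>M n\<^esub> B)) x = lkp (conv S (mat_fun n A) (mat_fun n B)) x"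
  proof (cases "i < n \<and> j < n")
    case False
    then show ?thesis
      unfolding x lookup_mat_fun[OF M_mult_closed[OF A B]] lookup_conv_mat[OF F sA sB]
      by (auto intro!: sum.neutral simp: lookup_mat_fun[OF A] lookup_mat_fun[OF B])
  next
    case True
    let ?q = "\<lambda>k p. if fst p \<otimes>\<^bsub>S\<^esub> snd p = s
      then lkp (mat_fun n A) (i, k, fst p) * lkp (mat_fun n B) (k, j, snd p) else 0"
    let ?P = "\<lambda>k. pairs (A $$ (i, k)) (B $$ (k, j)) s"
    have mR: "A $$ (i, k) \<otimes>\<^bsub>R\<^esub> B $$ (k, j) \<in> carrier R" if "k < n" for k
      using A B True that by (intro mult_R_closed) (auto simp: M_carrier)
    have fP: "finite (?P k)" if "k < n" for k
      using A B True that by (intro finite_pairs) (auto simp: M_carrier)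
    have "lkp (mat_fun n (A \<otimes>\<^bsub>M n\<^esub> B)) x = embed K ((\<Oplus>\<^bsub>R\<^esub>k\<in>{..<n}. A $$ (i, k) \<otimes>\<^bsub>R\<^esub> B $$ (k, j)) s)"
      unfolding x lookup_mat_fun[OF M_mult_closed[OF A B]] using True by (simp add: matrix_ring_def)
    also have "\<dots> = embed K (\<Oplus>\<^bsub>K\<^esub>k\<in>{..<n}. (A $$ (i, k) \<otimes>\<^bsub>R\<^esub> B $$ (k, j)) s)"
      using mR by (subst finsum_R_apply) auto
    also have "\<dots> = (\<Sum>k<n. embed K ((A $$ (i, k) \<otimes>\<^bsub>R\<^esub> B $$ (k, j)) s))"
      using mR by (intro embed_finsum) (auto simp: semigroup_algebra_carrier)
    also have "\<dots> = (\<Sum>k<n. \<Sum>p\<in>?P k. embed K ((A $$ (i, k)) (fst p) \<otimes> (B $$ (k, j)) (snd p)))"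
      unfolding mult_R using fP cl True by (intro sum.cong refl embed_finsum) auto
    also have "\<dots> = (\<Sum>k<n. \<Sum>p\<in>F \<times> F. ?q k p)"
    proof (rule sum.cong[OF refl])
      fix k assume "k \<in> {..<n}"
      then have k: "k < n" by simp
      have ne: "(A $$ (i, k)) t \<noteq> \<zero> \<longleftrightarrow> (i, k, t) \<in> supp (mat_fun n A)"
        "(B $$ (k, j)) t \<noteq> \<zero> \<longleftrightarrow> (k, j, t) \<in> supp (mat_fun n B)" for t
        using True k cl by (simp_all add: in_keys_iff lookup_mat_fun A B embed_eq_0)
      have "(\<Sum>p\<in>F \<times> F. ?q k p)
        = (\<Sum>p\<in>?P k. ?q k p)"
      proof (rule sum.mono_neutral_right)
        show "?P k \<subseteq> F \<times> F" using inF unfolding pairs_def ne by fastforce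
        show "\<forall>p\<in>F \<times> F - ?P k. (?q k p) = 0"
          unfolding pairs_def ne by (auto simp: in_keys_iff)
      qed (simp add: F)
      also have "\<dots> = (\<Sum>p\<in>?P k. embed K ((A $$ (i, k)) (fst p) \<otimes> (B $$ (k, j)) (snd p)))"
        using True k by (intro sum.cong refl) (auto simp: pairs_def lookup_mat_fun A B embed_ops cl)
      finally show "(\<Sum>p\<in>?P k. embed K ((A $$ (i, k)) (fst p) \<otimes> (B $$ (k, j)) (snd p))) = (\<Sum>p\<in>F \<times> F. ?q k p)" by simp
    qed
    also have "\<dots> = lkp (conv S (mat_fun n A) (mat_fun n B)) x"
      unfolding x lookup_conv_mat[OF F sA sB] by (simp add: sum.cartesian_product' case_prod_unfold cong: if_cong)
    finally show ?thesis .
  qed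
qed

text \<open>\<open>mat_fun n\<close> is an injective multiplicative map onto the finitary matrices
  over \<open>D\<close> supported in the block of size \<open>n\<close>. Relations can therefore be
  carried in both directions.\<close>

theorem stably_finite_iff: "stably_finite R \<longleftrightarrow> dedekind_conv S D"
proof
  assume C: "dedekind_conv S D"
  show "stably_finite R"
    unfolding stably_finite_def dedekind_finite_def
  proof (intro allI impI ballI)
    fix n e u v
    assume e: "e \<in> carrier (M n)" "e \<otimes>\<^bsub>M n\<^esub> e = e" and u: "u \<in> corner (M n) e" and v: "v \<in> corner (M n) e"
      and uv: "u \<otimes>\<^bsub>M n\<^esub> v = e"
    let ?f = "mat_fun n"
    have fin: "?f A \<in> fin_mats S D" "supp (?f A) \<subseteq> entries S" if "A \<in> carrier (M n)" for A
      using mat_fun_closed[OF that] by (auto simp: coeffs_in_def)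
    have ee: "conv S (?f e) (?f e) = ?f e" using mat_fun_mult[OF e(1,1)] e(2) by simp
    \<comment> \<open>The element has the form \<open>exe\<close>. That \<open>e\<close> acts on it
      as a unit is derived after applying \<open>mat_fun\<close>, where associativity is
      available.\<close>
    have corner: "a \<in> carrier (M n) \<and> conv S (?f e) (?f a) = ?f a \<and> conv S (?f a) (?f e) = ?f a"
      if a: "a \<in> corner (M n) e" for a
    proof -
      obtain x where x: "x \<in> carrier (M n)" "a = e \<otimes>\<^bsub>M n\<^esub> x \<otimes>\<^bsub>M n\<^esub> e" using a by (auto simp: corner_def)
      have ex: "e \<otimes>\<^bsub>M n\<^esub> x \<in> carrier (M n)" by (rule M_mult_closed[OF e(1) x(1)])
      have aM: "a \<in> carrier (M n)" using M_mult_closed[OF ex e(1)] x(2) by simp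
      have fa: "?f a = conv S (?f (e \<otimes>\<^bsub>M n\<^esub> x)) (?f e)" using mat_fun_mult[OF ex e(1)] x(2) by simp
      have eex: "conv S (?f e) (?f (e \<otimes>\<^bsub>M n\<^esub> x)) = ?f (e \<otimes>\<^bsub>M n\<^esub> x)"
        using conv_assoc[OF fin(2)[OF e(1)] fin(2)[OF e(1)] fin(2)[OF x(1)]] ee mat_fun_mult[OF e(1) x(1)] by simp
      have "conv S (?f e) (?f a) = ?f a"
        using conv_assoc[OF fin(2)[OF e(1)] fin(2)[OF ex] fin(2)[OF e(1)]] eex fa by simp
      moreover have "conv S (?f a) (?f e) = ?f a"
        using conv_assoc[OF fin(2)[OF ex] fin(2)[OF e(1)] fin(2)[OF e(1)]] ee fa by simp
      ultimately show ?thesis using aM by simp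
    qed
    note cu = corner[OF u] and cv = corner[OF v]
    have "conv S (?f u) (?f v) = ?f e" using mat_fun_mult[of u n v] cu cv uv by simp
    then have "conv S (?f v) (?f u) = ?f e"
      using C[unfolded dedekind_conv_def, rule_format, of "?f e" "?f u" "?f v"] fin(1) e(1) cu cv ee by simp
    then have "?f (v \<otimes>\<^bsub>M n\<^esub> u) = ?f e" using mat_fun_mult[of v n u] cu cv by simp
    then show "v \<otimes>\<^bsub>M n\<^esub> u = e" using mat_fun_inj[OF M_mult_closed e(1)] cu cv by simp
  qed
next
  assume sf: "stably_finite R"
  show "dedekind_conv S D"
    unfolding dedekind_conv_def
  proof (intro ballI impI, elim conjE)
    fix e u v
    assume in': "e \<in> fin_mats S D" "u \<in> fin_mats S D" "v \<in> fin_mats S D"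
    assume r: "conv S e e = e" "conv S e u = u" "conv S u e = u" "conv S e v = v" "conv S v e = v" "conv S u v = e"
    have "\<exists>d. supp e \<union> supp u \<union> supp v \<subseteq> block d (carrier S)"
      using in' by (intro finite_entries_bounded) (auto simp: coeffs_in_def)
    then obtain d where d: "supp e \<union> supp u \<union> supp v \<subseteq> block d (carrier S)" by blast
    \<comment> \<open>The block may be empty, whereas stable finiteness speaks only of sizes at
      least one.\<close>
    define n where "n = Suc d"
    have "block d (carrier S) \<subseteq> block n (carrier S)" by (auto simp: n_def)
    then have n: "supp e \<subseteq> block n (carrier S)" "supp u \<subseteq> block n (carrier S)"
      "supp v \<subseteq> block n (carrier S)" using d by blast+
    obtain E U V where E: "E \<in> carrier (M n)" "mat_fun n E = e" and U: "U \<in> carrier (M n)" "mat_fun n U = u"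
      and V: "V \<in> carrier (M n)" "mat_fun n V = v"
      using mat_fun_surj[OF in'(1) n(1)] mat_fun_surj[OF in'(2) n(2)] mat_fun_surj[OF in'(3) n(3)] by blast
    have mm: "A \<otimes>\<^bsub>M n\<^esub> B = C" if "A \<in> carrier (M n)" "B \<in> carrier (M n)" "C \<in> carrier (M n)"
      "conv S (mat_fun n A) (mat_fun n B) = mat_fun n C" for A B C
      using mat_fun_inj[OF M_mult_closed[OF that(1,2)] that(3)] mat_fun_mult[OF that(1,2)] that(4) by simp
    have "E \<otimes>\<^bsub>M n\<^esub> U = U" "U \<otimes>\<^bsub>M n\<^esub> E = U" "E \<otimes>\<^bsub>M n\<^esub> V = V" "V \<otimes>\<^bsub>M n\<^esub> E = V"
      "U \<otimes>\<^bsub>M n\<^esub> V = E" "E \<otimes>\<^bsub>M n\<^esub> E = E"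
      using E U V r by (auto intro!: mm)
    note rel = this
    have "U \<in> corner (M n) E"
      unfolding corner_def using U(1) by (intro CollectI exI[of _ U]) (simp add: rel(1,2))
    moreover have "V \<in> corner (M n) E"
      unfolding corner_def using V(1) by (intro CollectI exI[of _ V]) (simp add: rel(3,4))
    moreover have "dedekind_finite (M n)" using sf by (simp add: stably_finite_def n_def)
    ultimately have "V \<otimes>\<^bsub>M n\<^esub> U = E" using E(1) rel(5,6) unfolding dedekind_finite_def by blast
    then show "conv S v u = e" using mat_fun_mult[OF V(1) U(1)] E U V by simp
  qed
qed

end

section \<open>Sofic groups\<close>

definition nilpotent :: "'a::comm_ring_1 \<Rightarrow> bool" where
  "nilpotent c \<longleftrightarrow> (\<exists>n. c ^ n = 0)"

lemma nilpotent_0 [simp]: "nilpotent 0"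
  unfolding nilpotent_def by (rule exI[of _ 1]) simp

lemma power_eq_0_mono: "(c::'a::comm_ring_1) ^ n = 0 \<Longrightarrow> n \<le> m \<Longrightarrow> c ^ m = 0"
  by (metis le_add_diff_inverse mult_zero_left power_add)

lemma nilpotent_mult_left: "nilpotent c \<Longrightarrow> nilpotent (d * c)"
  unfolding nilpotent_def by (metis mult_zero_right power_mult_distrib)

lemma nilpotent_mult_right: "nilpotent c \<Longrightarrow> nilpotent (c * d)"
  using nilpotent_mult_left[of c d] by (simp add: mult.commute)

lemma nilpotent_square: "nilpotent (c * c) \<Longrightarrow> nilpotent c"
  unfolding nilpotent_def by (metis power2_eq_square power_mult)

lemma nilpotent_minus: "nilpotent c \<Longrightarrow> nilpotent (- c)"
  using nilpotent_mult_left[of c "-1"] by simp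

lemma nilpotent_add:
  assumes "nilpotent a" "nilpotent b" shows "nilpotent (a + b)"
proof -
  obtain m n where mn: "a ^ m = 0" "b ^ n = 0" using assms by (auto simp: nilpotent_def)
  have "a ^ k * b ^ (m + n - k) = 0" for k
  proof (cases "m \<le> k")
    case True
    then show ?thesis using power_eq_0_mono[OF mn(1)] by simp
  next
    case False
    then show ?thesis using power_eq_0_mono[OF mn(2), of "m + n - k"] by simp
  qed
  then have "(a + b) ^ (m + n) = 0"
    unfolding binomial_ring by (intro sum.neutral) (simp add: mult.assoc)
  then show ?thesis by (auto simp: nilpotent_def)
qed

lemma nilpotent_diff: "nilpotent a \<Longrightarrow> nilpotent b \<Longrightarrow> nilpotent (a - b)"
  using nilpotent_add[of a "- b"] nilpotent_minus[of b] by simp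

lemma nilpotent_sum: "(\<And>i. i \<in> I \<Longrightarrow> nilpotent (f i)) \<Longrightarrow> nilpotent (sum f I)"
  by (induction I rule: infinite_finite_induct) (auto intro: nilpotent_add)

text \<open>Gaussian elimination over the reduced ring \<open>R[1/c] / nil\<close>, with denominators cleared.\<close>
lemma homogeneous_system:
  fixes M :: "'i \<Rightarrow> 'j \<Rightarrow> 'a::comm_ring_1"
  assumes "finite I" "finite J" "card I < card J" "\<not> nilpotent c"
  shows "\<exists>x. (\<forall>i\<in>I. nilpotent (c * (\<Sum>j\<in>J. M i j * x j))) \<and> (\<exists>j\<in>J. \<not> nilpotent (c * x j))"
  using assms
proof (induction I arbitrary: J M c rule: finite_induct)
  case empty
  then have "J \<noteq> {}" by auto
  then show ?case using empty by (intro exI[of _ "\<lambda>_. 1"]) auto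
next
  case (insert i0 I)
  show ?case
  proof (cases "\<exists>p\<in>J. \<not> nilpotent (c * M i0 p)")
    case True
    then obtain p where p: "p \<in> J" "\<not> nilpotent (c * M i0 p)" by blast
    define \<pi> where "\<pi> = M i0 p"
    \<comment> \<open>Eliminating the unknown \<open>p\<close> by cross-multiplication with the
      pivot. The induction hypothesis is applied with \<open>c * \<pi>\<close> in place of
      \<open>c\<close>, which amounts to inverting the pivot too.\<close>
    define M' where "M' i j = \<pi> * M i j - M i0 j * M i p" for i j
    have card: "card I < card (J - {p})" using insert p by simp
    obtain y j0 where y: "\<forall>i\<in>I. nilpotent ((c * \<pi>) * (\<Sum>j\<in>J-{p}. M' i j * y j))"
      and j0: "j0 \<in> J - {p}" "\<not> nilpotent ((c * \<pi>) * y j0)"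
      using insert.IH[of "J - {p}" "c * \<pi>" M'] card p insert.prems unfolding \<pi>_def by auto
    \<comment> \<open>One factor \<open>\<pi>\<close> clears the denominator in the pivot row. The
      second one makes each row equal to \<open>\<pi>\<close> times the reduced row, as needed
      because the induction hypothesis controls that row only after multiplication by
      \<open>c * \<pi>\<close>.\<close>
    define x where "x j = (if j = p then - \<pi> * (\<Sum>j\<in>J-{p}. M i0 j * y j) else \<pi> * \<pi> * y j)" for j
    have split: "(\<Sum>j\<in>J. M i j * x j) = \<pi> * (\<Sum>j\<in>J-{p}. M' i j * y j)" for i
    proof -
      have "(\<Sum>j\<in>J. M i j * x j) = M i p * x p + (\<Sum>j\<in>J-{p}. M i j * x j)"
        using insert.prems(1) p(1) by (rule sum.remove)
      also have "(\<Sum>j\<in>J-{p}. M i j * x j) = (\<Sum>j\<in>J-{p}. M i j * (\<pi> * \<pi> * y j))"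
        by (intro sum.cong) (auto simp: x_def)
      also have "M i p * x p = (\<Sum>j\<in>J-{p}. - M i p * \<pi> * M i0 j * y j)"
        by (simp add: x_def sum_distrib_left sum_negf mult.assoc mult.left_commute)
      finally show ?thesis
        by (simp add: M'_def sum_distrib_left sum.distrib[symmetric] algebra_simps)
    qed
    have "nilpotent (c * (\<Sum>j\<in>J. M i j * x j))" if "i \<in> insert i0 I" for i
    proof (cases "i = i0")
      case True
      then have "M' i j = 0" for j by (simp add: M'_def \<pi>_def)
      then show ?thesis by (simp add: split)
    next
      case False
      then show ?thesis using y that by (simp add: split mult.assoc)
    qed
    moreover have "\<not> nilpotent (c * x j0)"
    proof
      assume "nilpotent (c * x j0)"
      \<comment> \<open>This product is a square of the element known not to be nilpotent.\<close>
      then have "nilpotent ((c * x j0) * (c * y j0))" by (rule nilpotent_mult_right)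
      moreover have "(c * x j0) * (c * y j0) = (c * \<pi> * y j0) * (c * \<pi> * y j0)"
        using j0 by (simp add: x_def algebra_simps)
      ultimately show False using nilpotent_square j0 by metis
    qed
    ultimately show ?thesis using j0 by blast
  next
    \<comment> \<open>Every coefficient of row \<open>i0\<close> is nilpotent after multiplication
      by \<open>c\<close>, so the row imposes no condition.\<close>
    case False
    have "card I < card J" using insert by simp
    then obtain x where x: "\<forall>i\<in>I. nilpotent (c * (\<Sum>j\<in>J. M i j * x j))" "\<exists>j\<in>J. \<not> nilpotent (c * x j)"
      using insert.IH[of J c M] insert.prems by blast
    have "nilpotent (c * (\<Sum>j\<in>J. M i0 j * x j))"
      unfolding sum_distrib_left mult.assoc[symmetric]
      by (rule nilpotent_sum, rule nilpotent_mult_right) (use False in auto)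
    then show ?thesis using x by blast
  qed
qed

text \<open>Over a field, \<open>1 - AB\<close> and \<open>1 - BA\<close> have the same rank; a scalar submatrix of \<open>1 - BA\<close> with
  non-nilpotent diagonal is the substitute for a lower bound on that rank.\<close>
lemma nilpotent_of_scalar_submatrix:
  fixes A B :: "'z \<Rightarrow> 'z \<Rightarrow> 'a::comm_ring_1"
  assumes Z: "finite Z" and R: "R \<subseteq> Z" and M: "finite M" "2 * card R < card M"
    and p: "p ` M \<subseteq> Z" and q: "q ` M \<subseteq> Z"
    and AB: "\<And>z w. z \<in> Z \<Longrightarrow> w \<in> Z - R \<Longrightarrow> (\<Sum>k\<in>Z. A z k * B k w) = (if z = w then 1 else 0)"
    and BA: "\<And>k l. k \<in> M \<Longrightarrow> l \<in> M \<Longrightarrow>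
      (if p k = q l then 1 else 0) - (\<Sum>z\<in>Z. B (p k) z * A z (q l)) = (if k = l then c else 0)"
  shows "nilpotent c"
proof (rule ccontr)
  assume nc: "\<not> nilpotent c"
  define Y where "Y z l = (if z = q l then 1 else 0) - (\<Sum>k\<in>Z. B z k * A k (q l))" for z l
  \<comment> \<open>The unknowns are a vector \<open>u\<close> on \<open>Z - R\<close> and a vector
    \<open>t\<close> on \<open>M\<close>. The rows from \<open>Z\<close> demand
    \<open>Bu + Yt = 0\<close>, with \<open>Y\<close> made of the columns \<open>q l\<close> of
    \<open>1 - BA\<close>; the rows from \<open>R\<close> demand that \<open>A\<close> applied to
    \<open>t\<close> placed on the columns \<open>q l\<close> vanishes on \<open>R\<close>. There
    are fewer equations than unknowns exactly because \<open>2 * card R < card M\<close>. The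
    solution is then shown to be trivial after inverting \<open>c\<close> and modulo
    nilpotents.\<close>
  define N where "N i j = (case i of Inl z \<Rightarrow> (case j of Inl w \<Rightarrow> B z w | Inr l \<Rightarrow> Y z l)
     | Inr r \<Rightarrow> (case j of Inl w \<Rightarrow> 0 | Inr l \<Rightarrow> A r (q l)))" for i j
  let ?I = "Z <+> R" and ?J = "(Z - R) <+> M"
  have fR: "finite R" using Z R finite_subset by blast
  have "card R \<le> card Z" using Z R card_mono by blast
  then have card: "card ?I < card ?J"
    using M Z R fR by (simp add: card_Plus card_Diff_subset)
  obtain x where x: "\<forall>i\<in>?I. nilpotent (c * (\<Sum>j\<in>?J. N i j * x j))" "\<exists>j\<in>?J. \<not> nilpotent (c * x j)"
    using homogeneous_system[OF _ _ card nc, of N] Z M fR by auto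
  define u where "u w = x (Inl w)" for w
  define t where "t l = x (Inr l)" for l
  define E where "E z = (\<Sum>w\<in>Z-R. B z w * u w) + (\<Sum>l\<in>M. Y z l * t l)" for z
  define F where "F r = (\<Sum>l\<in>M. A r (q l) * t l)" for r
  have E: "nilpotent (c * E z)" if "z \<in> Z" for z
    using x(1)[rule_format, OF InlI[OF that]] Z M
    by (simp add: sum.Plus N_def E_def u_def t_def)
  have F: "nilpotent (c * F r)" if "r \<in> R" for r
    using x(1)[rule_format, OF InrI[OF that]] Z M
    by (simp add: sum.Plus N_def F_def u_def t_def)
  define X where "X z w = (if z = w then 1 else 0) - (\<Sum>k\<in>Z. A z k * B k w)" for z w
  \<comment> \<open>This is \<open>A(1 - BA) = (1 - AB)A\<close>, combined with the fact that the
    columns of \<open>1 - AB\<close> outside \<open>R\<close> are zero.\<close>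
  have AY: "(\<Sum>z\<in>Z. A y z * Y z l) = (\<Sum>k\<in>R. X y k * A k (q l))" if "y \<in> Z" "l \<in> M" for y l
  proof -
    have ql: "q l \<in> Z" using that q by auto
    have "(\<Sum>z\<in>Z. A y z * Y z l) = (\<Sum>z\<in>Z. if z = q l then A y z else 0)
        - (\<Sum>z\<in>Z. \<Sum>k\<in>Z. A y z * B z k * A k (q l))"
      by (simp add: Y_def right_diff_distrib sum_subtractf sum_distrib_left mult.assoc if_distrib[of "(*) _"])
    also have "(\<Sum>z\<in>Z. if z = q l then A y z else 0) = A y (q l)"
      using ql Z by (simp add: sum.delta')
    also have "(\<Sum>z\<in>Z. \<Sum>k\<in>Z. A y z * B z k * A k (q l)) = (\<Sum>k\<in>Z. (\<Sum>z\<in>Z. A y z * B z k) * A k (q l))"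
      by (subst sum.swap) (simp add: sum_distrib_right)
    also have "\<dots> = (\<Sum>k\<in>Z. (if y = k then 1 else 0) * A k (q l)) - (\<Sum>k\<in>Z. X y k * A k (q l))"
      unfolding sum_subtractf[symmetric] by (intro sum.cong) (auto simp: X_def algebra_simps)
    also have "(\<Sum>k\<in>Z. (if y = k then 1 else 0) * A k (q l)) = (\<Sum>k\<in>Z. if y = k then A k (q l) else 0)"
      by (intro sum.cong) auto
    also have "\<dots> = A y (q l)" using that Z by (simp add: sum.delta)
    also have "(\<Sum>k\<in>Z. X y k * A k (q l)) = (\<Sum>k\<in>R. X y k * A k (q l))"
      using AB that by (intro sum.mono_neutral_right Z R) (auto simp: X_def)
    finally show ?thesis by simp
  qed
  \<comment> \<open>Applying \<open>A\<close> to \<open>Bu + Yt\<close> recovers \<open>u\<close>,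
    since \<open>AB\<close> is the identity on the columns outside \<open>R\<close>; the part coming
    from \<open>t\<close> is expressed by the equations with index in \<open>R\<close>.\<close>
  have u: "u y = (\<Sum>z\<in>Z. A y z * E z) - (\<Sum>k\<in>R. X y k * F k)" if y: "y \<in> Z - R" for y
  proof -
    have "(\<Sum>z\<in>Z. A y z * E z) = (\<Sum>z\<in>Z. \<Sum>w\<in>Z-R. A y z * B z w * u w) + (\<Sum>z\<in>Z. \<Sum>l\<in>M. A y z * Y z l * t l)"
      by (simp add: E_def distrib_left sum.distrib sum_distrib_left mult.assoc)
    also have "(\<Sum>z\<in>Z. \<Sum>w\<in>Z-R. A y z * B z w * u w) = (\<Sum>w\<in>Z-R. (\<Sum>z\<in>Z. A y z * B z w) * u w)"
      by (subst sum.swap) (simp add: sum_distrib_right)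
    also have "\<dots> = (\<Sum>w\<in>Z-R. if y = w then u w else 0)"
      using y by (intro sum.cong refl) (simp add: AB)
    also have "\<dots> = u y" using y Z by (simp add: sum.delta)
    also have "(\<Sum>z\<in>Z. \<Sum>l\<in>M. A y z * Y z l * t l) = (\<Sum>l\<in>M. (\<Sum>z\<in>Z. A y z * Y z l) * t l)"
      by (subst sum.swap) (simp add: sum_distrib_right)
    also have "\<dots> = (\<Sum>l\<in>M. \<Sum>k\<in>R. X y k * A k (q l) * t l)"
      using y by (intro sum.cong refl) (simp add: AY sum_distrib_right)
    also have "\<dots> = (\<Sum>k\<in>R. X y k * F k)"
      by (subst sum.swap) (simp add: F_def sum_distrib_left mult.assoc)
    finally show ?thesis by simp
  qed
  have nu: "nilpotent (c * u y)" if "y \<in> Z - R" for y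
  proof -
    have "c * u y = (\<Sum>z\<in>Z. A y z * (c * E z)) - (\<Sum>k\<in>R. X y k * (c * F k))"
      unfolding u[OF that] by (simp add: right_diff_distrib sum_distrib_left mult.left_commute)
    then show ?thesis by (simp only:, intro nilpotent_diff nilpotent_sum) (simp_all add: nilpotent_mult_left E F)
  qed
  have nt: "nilpotent (c * t k)" if k: "k \<in> M" for k
  proof -
    \<comment> \<open>With \<open>u\<close> negligible, the row \<open>p k\<close> of the system
      reads \<open>c * t k\<close>, because the chosen submatrix is scalar.\<close>
    have "(\<Sum>l\<in>M. Y (p k) l * t l) = (\<Sum>l\<in>M. if k = l then c * t l else 0)"
      using BA k by (intro sum.cong refl) (simp add: Y_def)
    also have "\<dots> = c * t k" using k M by (simp add: sum.delta)
    finally have "c * (c * t k) = c * E (p k) - (\<Sum>w\<in>Z-R. B (p k) w * (c * u w))"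
      by (simp add: E_def distrib_left sum_distrib_left mult.left_commute)
    moreover have "p k \<in> Z" using p k by auto
    ultimately have "nilpotent (c * (c * t k))"
      by (simp only:, intro nilpotent_diff nilpotent_sum) (simp_all add: nilpotent_mult_left E nu)
    then have "nilpotent (c * (c * t k) * t k)" by (rule nilpotent_mult_right)
    then have "nilpotent ((c * t k) * (c * t k))" by (simp add: mult_ac)
    then show ?thesis by (rule nilpotent_square)
  qed
  show False using x(2) nu nt by (auto simp: u_def t_def)
qed

text \<open>A finitely generated nil ideal is nilpotent, so an idempotent with nilpotent coefficients
  vanishes; \<open>s\<close> generates the last nonzero layer.\<close>
lemma exists_annihilating_scalar:
  fixes f :: "'x \<Rightarrow> 'a::comm_ring_1"
  assumes "finite Q" "\<And>c. c \<in> Q \<Longrightarrow> nilpotent c" "f x0 \<noteq> 0"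
  shows "\<exists>s. (\<exists>x. s * f x \<noteq> 0) \<and> (\<forall>c\<in>Q. \<forall>x. s * c * f x = 0)"
  using assms
proof (induction Q rule: finite_induct)
  case empty
  then show ?case by (intro exI[of _ 1]) auto
next
  case (insert c Q)
  then obtain s where s: "\<exists>x. s * f x \<noteq> 0" "\<forall>c\<in>Q. \<forall>x. s * c * f x = 0" by auto
  obtain n where n: "c ^ n = 0" using insert.prems by (auto simp: nilpotent_def)
  let ?P = "\<lambda>k. \<forall>x. s * c ^ k * f x = 0"
  \<comment> \<open>The exponent \<open>m\<close> is positive since \<open>s\<close> does not kill
    \<open>f\<close>. The power just before it still does not kill \<open>f\<close>, but one more
    factor \<open>c\<close> does.\<close>
  define m where "m = (LEAST k. ?P k)"
  have m: "?P m" unfolding m_def by (rule LeastI[of ?P n]) (simp add: n)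
  have "m \<noteq> 0" using s(1) m by (metis mult.right_neutral power_0)
  then obtain k where k: "m = Suc k" by (cases m) auto
  have nk: "\<not> ?P k" using not_less_Least[of k ?P] k unfolding m_def by simp
  show ?case
  proof (intro exI[of _ "s * c ^ k"] conjI ballI allI)
    show "\<exists>x. s * c ^ k * f x \<noteq> 0" using nk by blast
    fix d x assume "d \<in> insert c Q"
    then consider "d = c" | "d \<in> Q" by blast
    then show "s * c ^ k * d * f x = 0"
    proof cases
      case 1
      then show ?thesis using m k by (simp add: mult_ac)
    next
      case 2
      then have "c ^ k * (s * d * f x) = 0" using s by simp
      then show ?thesis by (simp add: mult_ac)
    qed
  qed
qed

text \<open>A maximal independent set dominates: every vertex conflicts with one of its members, and
  each member accounts for at most \<open>D\<close> vertices, itself included.\<close>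

lemma max_independent_set:
  assumes "finite V" "\<And>y. y \<in> V \<Longrightarrow> conf y y" "\<And>y y'. conf y y' \<Longrightarrow> conf y' y"
    "\<And>y. y \<in> V \<Longrightarrow> card {y' \<in> V. conf y y'} \<le> D"
  shows "\<exists>Y\<subseteq>V. (\<forall>y\<in>Y. \<forall>y'\<in>Y. conf y y' \<longrightarrow> y = y') \<and> card V \<le> D * card Y"
proof -
  let ?I = "{Y. Y \<subseteq> V \<and> (\<forall>y\<in>Y. \<forall>y'\<in>Y. conf y y' \<longrightarrow> y = y')}"
  have "finite ?I" using assms(1) by simp
  moreover have "{} \<in> ?I" by simp
  ultimately obtain Y where Y: "Y \<in> ?I" "\<forall>Y'\<in>?I. Y \<subseteq> Y' \<longrightarrow> Y = Y'"
    using finite_has_maximal[of ?I] by (metis (no_types, lifting) emptyE)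
  have fin: "finite Y" using Y(1) assms(1) finite_subset by auto
  have "V \<subseteq> (\<Union>y\<in>Y. {y' \<in> V. conf y y'})"
  proof
    fix z assume z: "z \<in> V"
    show "z \<in> (\<Union>y\<in>Y. {y' \<in> V. conf y y'})"
    proof (rule ccontr)
      assume nz: "\<not> ?thesis"
      then have "insert z Y \<in> ?I" using Y(1) z assms(3) by auto
      then have "z \<in> Y" using Y(2) by blast
      then show False using nz z assms(2) by blast
    qed
  qed
  then have "card V \<le> card (\<Union>y\<in>Y. {y' \<in> V. conf y y'})"
    using fin assms(1) by (intro card_mono) auto
  also have "\<dots> \<le> (\<Sum>y\<in>Y. card {y' \<in> V. conf y y'})" using fin by (rule card_UN_le)
  also have "\<dots> \<le> (\<Sum>y\<in>Y. D)" using Y(1) assms(4) by (intro sum_mono) auto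
  finally show ?thesis using Y(1) by (auto simp: mult.commute)
qed

text \<open>What remains of soficity once the bad points are known: genuine permutations that need
  not form an action, but behave like one for factors in \<open>F\<close> at the points of
  \<open>Good\<close>.\<close>

locale almost_action = group G for G (structure) +
  fixes n :: nat and \<sigma> :: "'a \<Rightarrow> nat \<Rightarrow> nat" and F :: "'a set" and Good :: "nat set"
  assumes finF: "finite F" and FG: "F \<subseteq> carrier G" and oneF: "\<one> \<in> F"
    and perm: "g \<in> carrier G \<Longrightarrow> \<sigma> g permutes {1..n}"
    and Good: "Good \<subseteq> {1..n}"
    and act: "\<lbrakk>g \<in> F; h \<in> F; y \<in> Good\<rbrakk> \<Longrightarrow> \<sigma> g (\<sigma> h y) = \<sigma> (g \<otimes> h) y"
begin

text \<open>Each group element in \<open>F\<close> is replaced by the permutation matrix of its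
  image under \<open>\<sigma>\<close>, so a block of size \<open>d\<close> becomes a matrix of size
  \<open>d * n\<close> over the coefficients.\<close>

definition rep_mat :: "('a, 'c::comm_ring_1) fin_mat \<Rightarrow> nat \<times> nat \<Rightarrow> nat \<times> nat \<Rightarrow> 'c" where
  "rep_mat A = (\<lambda>(i, x) (j, y). \<Sum>g\<in>F. if \<sigma> g y = x then lkp A (i, j, g) else 0)"

lemma one_act: "y \<in> Good \<Longrightarrow> \<sigma> \<one> y = y"
  using act[OF oneF oneF, of y] permutes_inj[OF perm[OF one_closed]]
  by (auto simp: inj_def)

text \<open>In a column over a good point \<open>y\<close>, following \<open>h\<close> and then
  \<open>g\<close> leads to the same place as following \<open>g \<otimes> h\<close>, so there the
  representation is multiplicative. The products may leave \<open>F\<close>, hence the larger index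
  set \<open>P\<close>.\<close>

lemma rep_mat_mult:
  assumes A: "supp A \<subseteq> block d F" and B: "supp B \<subseteq> block d F"
    and P: "finite P" "\<And>g h. g \<in> F \<Longrightarrow> h \<in> F \<Longrightarrow> g \<otimes> h \<in> P" and y: "y \<in> Good"
  shows "(\<Sum>z\<in>{..<d} \<times> {1..n}. rep_mat A (i, x) z * rep_mat B z (j, y)) =
    (\<Sum>p\<in>P. if \<sigma> p y = x then lkp (conv G A B) (i, j, p) else 0)"
proof -
  have yn: "y \<in> {1..n}" using y Good by auto
  have in_n: "\<sigma> h y \<in> {1..n}" if "h \<in> F" for h
    using permutes_in_image[OF perm] yn that FG by blast
  let ?t = "\<lambda>k z g h. (if \<sigma> g z = x then lkp A (i, k, g) else 0) * (if \<sigma> h y = z then lkp B (k, j, h) else 0)"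
  let ?c = "\<lambda>p k g h. if p = g \<otimes> h \<and> \<sigma> p y = x then lkp A (i, k, g) * lkp B (k, j, h) else 0"
  have "(\<Sum>z\<in>{..<d} \<times> {1..n}. rep_mat A (i, x) z * rep_mat B z (j, y)) =
    (\<Sum>k<d. \<Sum>z=1..n. \<Sum>g\<in>F. \<Sum>h\<in>F. ?t k z g h)"
    by (simp add: rep_mat_def sum.cartesian_product' sum_product)
  also have "\<dots> = (\<Sum>k<d. \<Sum>g\<in>F. \<Sum>h\<in>F. \<Sum>p\<in>P. ?c p k g h)"
  proof (rule sum.cong[OF refl])
    fix k
    have "(\<Sum>z=1..n. \<Sum>g\<in>F. \<Sum>h\<in>F. ?t k z g h)
       = (\<Sum>g\<in>F. \<Sum>z=1..n. \<Sum>h\<in>F. ?t k z g h)"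
      by (rule sum.swap)
    also have "\<dots> = (\<Sum>g\<in>F. \<Sum>h\<in>F. \<Sum>z=1..n. ?t k z g h)"
      by (intro sum.cong refl sum.swap)
    also have "\<dots> = (\<Sum>g\<in>F. \<Sum>h\<in>F. \<Sum>p\<in>P. ?c p k g h)"
    proof (intro sum.cong refl)
      fix g h assume gh: "g \<in> F" "h \<in> F"
      have "(\<Sum>z=1..n. ?t k z g h)
        = (\<Sum>z=1..n. if \<sigma> h y = z then (if \<sigma> g (\<sigma> h y) = x then lkp A (i, k, g) * lkp B (k, j, h) else 0) else 0)"
        by (intro sum.cong) auto
      also have "\<dots> = (if \<sigma> (g \<otimes> h) y = x then lkp A (i, k, g) * lkp B (k, j, h) else 0)"
        using in_n[OF gh(2)] act[OF gh y] by (simp add: sum.delta)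
      also have "\<dots> = (\<Sum>p\<in>P. if p = g \<otimes> h then (if \<sigma> (g \<otimes> h) y = x then lkp A (i, k, g) * lkp B (k, j, h) else 0) else 0)"
        using P(1) P(2)[OF gh] by (simp add: sum.delta')
      also have "\<dots> = (\<Sum>p\<in>P. ?c p k g h)"
        by (intro sum.cong) auto
      finally show "(\<Sum>z=1..n. ?t k z g h)
        = (\<Sum>p\<in>P. ?c p k g h)" .
    qed
    finally show "(\<Sum>z=1..n. \<Sum>g\<in>F. \<Sum>h\<in>F. ?t k z g h)
      = (\<Sum>g\<in>F. \<Sum>h\<in>F. \<Sum>p\<in>P. ?c p k g h)" .
  qed
  also have "\<dots> = (\<Sum>(k, g, h)\<in>{..<d} \<times> F \<times> F. \<Sum>p\<in>P. ?c p k g h)"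
    by (simp add: sum.cartesian_product')
  also have "\<dots> = (\<Sum>p\<in>P. \<Sum>(k, g, h)\<in>{..<d} \<times> F \<times> F. ?c p k g h)"
    unfolding case_prod_unfold by (rule sum.swap)
  also have "\<dots> = (\<Sum>p\<in>P. if \<sigma> p y = x then lkp (conv G A B) (i, j, p) else 0)"
  proof (rule sum.cong[OF refl])
    fix p
    have *: "supp A \<subseteq> UNIV \<times> {..<d} \<times> F" "supp B \<subseteq> {..<d} \<times> UNIV \<times> F" using A B by auto
    show "(\<Sum>(k, g, h)\<in>{..<d} \<times> F \<times> F. ?c p k g h) = (if \<sigma> p y = x then lkp (conv G A B) (i, j, p) else 0)"
      unfolding lookup_conv_mat[OF finF *] by (auto simp: eq_commute[of p] intro!: sum.cong)
  qed
  finally show ?thesis .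
qed

end

context almost_action begin

text \<open>\<open>Y\<close> consists of good points whose translates by \<open>F\<close> are
  disjoint. In the matrix of \<open>1 - BA\<close>, the rows at \<open>\<sigma> g0 y\<close> in
  block row \<open>i0\<close> and the columns at \<open>y\<close> in block column \<open>j0\<close>
  then form a scalar matrix whose diagonal is the coefficient in question. The columns over bad
  points play the part of \<open>R\<close> in \<open>nilpotent_of_scalar_submatrix\<close>.\<close>

lemma nilpotent_coeff:
  fixes A B C :: "('a, 'c::comm_ring_1) fin_mat"
  assumes A: "supp A \<subseteq> block d F" and B: "supp B \<subseteq> block d F"
    and AB: "conv G A B = unit_mat G d" and C: "C = unit_mat G d - conv G B A"
    and suppC: "supp C \<subseteq> block d F"
    and ij: "i0 < d" "j0 < d" "g0 \<in> F"
    and Y: "Y \<subseteq> Good" "\<And>y y' g g'. \<lbrakk>y \<in> Y; y' \<in> Y; g \<in> F; g' \<in> F; \<sigma> g y = \<sigma> g' y'\<rbrakk> \<Longrightarrow> y = y'"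
      "\<And>y g. \<lbrakk>y \<in> Y; (i0, j0, g) \<in> supp C; \<sigma> g y = \<sigma> g0 y\<rbrakk> \<Longrightarrow> g = g0"
    and card: "2 * (d * card ({1..n} - Good)) < card Y"
  shows "nilpotent (lkp C (i0, j0, g0))"
proof -
  let ?Z = "{..<d} \<times> {1..n}" and ?R = "{..<d} \<times> ({1..n} - Good)"
  define P where "P = F \<union> (\<lambda>(g, h). g \<otimes> h) ` (F \<times> F)"
  have P: "finite P" "\<And>g h. g \<in> F \<Longrightarrow> h \<in> F \<Longrightarrow> g \<otimes> h \<in> P" "F \<subseteq> P"
    using finF by (auto simp: P_def)
  have oneP: "\<one> \<in> P" using oneF P by auto
  have AB': "(\<Sum>k\<in>?Z. rep_mat A z k * rep_mat B k w) = (if z = w then 1 else 0)"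
    if z: "z \<in> ?Z" and w: "w \<in> ?Z - ?R" for z w
  proof -
    obtain i x j y where [simp]: "z = (i, x)" "w = (j, y)" by (metis surj_pair)
    have y: "y \<in> Good" "j < d" using w by auto
    have "(\<Sum>k\<in>?Z. rep_mat A z k * rep_mat B k w)
      = (\<Sum>p\<in>P. if \<sigma> p y = x then lkp (unit_mat G d :: _ \<Rightarrow>\<^sub>0 'c) (i, j, p) else 0)"
      using rep_mat_mult[OF A B P(1,2) y(1), of i x j] unfolding AB by simp
    also have "\<dots> = (\<Sum>p\<in>P. if p = \<one> then (if z = w then 1 else 0) else 0)"
      using one_act[OF y(1)] y by (intro sum.cong refl) (auto simp: lookup_unit_mat)
    finally show ?thesis using P oneP by (simp add: sum.delta')
  qed
  have BA': "(if (i0, \<sigma> g0 k) = (j0, l) then 1 else 0) - (\<Sum>z\<in>?Z. rep_mat B (i0, \<sigma> g0 k) z * rep_mat A z (j0, l))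
      = (if k = l then lkp C (i0, j0, g0) else 0)" if kl: "k \<in> Y" "l \<in> Y" for k l
  proof -
    have l: "l \<in> Good" using kl Y by auto
    have CB: "lkp (conv G B A) x = lkp (unit_mat G d) x - lkp C x" for x
      by (simp add: C lookup_minus)
    have "(\<Sum>z\<in>?Z. rep_mat B (i0, \<sigma> g0 k) z * rep_mat A z (j0, l))
      = (\<Sum>p\<in>P. if \<sigma> p l = \<sigma> g0 k then lkp (conv G B A) (i0, j0, p) else 0)"
      by (rule rep_mat_mult[OF B A P(1,2) l])
    also have "\<dots> = (\<Sum>p\<in>P. if p = \<one> then (if (i0, \<sigma> g0 k) = (j0, l) then 1 else 0) else 0)
        - (\<Sum>p\<in>P. if \<sigma> p l = \<sigma> g0 k then lkp C (i0, j0, p) else 0)"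
      unfolding sum_subtractf[symmetric]
      using one_act[OF l] ij by (intro sum.cong refl) (auto simp: lookup_unit_mat CB)
    also have "(\<Sum>p\<in>P. if p = \<one> then (if (i0, \<sigma> g0 k) = (j0, l) then 1 else 0) else 0)
       = (if (i0, \<sigma> g0 k) = (j0, l) then 1 else (0::'c))"
      using P oneP by (simp add: sum.delta')
    also have "(\<Sum>p\<in>P. if \<sigma> p l = \<sigma> g0 k then lkp C (i0, j0, p) else 0)
       = (\<Sum>p\<in>P. if p = g0 then (if k = l then lkp C (i0, j0, g0) else 0) else 0)"
    proof (intro sum.cong refl)
      fix p
      show "(if \<sigma> p l = \<sigma> g0 k then lkp C (i0, j0, p) else 0)
         = (if p = g0 then (if k = l then lkp C (i0, j0, g0) else 0) else 0)"
      proof (cases "(i0, j0, p) \<in> supp C")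
        case True
        then have "p \<in> F" using suppC by auto
        show ?thesis
        proof (cases "\<sigma> p l = \<sigma> g0 k")
          case eq: True
          \<comment> \<open>A nonzero contribution makes translates of \<open>l\<close> and
            \<open>k\<close> meet, so the two points agree; at a single point of \<open>Y\<close>
            distinct support elements act differently from \<open>g0\<close>, so \<open>p\<close> is
            \<open>g0\<close>.\<close>
          have "l = k" by (rule Y(2)[OF kl(2,1) \<open>p \<in> F\<close> ij(3) eq])
          moreover have "p = g0" using Y(3)[OF kl(2) True] eq \<open>l = k\<close> by simp
          ultimately show ?thesis by simp
        qed auto
      next
        case False
        then show ?thesis by (auto simp: in_keys_iff)
      qed
    qed
    also have "\<dots> = (if k = l then lkp C (i0, j0, g0) else 0)"
      using P ij by (simp add: sum.delta' subset_eq)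
    finally show ?thesis by simp
  qed
  have "finite Y" using finite_subset[OF Y(1) finite_subset[OF Good]] by simp
  moreover have "2 * card ?R < card Y" using card by (simp add: card_cartesian_product)
  moreover have "(\<lambda>y. (i0, \<sigma> g0 y)) ` Y \<subseteq> ?Z"
  proof -
    have "\<sigma> g0 y \<in> {1..n}" if "y \<in> Y" for y
    proof -
      have "g0 \<in> carrier G" "y \<in> {1..n}" using ij FG Y(1) Good that by auto
      then show ?thesis using permutes_in_image[OF perm, of g0 y] by simp
    qed
    then show ?thesis using ij by auto
  qed
  moreover have "(\<lambda>y. (j0, y)) ` Y \<subseteq> ?Z" using ij Y(1) Good by auto
  moreover have "finite ?Z" "?R \<subseteq> ?Z" by (simp, blast)
  ultimately show ?thesis
    by (intro nilpotent_of_scalar_submatrix[where Z = ?Z and R = ?R and M = Y and p = "\<lambda>y. (i0, \<sigma> g0 y)"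
          and q = "\<lambda>y. (j0, y)" and A = "rep_mat A" and B = "rep_mat B"] AB' BA')
qed

end

lemma (in group) sofic_nilpotent_coeff:
  fixes A B C :: "('a, 'c::comm_ring_1) fin_mat"
  assumes sofic: "sofic G"
    and A: "supp A \<subseteq> block d (carrier G)" and B: "supp B \<subseteq> block d (carrier G)"
    and AB: "conv G A B = unit_mat G d" and C: "C = unit_mat G d - conv G B A"
    and suppC: "supp C \<subseteq> block d (carrier G)"
  shows "nilpotent (lkp C x0)"
proof (cases "x0 \<in> supp C")
  case False
  then show ?thesis by (simp add: in_keys_iff)
next
  case True
  obtain i0 j0 g0 where x0: "x0 = (i0, j0, g0)" by (metis surj_pair)
  have ij: "i0 < d" "j0 < d" "g0 \<in> carrier G" using True suppC x0 by auto
  define H where "H = insert \<one> ((snd \<circ> snd) ` (supp A \<union> supp B \<union> supp C))"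
  have H: "finite H" "H \<subseteq> carrier G" "\<one> \<in> H" "g0 \<in> H"
    "supp A \<subseteq> block d H" "supp B \<subseteq> block d H" "supp C \<subseteq> block d H"
  proof -
    show "finite H" by (simp add: H_def)
    show "H \<subseteq> carrier G" using A B suppC by (auto simp: H_def)
    show "\<one> \<in> H" by (simp add: H_def)
    show "g0 \<in> H" using True x0 by (force simp: H_def)
    have *: "snd (snd x) \<in> H" if "x \<in> supp A \<union> supp B \<union> supp C" for x
      using that unfolding H_def by (intro insertI2 image_eqI[where x = x]) simp_all
    have **: "x \<in> block d H" if "x \<in> supp A \<union> supp B \<union> supp C" for x
    proof -
      have "x \<in> block d (carrier G)" using that A B suppC by blast
      then show ?thesis using *[OF that] by (cases x) simp
    qed
    show "supp A \<subseteq> block d H" "supp B \<subseteq> block d H"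
      "supp C \<subseteq> block d H"
      using ** by blast+
  qed
  \<comment> \<open>The elements \<open>inv g0 \<otimes> g\<close> turn a coincidence
    \<open>\<sigma> g y = \<sigma> g0 y\<close> into a fixed point, which the second clause of
    soficity makes rare.\<close>
  define F where "F = H \<union> insert (inv g0) ((\<lambda>g. inv g0 \<otimes> g) ` H)"
  have F: "finite F" "F \<subseteq> carrier G" "\<one> \<in> F" "H \<subseteq> F" "inv g0 \<in> F"
    using H ij by (auto simp: F_def)
  define q where "q = card F"
  have q: "q \<ge> 1" using F by (auto simp: q_def Suc_le_eq card_gt_0_iff)
  \<comment> \<open>Chosen backwards. If \<open>card Y\<close> were at most
    \<open>2 * d * card Bad\<close>, then \<open>card Good \<le> q^2 * card Y\<close> would give
    \<open>n \<le> (2 * d * q^2 + 1) * card Bad\<close>, which is impossible for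
    \<open>card Bad \<le> \<kappa> * n\<close>. The divisor \<open>2 * q^2\<close> in
    \<open>\<epsilon>\<close> pays for the \<open>q^2\<close> multiplicativity defects and for at
    most \<open>q\<close> fixed point sets, bounded by another \<open>q^2\<close>.\<close>
  define \<kappa> :: real where "\<kappa> = 1 / (2 * d * q^2 + 2)"
  define \<epsilon> where "\<epsilon> = \<kappa> / (2 * q^2)"
  have \<kappa>: "\<kappa> > 0" by (simp add: \<kappa>_def add_pos_nonneg)
  then have \<epsilon>: "\<epsilon> > 0" using q by (simp add: \<epsilon>_def)
  obtain n \<sigma> where n: "n \<ge> 1" and \<sigma>: "\<sigma> \<in> carrier G \<rightarrow> carrier (sym_group n)"
    and mult: "\<And>g h. g \<in> F \<Longrightarrow> h \<in> F \<Longrightarrow>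
      real (card {x \<in> {1..n}. (\<sigma> g \<otimes>\<^bsub>sym_group n\<^esub> \<sigma> h) x = \<sigma> (g \<otimes> h) x}) \<ge> (1 - \<epsilon>) * real n"
    and fixp: "\<And>g. g \<in> F \<Longrightarrow> g \<noteq> \<one> \<Longrightarrow> real (card {x \<in> {1..n}. \<sigma> g x = x}) \<le> \<epsilon> * real n"
    using sofic[unfolded sofic_def, rule_format, of F \<epsilon>] F \<epsilon> by blast
  have perm: "\<sigma> g permutes {1..n}" if "g \<in> carrier G" for g
    using \<sigma> that by (auto simp: sym_group_def Pi_iff)
  define Bad1 where "Bad1 g h = {x \<in> {1..n}. \<sigma> g (\<sigma> h x) \<noteq> \<sigma> (g \<otimes> h) x}" for g h
  define Bad2 where "Bad2 g = {x \<in> {1..n}. \<sigma> g x = x}" for g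
  define Bad where "Bad = (\<Union>g\<in>F. \<Union>h\<in>F. Bad1 g h) \<union> (\<Union>g\<in>F-{\<one>}. Bad2 g)"
  define Good where "Good = {1..n} - Bad"
  have Badn: "Bad \<subseteq> {1..n}" by (auto simp: Bad_def Bad1_def Bad2_def)
  have b1: "real (card (Bad1 g h)) \<le> \<epsilon> * n" if "g \<in> F" "h \<in> F" for g h
  proof -
    let ?A = "{x \<in> {1..n}. (\<sigma> g \<otimes>\<^bsub>sym_group n\<^esub> \<sigma> h) x = \<sigma> (g \<otimes> h) x}"
    have sub: "?A \<subseteq> {1..n}" by blast
    have "Bad1 g h = {1..n} - ?A"
      by (auto simp: Bad1_def sym_group_def)
    then have "card (Bad1 g h) = n - card ?A"
      using card_Diff_subset[OF finite_subset[OF sub] sub] by simp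
    moreover have "card ?A \<le> n" using card_mono[OF _ sub] by simp
    ultimately have "real (card (Bad1 g h)) = n - real (card ?A)" by (simp only: of_nat_diff)
    then show ?thesis using mult[OF that] by (simp add: algebra_simps)
  qed
  have "real (card Bad) \<le> real (\<Sum>g\<in>F. \<Sum>h\<in>F. card (Bad1 g h)) + real (\<Sum>g\<in>F-{\<one>}. card (Bad2 g))"
  proof -
    have "card Bad \<le> card (\<Union>g\<in>F. \<Union>h\<in>F. Bad1 g h) + card (\<Union>g\<in>F-{\<one>}. Bad2 g)"
      unfolding Bad_def by (rule card_Un_le)
    also have "card (\<Union>g\<in>F. \<Union>h\<in>F. Bad1 g h) \<le> (\<Sum>g\<in>F. card (\<Union>h\<in>F. Bad1 g h))"
      using F by (intro card_UN_le)
    also have "(\<Sum>g\<in>F. card (\<Union>h\<in>F. Bad1 g h)) \<le> (\<Sum>g\<in>F. \<Sum>h\<in>F. card (Bad1 g h))"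
      using F by (intro sum_mono card_UN_le)
    also have "card (\<Union>g\<in>F-{\<one>}. Bad2 g) \<le> (\<Sum>g\<in>F-{\<one>}. card (Bad2 g))"
      using F by (intro card_UN_le) auto
    finally show ?thesis by linarith
  qed
  also have "\<dots> \<le> (\<Sum>g\<in>F. \<Sum>h\<in>F. \<epsilon> * n) + (\<Sum>g\<in>F-{\<one>}. \<epsilon> * n)"
    unfolding of_nat_sum using b1 fixp by (intro add_mono sum_mono) (auto simp: Bad2_def)
  also have "\<dots> \<le> q^2 * (\<epsilon> * n) + q * (\<epsilon> * n)"
    using F \<epsilon> by (intro add_mono) (auto simp: q_def power2_eq_square intro!: mult_right_mono)
  also have "\<dots> \<le> q^2 * (\<epsilon> * n) + q^2 * (\<epsilon> * n)"
    using q \<epsilon> by (intro add_left_mono mult_right_mono) (auto simp: power2_eq_square simp flip: of_nat_mult)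
  also have "\<dots> = \<kappa> * n" using q by (simp add: \<epsilon>_def field_simps)
  finally have bad: "real (card Bad) \<le> \<kappa> * n" .
  interpret almost_action G n \<sigma> F Good
    by unfold_locales (use F perm in \<open>auto simp: Good_def Bad_def Bad1_def\<close>)
  \<comment> \<open>A point conflicts with at most \<open>q^2\<close> others, since
    \<open>y'\<close> is determined by \<open>y\<close> and the pair of elements whose translates
    meet.\<close>
  define conf where "conf y y' \<longleftrightarrow> (\<exists>g\<in>F. \<exists>g'\<in>F. \<sigma> g y = \<sigma> g' y')" for y y'
  have "\<exists>Y\<subseteq>Good. (\<forall>y\<in>Y. \<forall>y'\<in>Y. conf y y' \<longrightarrow> y = y') \<and> card Good \<le> q^2 * card Y"
  proof (rule max_independent_set)
    show "finite Good" by (simp add: Good_def)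
    show "conf y y" if "y \<in> Good" for y using F by (auto simp: conf_def)
    show "conf y' y" if "conf y y'" for y y' using that unfolding conf_def by (elim bexE, intro bexI) (erule sym)
    show "card {y' \<in> Good. conf y y'} \<le> q^2" for y
    proof -
      have "{y' \<in> Good. conf y y'} \<subseteq> (\<lambda>(g, g'). Hilbert_Choice.inv (\<sigma> g') (\<sigma> g y)) ` (F \<times> F)"
      proof
        fix y' assume "y' \<in> {y' \<in> Good. conf y y'}"
        then obtain g g' where g: "g \<in> F" "g' \<in> F" "\<sigma> g y = \<sigma> g' y'" by (auto simp: conf_def)
        then have "y' = Hilbert_Choice.inv (\<sigma> g') (\<sigma> g y)"
          using inv_f_f[OF permutes_inj[OF perm], of g' y'] F by auto
        then show "y' \<in> (\<lambda>(g, g'). Hilbert_Choice.inv (\<sigma> g') (\<sigma> g y)) ` (F \<times> F)" using g by force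
      qed
      then have "card {y' \<in> Good. conf y y'} \<le> card ((\<lambda>(g, g'). Hilbert_Choice.inv (\<sigma> g') (\<sigma> g y)) ` (F \<times> F))"
        using F by (intro card_mono) auto
      also have "\<dots> \<le> card (F \<times> F)" using F by (intro card_image_le) auto
      finally show ?thesis by (simp add: q_def card_cartesian_product power2_eq_square)
    qed
  qed
  then obtain Y where Y: "Y \<subseteq> Good" "\<And>y y'. y \<in> Y \<Longrightarrow> y' \<in> Y \<Longrightarrow> conf y y' \<Longrightarrow> y = y'"
    and cY: "card Good \<le> q^2 * card Y" by blast
  have GB: "{1..n} - Good = Bad" using Badn by (auto simp: Good_def)
  have "real (card Good) = n - card Bad"
    using Badn card_mono[OF _ Badn] by (simp add: Good_def card_Diff_subset finite_subset of_nat_diff)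
  have "2 * (d * card Bad) < card Y"
  proof (rule ccontr)
    assume "\<not> ?thesis"
    then have "card Good \<le> q^2 * (2 * (d * card Bad))"
      using cY by (meson le_trans mult_le_mono2 not_less)
    then have "real (card Good) \<le> real (q^2 * (2 * (d * card Bad)))" by (rule of_nat_mono)
    then have "real n \<le> (2 * d * q^2 + 1) * real (card Bad)"
      using \<open>real (card Good) = n - card Bad\<close> by (simp add: algebra_simps)
    also have "\<dots> \<le> (2 * d * q^2 + 1) * (\<kappa> * n)" using bad by (intro mult_left_mono) auto
    also have "\<dots> < (2 * d * q^2 + 2) * (\<kappa> * n)" using \<kappa> n by (intro mult_strict_right_mono) auto
    also have "\<dots> = n"
    proof -
      have "real (2 * d * q^2 + 2) \<noteq> 0" by linarith
      then show ?thesis unfolding \<kappa>_def by (simp add: field_simps)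
    qed
    finally show False by simp
  qed
  then have card: "2 * (d * card ({1..n} - Good)) < card Y" by (simp only: GB)
  show ?thesis unfolding x0
  proof (rule nilpotent_coeff[OF _ _ AB C _ ij(1,2) _ Y(1) _ _ card])
    fix y g assume y: "y \<in> Y" and g: "(i0, j0, g) \<in> supp C" "\<sigma> g y = \<sigma> g0 y"
    have yG: "y \<in> Good" using y Y by auto
    have gH: "g \<in> H" using g H by auto
    then have gF: "g \<in> F" "inv g0 \<otimes> g \<in> F" "g \<in> carrier G" using H by (auto simp: F_def)
    have "\<sigma> (inv g0 \<otimes> g) y = \<sigma> (inv g0) (\<sigma> g0 y)"
      using act[OF F(5) gF(1) yG] g by simp
    also have "\<dots> = y"
      using act[OF F(5) subsetD[OF F(4) H(4)] yG] one_act[OF yG] l_inv[OF ij(3)] by simp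
    finally have "y \<in> Bad2 (inv g0 \<otimes> g)" using yG Good by (auto simp: Bad2_def)
    then have "inv g0 \<otimes> g = \<one>" using yG gF(2) by (auto simp: Good_def Bad_def)
    then show "g = g0" using inv_solve_left'[OF one_closed ij(3) gF(3)] r_one[OF ij(3)] by simp
  next
    show "y = y'" if "y \<in> Y" "y' \<in> Y" "g \<in> F" "g' \<in> F" "\<sigma> g y = \<sigma> g' y'" for y y' g g'
    proof -
      have "conf y y'" using that(3-5) unfolding conf_def by (intro bexI)
      then show ?thesis by (rule Y(2)[OF that(1,2)])
    qed
    have *: "block d H \<subseteq> block d F" using F(4) by auto
    show "supp A \<subseteq> block d F" "supp B \<subseteq> block d F"
      "supp C \<subseteq> block d F"
      using order.trans[OF H(5) *] order.trans[OF H(6) *] order.trans[OF H(7) *] by simp_all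
    show "g0 \<in> F" using H(4) F(4) by (rule rev_subsetD)
  qed
qed

text \<open>Take \<open>s\<close> with \<open>sC\<close> nonzero and \<open>scC = 0\<close> for
  every coefficient \<open>c\<close> of \<open>C\<close>. Each coefficient of \<open>CC\<close> is a
  sum of products of two coefficients of \<open>C\<close>, so \<open>s\<close> kills
  \<open>CC = C\<close>, a contradiction.\<close>

lemma idempotent_of_nilpotent_eq_0:
  fixes C :: "('s, 'c::comm_ring_1) fin_mat"
  assumes idem: "conv S C C = C" and nil: "\<And>x. nilpotent (lkp C x)"
  shows "C = 0"
proof (rule ccontr)
  assume "C \<noteq> 0"
  then obtain x0 where "lkp C x0 \<noteq> 0" by (metis poly_mapping_eqI lookup_zero)
  then obtain s x where s: "s * lkp C x \<noteq> 0" "\<And>c y. c \<in> lkp C ` supp C \<Longrightarrow> s * c * lkp C y = 0"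
    using exists_annihilating_scalar[of "lkp C ` supp C" "lkp C" x0] nil by fastforce
  obtain i l t where x: "x = (i, l, t)" by (metis surj_pair)
  have "s * lkp C x = s * lkp (conv S C C) (i, l, t)" by (simp add: idem x)
  also have "\<dots> = 0"
    unfolding lookup_conv[OF finite_keys order.refl finite_keys order.refl] sum_distrib_left
    by (intro sum.neutral ballI) (simp add: s(2) mult.assoc[symmetric])
  finally show False using s(1) by simp
qed

theorem (in group) sofic_dedekind_conv:
  assumes "sofic G"
  shows "dedekind_conv G (UNIV :: 'c::comm_ring_1 set)"
proof (rule semigroup_on.dedekind_convI[OF is_semigroup_on])
  fix d and e u v z :: "('a, 'c) fin_mat"
  assume d: "supp e \<subseteq> block d (carrier G)" "supp u \<subseteq> block d (carrier G)"
    "supp v \<subseteq> block d (carrier G)" "supp z \<subseteq> block d (carrier G)"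
    and r: "conv G e e = e" "conv G e u = u" "conv G u e = u" "conv G e v = v" "conv G v e = v" "conv G u v = e"
    and z_def: "z = e - conv G v u" and zz: "conv G z z = z"
  define w :: "('a, 'c) fin_mat" where "w = unit_mat G d"
  have w: "supp w \<subseteq> block d (carrier G)"
    by (auto simp: w_def in_keys_iff lookup_unit_mat split: if_splits)
  have wl: "conv G w x = x" and wr: "conv G x w = x"
    if "supp x \<subseteq> block d (carrier G)" for x
    using that unfolding w_def by (auto intro!: conv_unit_mat_left conv_unit_mat_right)
  \<comment> \<open>Completing the corner of \<open>e\<close> to the whole block: adding
    \<open>w - e\<close> to both elements turns \<open>uv = e\<close> into \<open>AB = w\<close> and
    leaves the defect unchanged, that is \<open>w - BA = e - vu\<close>.\<close>
  define A where "A = u + (w - e)"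
  define B where "B = v + (w - e)"
  have supp_pd: "supp (x + (y - y')) \<subseteq> supp x \<union> supp y \<union> supp y'" for x y y' :: "('a, 'c) fin_mat"
    using Poly_Mapping.keys_add[of x "y - y'"] keys_diff[of y y'] by blast
  have sA: "supp A \<subseteq> block d (carrier G)" and sB: "supp B \<subseteq> block d (carrier G)"
    unfolding A_def B_def by (rule order.trans[OF supp_pd]; use d w in simp)+
  have ww: "conv G w w = w" using wl w by blast
  have AB: "conv G A B = w"
    using r wl[OF d(1)] wl[OF d(3)] wr[OF d(1)] wr[OF d(2)] ww
    by (simp add: A_def B_def conv_add_left conv_add_right conv_diff_left conv_diff_right)
  have z: "z = w - conv G B A"
    using r wl[OF d(1)] wl[OF d(2)] wr[OF d(1)] wr[OF d(3)] ww
    by (simp add: z_def A_def B_def conv_add_left conv_add_right conv_diff_left conv_diff_right)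
  have "nilpotent (lkp z x)" for x
    by (rule sofic_nilpotent_coeff[OF assms sA sB AB[unfolded w_def] z[unfolded w_def] d(4)])
  then show "z = 0" using idempotent_of_nilpotent_eq_0[OF zz] by blast
qed

section \<open>Complex group algebras\<close>

definition cinner :: "('x \<Rightarrow>\<^sub>0 complex) \<Rightarrow> ('x \<Rightarrow>\<^sub>0 complex) \<Rightarrow> complex" where
  "cinner f g = (\<Sum>x\<in>supp f. lkp f x * cnj (lkp g x))"

definition norm_sq :: "('x \<Rightarrow>\<^sub>0 complex) \<Rightarrow> real" where
  "norm_sq f = (\<Sum>x\<in>supp f. (cmod (lkp f x))\<^sup>2)"

definition scale :: "complex \<Rightarrow> ('x \<Rightarrow>\<^sub>0 complex) \<Rightarrow> ('x \<Rightarrow>\<^sub>0 complex)" where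
  "scale t f = Poly_Mapping.map ((*) t) f"

lemma lookup_scale: "lkp (scale t f) x = t * lkp f x"
  by (simp add: scale_def Poly_Mapping.map.rep_eq when_def)

lemma supp_scale: "supp (scale t f) \<subseteq> supp f"
  by (auto simp: in_keys_iff lookup_scale)

lemma cinner_superset: "finite A \<Longrightarrow> supp f \<subseteq> A \<Longrightarrow> cinner f g = (\<Sum>x\<in>A. lkp f x * cnj (lkp g x))"
  unfolding cinner_def by (rule sum.mono_neutral_left) (auto simp: in_keys_iff)

lemma norm_sq_superset: "finite A \<Longrightarrow> supp f \<subseteq> A \<Longrightarrow> norm_sq f = (\<Sum>x\<in>A. (cmod (lkp f x))\<^sup>2)"
  unfolding norm_sq_def by (rule sum.mono_neutral_left) (auto simp: in_keys_iff)

lemma cinner_cnj: "cinner g f = cnj (cinner f g)"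
  using cinner_superset[of "supp f \<union> supp g" f g] cinner_superset[of "supp f \<union> supp g" g f]
  by (simp add: mult.commute)

lemma cinner_diff_right: "cinner f (g - h) = cinner f g - cinner f h"
  by (simp add: cinner_def lookup_minus algebra_simps sum_subtractf)

lemma norm_sq_nonneg [simp]: "norm_sq f \<ge> 0"
  by (simp add: norm_sq_def sum_nonneg)

lemma cinner_self: "cinner f f = complex_of_real (norm_sq f)"
  by (simp add: cinner_def norm_sq_def complex_norm_square[symmetric])

lemma norm_sq_eq_0_iff: "norm_sq f = 0 \<longleftrightarrow> f = 0"
proof
  assume "norm_sq f = 0"
  then have "\<forall>x\<in>supp f. (cmod (lkp f x))\<^sup>2 = 0"
    unfolding norm_sq_def by (subst (asm) sum_nonneg_eq_0_iff) auto
  then show "f = 0" by (intro poly_mapping_eqI) (auto simp: in_keys_iff)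
qed (simp add: norm_sq_def)

lemma cmod_lookup_le: "cmod (lkp f x) \<le> sqrt (norm_sq f)"
proof (cases "x \<in> supp f")
  case True
  have "(cmod (lkp f x))\<^sup>2 \<le> norm_sq f"
    unfolding norm_sq_def using True by (intro member_le_sum) auto
  then show ?thesis by (simp add: real_le_rsqrt)
qed (simp add: in_keys_iff)

text \<open>Weaker than Cauchy-Schwarz, using only that the sup norm is at most the l2 norm. The l1
  factor is harmless because it will be bounded by the l1 norm of a fixed idempotent.\<close>

lemma cmod_cinner_le: "cmod (cinner f g) \<le> (\<Sum>x\<in>supp f. cmod (lkp f x)) * sqrt (norm_sq g)"
proof -
  have "cmod (cinner f g) \<le> (\<Sum>x\<in>supp f. cmod (lkp f x) * cmod (lkp g x))"
    unfolding cinner_def by (rule order.trans[OF norm_sum]) (simp add: norm_mult)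
  also have "\<dots> \<le> (\<Sum>x\<in>supp f. cmod (lkp f x) * sqrt (norm_sq g))"
    by (intro sum_mono mult_left_mono cmod_lookup_le) auto
  finally show ?thesis by (simp add: sum_distrib_right)
qed

lemma norm_sq_diff_scale:
  "norm_sq (f - scale t g) = norm_sq f + (cmod t)\<^sup>2 * norm_sq g - 2 * Re (cnj t * cinner f g)"
proof -
  let ?A = "supp f \<union> supp g"
  have A: "supp (f - scale t g) \<subseteq> ?A" using keys_diff[of f "scale t g"] supp_scale[of t g] by blast
  have pt: "(cmod (a - t * b))\<^sup>2 = (cmod a)\<^sup>2 + (cmod t)\<^sup>2 * (cmod b)\<^sup>2 - 2 * Re (cnj t * (a * cnj b))" for a b
    unfolding cmod_power2 by (simp add: power2_eq_square algebra_simps)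
  have "norm_sq (f - scale t g) = (\<Sum>x\<in>?A. (cmod (lkp f x))\<^sup>2 + (cmod t)\<^sup>2 * (cmod (lkp g x))\<^sup>2
      - 2 * Re (cnj t * (lkp f x * cnj (lkp g x))))"
    by (subst norm_sq_superset[OF _ A]) (simp_all add: lookup_minus lookup_scale pt)
  also have "\<dots> = norm_sq f + (cmod t)\<^sup>2 * norm_sq g - 2 * Re (cnj t * cinner f g)"
  proof -
    have "Re (cnj t * cinner f g) = (\<Sum>x\<in>?A. Re (cnj t * (lkp f x * cnj (lkp g x))))"
      by (simp only: cinner_superset[of ?A f, OF finite_UnI[OF finite_keys finite_keys] Un_upper1] sum_distrib_left Re_sum)
    then show ?thesis
      using norm_sq_superset[of ?A f] norm_sq_superset[of ?A g]
      by (simp only: finite_UnI[OF finite_keys finite_keys] Un_upper1 Un_upper2 simp_thms sum_subtractf sum.distrib sum_distrib_left)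
  qed
  finally show ?thesis .
qed

text \<open>An almost best approximation of \<open>w\<close> from a subspace is almost orthogonal to it. It replaces the
  orthogonal projection, which leaves the space of finitely supported functions.\<close>
lemma approx_projection:
  assumes I: "0 \<in> I" "\<And>f g. f \<in> I \<Longrightarrow> g \<in> I \<Longrightarrow> f + g \<in> I" "\<And>t f. f \<in> I \<Longrightarrow> scale t f \<in> I"
    and \<eta>: "\<eta> > 0"
  shows "\<exists>\<alpha>\<in>I. \<forall>\<beta>\<in>I. cmod (cinner \<beta> (w - \<alpha>)) \<le> \<eta> * sqrt (norm_sq \<beta>)"
proof -
  define d where "d = (INF \<alpha>\<in>I. norm_sq (w - \<alpha>))"
  have bdd: "bdd_below ((\<lambda>\<alpha>. norm_sq (w - \<alpha>)) ` I)" by (rule bdd_belowI2[where m=0]) simp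
  have "d < d + \<eta>\<^sup>2" using \<eta> by simp
  then obtain \<alpha> where \<alpha>: "\<alpha> \<in> I" "norm_sq (w - \<alpha>) < d + \<eta>\<^sup>2"
    unfolding d_def using cINF_less_iff[OF _ bdd] I(1) by (metis empty_iff)
  have "cmod (cinner \<beta> (w - \<alpha>)) \<le> \<eta> * sqrt (norm_sq \<beta>)" if \<beta>: "\<beta> \<in> I" for \<beta>
  proof (cases "\<beta> = 0")
    case True
    then show ?thesis by (simp add: cinner_def norm_sq_def)
  next
    case False
    then have b: "norm_sq \<beta> > 0" using norm_sq_eq_0_iff[of \<beta>] norm_sq_nonneg[of \<beta>] by linarith
    define z where "z = cinner (w - \<alpha>) \<beta>"
    \<comment> \<open>Moving from \<open>\<alpha>\<close> to \<open>\<alpha> + t \<beta>\<close>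
      with this \<open>t\<close> lowers the squared distance by
      \<open>(cmod z)\<^sup>2 / norm_sq \<beta>\<close>, and by the choice of
      \<open>\<alpha>\<close> no more than \<open>\<eta>\<^sup>2\<close> can be gained.\<close>
    define t where "t = z / complex_of_real (norm_sq \<beta>)"
    have "d \<le> norm_sq (w - (\<alpha> + scale t \<beta>))"
      unfolding d_def by (rule cINF_lower[OF bdd]) (use I \<alpha> \<beta> in auto)
    also have "w - (\<alpha> + scale t \<beta>) = (w - \<alpha>) - scale t \<beta>" by simp
    also have "norm_sq \<dots> = norm_sq (w - \<alpha>) + (cmod t)\<^sup>2 * norm_sq \<beta> - 2 * Re (cnj t * z)"
      unfolding norm_sq_diff_scale z_def ..
    also have "cnj t * z = complex_of_real ((cmod z)\<^sup>2 / norm_sq \<beta>)"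
      using complex_norm_square[of z] by (simp add: t_def mult.commute)
    also have "(cmod t)\<^sup>2 * norm_sq \<beta> = (cmod z)\<^sup>2 / norm_sq \<beta>"
      using b by (simp add: t_def norm_divide power_divide power2_eq_square)
    finally have "(cmod z)\<^sup>2 / norm_sq \<beta> \<le> \<eta>\<^sup>2" using \<alpha>(2) by simp
    then have "(cmod z)\<^sup>2 \<le> (\<eta> * sqrt (norm_sq \<beta>))\<^sup>2" using b by (simp add: power_mult_distrib divide_le_eq)
    then have "cmod z \<le> \<eta> * sqrt (norm_sq \<beta>)" by (rule power2_le_imp_le) (use \<eta> in simp)
    then show ?thesis unfolding z_def cinner_cnj[of \<beta> "w - \<alpha>"] by simp
  qed
  then show ?thesis using \<alpha>(1) by blast
qed

lemma conv_scale_right: "conv S f (scale t g) = scale t (conv S f g)"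
proof (rule poly_mapping_eqI)
  fix x :: "nat \<times> nat \<times> 'a"
  obtain i l u where x: "x = (i, l, u)" by (metis surj_pair)
  show "lkp (conv S f (scale t g)) x = lkp (scale t (conv S f g)) x"
    unfolding x lookup_scale lookup_conv[OF finite_keys[of f] order.refl finite_keys[of g] supp_scale]
      lookup_conv[OF finite_keys[of f] order.refl finite_keys[of g] order.refl] sum_distrib_left
    by (intro sum.cong refl) (simp add: lookup_scale)
qed

section \<open>Translations, adjoints and the trace\<close>

context group
begin

text \<open>The position to which the adjoint (conjugate transpose combined with inversion in the
  group) moves an entry.\<close>

fun inv_entry :: "nat \<times> nat \<times> 'a \<Rightarrow> nat \<times> nat \<times> 'a" where
  "inv_entry (a, b, g) = (b, a, inv g)"

lemma inv_entry_inv_entry [simp]: "x \<in> entries G \<Longrightarrow> inv_entry (inv_entry x) = x"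
  by (cases x) auto

lemma inv_entry_closed [simp]: "x \<in> entries G \<Longrightarrow> inv_entry x \<in> entries G"
  by (cases x) auto

lemma lookup_translate:
  assumes f: "supp f \<subseteq> entries G" and g: "g \<in> carrier G" "h \<in> carrier G"
  shows "lkp (conv G f (sng (a, b, g) (1::complex))) (i, l, h) = (if l = b then lkp f (i, a, h \<otimes> inv g) else 0)"
proof -
  have "lkp (conv G f (sng (a, b, g) (1::complex))) (i, l, h) = (\<Sum>x\<in>supp f. \<Sum>y\<in>{(a, b, g)}.
    if fst x = i \<and> fst (snd x) = fst y \<and> fst (snd y) = l \<and> snd (snd x) \<otimes> snd (snd y) = h
       then lkp f x * lkp (sng (a, b, g) 1) y else 0)"
    by (rule lookup_conv) auto
  also have "\<dots> = (\<Sum>x\<in>supp f. if x = (i, a, h \<otimes> inv g) then (if l = b then lkp f (i, a, h \<otimes> inv g) else 0) else 0)"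
  proof (rule sum.cong[OF refl])
    fix x assume x: "x \<in> supp f"
    obtain i' a' k where xk: "x = (i', a', k)" by (metis surj_pair)
    have k: "k \<in> carrier G" using f x xk by auto
    have "k \<otimes> g = h \<longleftrightarrow> k = h \<otimes> inv g" using k g by (metis inv_solve_right')
    then show "(\<Sum>y\<in>{(a, b, g)}. if fst x = i \<and> fst (snd x) = fst y \<and> fst (snd y) = l \<and> snd (snd x) \<otimes> snd (snd y) = h
       then lkp f x * lkp (sng (a, b, g) 1) y else 0) = (if x = (i, a, h \<otimes> inv g) then (if l = b then lkp f (i, a, h \<otimes> inv g) else 0) else 0)"
      unfolding xk by auto
  qed
  also have "\<dots> = (if l = b then lkp f (i, a, h \<otimes> inv g) else 0)"
    by (auto simp: sum.delta in_keys_iff)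
  finally show ?thesis .
qed

context
  fixes y :: "nat \<times> nat \<times> 'a" and f :: "('a, complex) fin_mat"
  assumes f: "supp f \<subseteq> entries G" and y: "y \<in> entries G"
begin

text \<open>Right multiplication by a matrix unit with a group element. It is a partial isometry of
  l2 whose adjoint is the translation by \<open>inv_entry y\<close>, and it maps right ideals into
  themselves.\<close>

abbreviation "translated \<equiv> conv G f (sng y 1)"

lemma translate_closed: "supp translated \<subseteq> entries G"
proof -
  interpret semigroup_on G by (rule is_semigroup_on)
  show ?thesis using conv_closed[OF add_mult_closed_UNIV, of f "sng y 1"] f y
    by (auto simp: coeffs_in_def)
qed

text \<open>The translation deletes all columns but one and moves that one injectively, so sums over
  the translate become sums over part of the support of \<open>f\<close>. All norm and inner product
  formulas below are instances.\<close>

lemma sum_translate: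
  fixes \<phi> :: "nat \<times> nat \<times> 'a \<Rightarrow> complex \<Rightarrow> 'c::comm_monoid_add"
  shows "(\<Sum>x\<in>supp translated. \<phi> x (lkp translated x)) =
    (\<Sum>x\<in>{x \<in> supp f. fst (snd x) = fst y}. \<phi> (fst x, fst (snd y), snd (snd x) \<otimes> snd (snd y)) (lkp f x))"
proof -
  obtain a b g where yg: "y = (a, b, g)" by (metis surj_pair)
  have g: "g \<in> carrier G" using y yg by auto
  have supp_tf: "\<exists>i h. x = (i, b, h) \<and> h \<in> carrier G" if "x \<in> supp translated" for x
    using that translate_closed lookup_translate[OF f g, of "snd (snd x)" a b "fst x" "fst (snd x)"]
    by (cases x) (auto simp: in_keys_iff yg split: if_splits)
  show ?thesis
  proof (rule sum.reindex_bij_witness[where j = "\<lambda>x. (fst x, a, snd (snd x) \<otimes> inv g)"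
        and i = "\<lambda>x. (fst x, b, snd (snd x) \<otimes> g)"], goal_cases)
    case (1 x)
    then obtain i h where x: "x = (i, b, h)" "h \<in> carrier G" using supp_tf by blast
    then show ?case using g by (simp add: m_assoc)
  next
    case (2 x)
    then obtain i h where x: "x = (i, b, h)" "h \<in> carrier G" using supp_tf by blast
    then show ?case using 2 lookup_translate[OF f g, of h a b i b] by (simp add: in_keys_iff yg)
  next
    case (3 x)
    then obtain i h where x: "x = (i, a, h)" "h \<in> carrier G" using f by (cases x) (auto simp: yg)
    then show ?case using g by (simp add: m_assoc)
  next
    case (4 x)
    then obtain i h where x: "x = (i, a, h)" "h \<in> carrier G" using f by (cases x) (auto simp: yg)
    then show ?case using 4 g lookup_translate[OF f g, of "h \<otimes> g" a b i b]
      by (simp add: in_keys_iff yg m_assoc)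
  next
    case (5 x)
    then obtain i h where x: "x = (i, b, h)" "h \<in> carrier G" using supp_tf by blast
    then show ?case using g lookup_translate[OF f g, of h a b i b] by (simp add: yg m_assoc)
  qed
qed

lemma norm_sq_translate: "norm_sq translated \<le> norm_sq f"
  unfolding norm_sq_def sum_translate[of "\<lambda>x c. (cmod c)\<^sup>2"] by (intro sum_mono2) auto

lemma l1_translate: "(\<Sum>x\<in>supp translated. cmod (lkp translated x)) \<le> (\<Sum>x\<in>supp f. cmod (lkp f x))"
  unfolding sum_translate[of "\<lambda>x c. cmod c"] by (intro sum_mono2) auto

text \<open>A coefficient of \<open>f\<close> appears as an inner product with the unit; almost
  orthogonality to a right ideal thus gives information on single coefficients.\<close>

lemma cinner_translate_unit:
  assumes "fst (snd y) < n"
  shows "cinner translated (unit_mat G n) = lkp f (inv_entry y)"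
proof -
  obtain a b g where yg: "y = (a, b, g)" by (metis surj_pair)
  have g: "g \<in> carrier G" using y yg by auto
  have "cinner translated (unit_mat G n) = (\<Sum>x\<in>{x \<in> supp f. fst (snd x) = a}. lkp f x * cnj (lkp (unit_mat G n) (fst x, b, snd (snd x) \<otimes> g)))"
    unfolding cinner_def sum_translate[of "\<lambda>x c. c * cnj (lkp (unit_mat G n) x)"] by (simp add: yg)
  also have "\<dots> = (\<Sum>x\<in>{x \<in> supp f. fst (snd x) = a}. if x = (b, a, inv g) then lkp f x else 0)"
  proof (rule sum.cong[OF refl])
    fix x assume x: "x \<in> {x \<in> supp f. fst (snd x) = a}"
    then obtain i k where xk: "x = (i, a, k)" "k \<in> carrier G" using f by (cases x) auto
    have "k \<otimes> g = \<one> \<longleftrightarrow> k = inv g" using xk g by (metis inv_equality l_inv)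
    then show "lkp f x * cnj (lkp (unit_mat G n) (fst x, b, snd (snd x) \<otimes> g)) = (if x = (b, a, inv g) then lkp f x else 0)"
      using assms yg by (auto simp: xk lookup_unit_mat)
  qed
  also have "\<dots> = lkp f (inv_entry y)" by (auto simp: sum.delta in_keys_iff yg)
  finally show ?thesis .
qed

lemma cinner_translate:
  assumes h: "supp h \<subseteq> entries G"
  shows "cinner translated h = cinner f (conv G h (sng (inv_entry y) 1))"
proof -
  obtain a b g where yg: "y = (a, b, g)" by (metis surj_pair)
  have g: "g \<in> carrier G" using y yg by auto
  have "cinner translated h = (\<Sum>x\<in>{x \<in> supp f. fst (snd x) = a}. lkp f x * cnj (lkp h (fst x, b, snd (snd x) \<otimes> g)))"
    unfolding cinner_def sum_translate[of "\<lambda>x c. c * cnj (lkp h x)"] by (simp add: yg)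
  also have "\<dots> = (\<Sum>x\<in>{x \<in> supp f. fst (snd x) = a}. lkp f x * cnj (lkp (conv G h (sng (inv_entry y) 1)) x))"
  proof (rule sum.cong[OF refl])
    fix x assume x: "x \<in> {x \<in> supp f. fst (snd x) = a}"
    then obtain i k where xk: "x = (i, a, k)" "k \<in> carrier G" using f by (cases x) auto
    then show "lkp f x * cnj (lkp h (fst x, b, snd (snd x) \<otimes> g)) = lkp f x * cnj (lkp (conv G h (sng (inv_entry y) 1)) x)"
      using lookup_translate[OF h, of "inv g" k b a i a] g by (simp add: yg)
  qed
  also have "\<dots> = cinner f (conv G h (sng (inv_entry y) 1))"
    unfolding cinner_def
  proof (rule sum.mono_neutral_left)
    show "\<forall>x\<in>supp f - {x \<in> supp f. fst (snd x) = a}. lkp f x * cnj (lkp (conv G h (sng (inv_entry y) 1)) x) = 0"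
    proof
      fix x assume x: "x \<in> supp f - {x \<in> supp f. fst (snd x) = a}"
      then obtain i c k where xk: "x = (i, c, k)" "k \<in> carrier G" "c \<noteq> a" using f by (cases x) auto
      then show "lkp f x * cnj (lkp (conv G h (sng (inv_entry y) 1)) x) = 0"
        using lookup_translate[OF h, of "inv g" k b a i c] g by (simp add: yg)
    qed
  qed auto
  finally show ?thesis .
qed

end

lemma cinner_unit: "cinner f (unit_mat G n) = (\<Sum>i<n. lkp f (i, i, \<one>))"
proof -
  have "cinner f (unit_mat G n) = cnj (cinner (unit_mat G n) f)" by (rule cinner_cnj)
  also have "cinner (unit_mat G n) f = (\<Sum>x\<in>(\<lambda>i. (i, i, \<one>)) ` {..<n}. lkp (unit_mat G n) x * cnj (lkp f x))"
    by (rule cinner_superset) (auto simp: in_keys_iff lookup_unit_mat split: if_splits)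
  also have "\<dots> = (\<Sum>i<n. cnj (lkp f (i, i, \<one>)))"
    by (subst sum.reindex) (auto simp: inj_on_def lookup_unit_mat)
  finally show ?thesis by simp
qed

lemma trace_conv:
  assumes f: "supp f \<subseteq> {..<n} \<times> UNIV \<times> carrier G" and g: "supp g \<subseteq> entries G"
  shows "cinner (conv G f g) (unit_mat G n) = (\<Sum>x\<in>supp f. lkp f x * lkp g (inv_entry x))"
proof -
  let ?c = "\<lambda>i x y. if fst x = i \<and> fst (snd x) = fst y \<and> fst (snd y) = i \<and> snd (snd x) \<otimes> snd (snd y) = \<one>
    then lkp f x * lkp g y else 0"
  have "cinner (conv G f g) (unit_mat G n) = (\<Sum>i<n. \<Sum>x\<in>supp f. \<Sum>y\<in>supp g.
    ?c i x y)"
    unfolding cinner_unit lookup_conv[OF finite_keys order.refl finite_keys order.refl] ..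
  also have "\<dots> = (\<Sum>x\<in>supp f. \<Sum>i<n. \<Sum>y\<in>supp g.
    ?c i x y)" by (rule sum.swap)
  also have "\<dots> = (\<Sum>x\<in>supp f. lkp f x * lkp g (inv_entry x))"
  proof (rule sum.cong[OF refl])
    fix x assume x: "x \<in> supp f"
    obtain a b h where xh: "x = (a, b, h)" by (metis surj_pair)
    have h: "a < n" "h \<in> carrier G" using x xh f by auto
    have "(\<Sum>i<n. \<Sum>y\<in>supp g.
      ?c i x y) = (\<Sum>i<n. if i = a then (\<Sum>y\<in>supp g. if y = inv_entry x then lkp f x * lkp g y else 0) else 0)"
    proof (rule sum.cong[OF refl], goal_cases)
      case (1 i)
      show ?case
      proof (cases "i = a")
        case True
        show ?thesis unfolding if_P[OF True]
        proof (rule sum.cong[OF refl])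
          fix y assume y: "y \<in> supp g"
          obtain b' a' k where yk: "y = (b', a', k)" by (metis surj_pair)
          have k: "k \<in> carrier G" using y yk g by auto
          have "h \<otimes> k = \<one> \<longleftrightarrow> k = inv h" using k h by (metis inv_equality inv_inv inv_closed r_inv)
          then show "(?c i x y) = (if y = inv_entry x then lkp f x * lkp g y else 0)"
            unfolding xh yk True by auto
        qed
      qed (simp add: xh)
    qed
    also have "\<dots> = lkp f x * lkp g (inv_entry x)"
      using h by (auto simp: sum.delta in_keys_iff)
    finally show "(\<Sum>i<n. \<Sum>y\<in>supp g.
      ?c i x y) = \<dots>" .
  qed
  finally show ?thesis .
qed

text \<open>By \<open>trace_conv\<close> the trace of a product pairs the value of one factor at
  \<open>x\<close> with that of the other at \<open>inv_entry x\<close>, and this pairing is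
  symmetric since \<open>inv_entry\<close> is an involution.\<close>

lemma trace_commute:
  assumes f: "supp f \<subseteq> {..<n} \<times> UNIV \<times> carrier G" and g: "supp g \<subseteq> {..<n} \<times> UNIV \<times> carrier G"
  shows "cinner (conv G f g) (unit_mat G n) = cinner (conv G g f) (unit_mat G n)"
proof -
  have fe: "supp f \<subseteq> entries G" and ge: "supp g \<subseteq> entries G" using f g by auto
  let ?F = "{x \<in> supp f. lkp g (inv_entry x) \<noteq> 0}" and ?H = "{x \<in> supp g. lkp f (inv_entry x) \<noteq> 0}"
  have "(\<Sum>x\<in>supp f. lkp f x * lkp g (inv_entry x)) = (\<Sum>x\<in>?F. lkp f x * lkp g (inv_entry x))"
    by (rule sum.mono_neutral_right) auto
  also have "\<dots> = (\<Sum>x\<in>?H. lkp g x * lkp f (inv_entry x))"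
    by (rule sum.reindex_bij_witness[where i = inv_entry and j = inv_entry])
      (use fe ge in \<open>auto simp: in_keys_iff subset_iff mult.commute\<close>)
  also have "\<dots> = (\<Sum>x\<in>supp g. lkp g x * lkp f (inv_entry x))"
    by (rule sum.mono_neutral_left) auto
  finally show ?thesis unfolding trace_conv[OF f ge] trace_conv[OF g fe] .
qed

text \<open>Let \<open>I\<close> be the right ideal of \<open>e\<close> and suppose first that
  \<open>\<alpha>\<close> is the exact projection of the unit \<open>w\<close> to \<open>I\<close>.
  Pairing translates of an \<open>f\<close> in \<open>I\<close> with \<open>w\<close> or with
  \<open>\<alpha>\<close> gives the same number, so \<open>\<alpha>\<close> determines the
  coefficients of \<open>f\<close>; for \<open>f = \<alpha>\<close> this shows that
  \<open>\<alpha>\<close> is hermitian. As \<open>e\<alpha> = \<alpha>\<close>, it follows that the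
  trace of \<open>\<alpha>\<close> is \<open>cinner e \<alpha>\<close>, which is the trace of
  \<open>e\<close>, that is 0; but it is also the squared norm of \<open>\<alpha>\<close>. Hence
  \<open>\<alpha>\<close> vanishes, and with it every coefficient of \<open>e\<close>. The
  inequalities track the errors when orthogonality holds only up to \<open>\<eta>\<close>; here
  \<open>r\<close> is the norm of \<open>\<alpha>\<close>.\<close>

lemma idempotent_approx:
  assumes e: "supp e \<subseteq> block n (carrier G)" and idem: "conv G e e = e"
    and tr: "cinner e (unit_mat G n) = 0" and \<eta>: "\<eta> > 0"
  defines "L \<equiv> (\<Sum>x\<in>supp e. cmod (lkp e x))" and "N \<equiv> sqrt (norm_sq e)"
  shows "\<exists>r\<ge>0. r\<^sup>2 \<le> \<eta> * ((1 + 2 * L) * r + N) \<and> (\<forall>y\<in>supp e. cmod (lkp e y) \<le> L * r + \<eta> * N)"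
proof -
  interpret semigroup_on G by (rule is_semigroup_on)
  have ee: "supp e \<subseteq> entries G" using e by auto
  let ?w = "unit_mat G n :: ('a, complex) fin_mat"
  define I where "I = {f. supp f \<subseteq> entries G \<and> conv G e f = f}"
  have eI: "e \<in> I" using ee idem by (simp add: I_def)
  have tI: "conv G f (sng y 1) \<in> I" if "f \<in> I" "y \<in> entries G" for f y
  proof -
    have f: "supp f \<subseteq> entries G" "conv G e f = f" using that by (auto simp: I_def)
    have "conv G e (conv G f (sng y 1)) = conv G (conv G e f) (sng y 1)"
      using conv_assoc[OF ee f(1), of "sng y 1"] that(2) by simp
    then show ?thesis using translate_closed[OF f(1) that(2)] f(2) by (simp add: I_def)
  qed
  have "\<exists>\<alpha>\<in>I. \<forall>\<beta>\<in>I. cmod (cinner \<beta> (?w - \<alpha>)) \<le> \<eta> * sqrt (norm_sq \<beta>)"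
  proof (rule approx_projection)
    show "0 \<in> I" by (simp add: I_def)
    show "f + g \<in> I" if "f \<in> I" "g \<in> I" for f g
      using that Poly_Mapping.keys_add[of f g] by (auto simp: I_def conv_add_right)
    show "scale t f \<in> I" if "f \<in> I" for t f
      using that supp_scale[of t f] by (auto simp: I_def conv_scale_right)
  qed (rule \<eta>)
  then obtain \<alpha> where \<alpha>: "\<alpha> \<in> I" and orth: "\<And>\<beta>. \<beta> \<in> I \<Longrightarrow> cmod (cinner \<beta> ?w - cinner \<beta> \<alpha>) \<le> \<eta> * sqrt (norm_sq \<beta>)"
    unfolding cinner_diff_right by blast
  have sa: "supp \<alpha> \<subseteq> entries G" "conv G e \<alpha> = \<alpha>" using \<alpha> by (auto simp: I_def)
  define r where "r = sqrt (norm_sq \<alpha>)"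
  have r0: "r \<ge> 0" by (simp add: r_def)
  have orth_t: "cmod (lkp f (inv_entry y) - cinner (conv G f (sng y 1)) \<alpha>) \<le> \<eta> * sqrt (norm_sq f)"
    if "f \<in> I" "y \<in> entries G" "fst (snd y) < n" for f y
  proof -
    have f: "supp f \<subseteq> entries G" using that by (auto simp: I_def)
    have "cmod (lkp f (inv_entry y) - cinner (conv G f (sng y 1)) \<alpha>) \<le> \<eta> * sqrt (norm_sq (conv G f (sng y 1)))"
      using orth[OF tI[OF that(1,2)]] unfolding cinner_translate_unit[OF f that(2,3)] .
    also have "\<dots> \<le> \<eta> * sqrt (norm_sq f)"
      using norm_sq_translate[OF f that(2)] \<eta> by (intro mult_left_mono) auto
    finally show ?thesis .
  qed
  \<comment> \<open>Both coefficients are within \<open>\<eta> * r\<close> of the same number, since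
    the translations by \<open>y\<close> and by \<open>inv_entry y\<close> are adjoint to each
    other.\<close>
  have herm: "cmod (lkp \<alpha> (inv_entry y) - cnj (lkp \<alpha> y)) \<le> 2 * \<eta> * r" if y: "y \<in> supp e" for y
  proof -
    have yG: "y \<in> entries G" "fst y < n" "fst (snd y) < n" using y e by auto
    have yi: "inv_entry y \<in> entries G" "fst (snd (inv_entry y)) < n"
      using yG by (cases y; simp)+
    let ?c = "cinner (conv G \<alpha> (sng y 1)) \<alpha>"
    have 1: "cmod (lkp \<alpha> (inv_entry y) - ?c) \<le> \<eta> * r"
      using orth_t[OF \<alpha> yG(1,3)] by (simp add: r_def)
    have "cinner (conv G \<alpha> (sng (inv_entry y) 1)) \<alpha> = cinner \<alpha> (conv G \<alpha> (sng y 1))"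
      using cinner_translate[OF sa(1) yi(1) sa(1)] yG by simp
    also have "\<dots> = cnj ?c" by (rule cinner_cnj)
    finally have "cmod (lkp \<alpha> y - cnj ?c) \<le> \<eta> * r"
      using orth_t[OF \<alpha> yi] yG by (simp add: r_def)
    then have "cmod (cnj (lkp \<alpha> y - cnj ?c)) \<le> \<eta> * r" by (simp only: complex_mod_cnj)
    then have 2: "cmod (cnj (lkp \<alpha> y) - ?c) \<le> \<eta> * r" by simp
    have "cmod ((lkp \<alpha> (inv_entry y) - ?c) - (cnj (lkp \<alpha> y) - ?c)) \<le> \<eta> * r + \<eta> * r"
      using 1 2 norm_triangle_ineq4[of "lkp \<alpha> (inv_entry y) - ?c" "cnj (lkp \<alpha> y) - ?c"] by linarith
    then show ?thesis by simp
  qed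
  have "cinner \<alpha> ?w = (\<Sum>x\<in>supp e. lkp e x * lkp \<alpha> (inv_entry x))"
    using trace_conv[of e n \<alpha>] e sa by auto
  then have "cinner \<alpha> ?w - cinner e \<alpha> = (\<Sum>x\<in>supp e. lkp e x * (lkp \<alpha> (inv_entry x) - cnj (lkp \<alpha> x)))"
    by (simp add: cinner_def right_diff_distrib sum_subtractf)
  then have "cmod (cinner \<alpha> ?w - cinner e \<alpha>) \<le> (\<Sum>x\<in>supp e. cmod (lkp e x) * cmod (lkp \<alpha> (inv_entry x) - cnj (lkp \<alpha> x)))"
    using norm_sum[of "\<lambda>x. lkp e x * (lkp \<alpha> (inv_entry x) - cnj (lkp \<alpha> x))" "supp e"] by (simp add: norm_mult)
  also have "\<dots> \<le> (\<Sum>x\<in>supp e. cmod (lkp e x) * (2 * \<eta> * r))"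
    by (intro sum_mono mult_left_mono herm) auto
  also have "\<dots> = L * (2 * \<eta> * r)" unfolding L_def by (rule sum_distrib_right[symmetric])
  also have "\<dots> = 2 * \<eta> * L * r" by simp
  finally have 1: "cmod (cinner \<alpha> ?w - cinner e \<alpha>) \<le> 2 * \<eta> * L * r" .
  have 2: "cmod (cinner e \<alpha>) \<le> \<eta> * N" using orth[OF eI] by (simp add: tr N_def)
  have 3: "cmod (cinner \<alpha> ?w - cinner \<alpha> \<alpha>) \<le> \<eta> * r" using orth[OF \<alpha>] by (simp add: r_def)
  have "r\<^sup>2 = cmod (cinner \<alpha> \<alpha>)" by (simp add: r_def cinner_self)
  \<comment> \<open>The three terms are the failure of hermitian symmetry, the failure of
    orthogonality at \<open>\<alpha>\<close>, and the failure of orthogonality at \<open>e\<close>,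
    whose trace is 0.\<close>
  also have "cinner \<alpha> \<alpha> = (cinner \<alpha> ?w - cinner e \<alpha>) - (cinner \<alpha> ?w - cinner \<alpha> \<alpha>) + cinner e \<alpha>" by simp
  also have "cmod \<dots> \<le> cmod (cinner \<alpha> ?w - cinner e \<alpha>) + cmod (cinner \<alpha> ?w - cinner \<alpha> \<alpha>) + cmod (cinner e \<alpha>)"
    using norm_triangle_ineq norm_triangle_ineq4 by (meson add_mono order.refl order.trans)
  also have "\<dots> \<le> \<eta> * ((1 + 2 * L) * r + N)" using 1 2 3 by (simp add: algebra_simps)
  finally have A: "r\<^sup>2 \<le> \<eta> * ((1 + 2 * L) * r + N)" .
  have B: "cmod (lkp e y) \<le> L * r + \<eta> * N" if y: "y \<in> supp e" for y
  proof -
    have yG: "y \<in> entries G" "fst y < n" using y e by auto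
    have yi: "inv_entry y \<in> entries G" "fst (snd (inv_entry y)) < n"
      using yG by (cases y; simp)+
    let ?t = "conv G e (sng (inv_entry y) 1)"
    have "cmod (lkp e y - cinner ?t \<alpha>) \<le> \<eta> * N"
      using orth_t[OF eI yi] yG by (simp add: N_def)
    moreover have "cmod (cinner ?t \<alpha>) \<le> L * r"
    proof -
      have "cmod (cinner ?t \<alpha>) \<le> (\<Sum>x\<in>supp ?t. cmod (lkp ?t x)) * r" unfolding r_def by (rule cmod_cinner_le)
      also have "\<dots> \<le> L * r" unfolding L_def using l1_translate[OF ee yi(1)] r0 by (rule mult_right_mono)
      finally show ?thesis .
    qed
    ultimately show ?thesis using norm_triangle_ineq[of "lkp e y - cinner ?t \<alpha>" "cinner ?t \<alpha>"] by simp
  qed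
  show ?thesis using A B r0 by blast
qed

text \<open>Kaplansky: the trace of an idempotent over \<open>\<complex>\<close> is the squared norm of a projection.\<close>
lemma idempotent_trace_0:
  assumes e: "supp e \<subseteq> block n (carrier G)" and idem: "conv G e e = e"
    and tr: "cinner e (unit_mat G n) = 0"
  shows "e = 0"
proof (rule ccontr)
  assume "e \<noteq> 0"
  then obtain y where y: "y \<in> supp e" by (metis keys_eq_empty ex_in_conv)
  define \<epsilon> where "\<epsilon> = cmod (lkp e y)"
  have \<epsilon>: "\<epsilon> > 0" using y by (simp add: \<epsilon>_def in_keys_iff)
  define L where "L = (\<Sum>x\<in>supp e. cmod (lkp e x))"
  define N where "N = sqrt (norm_sq e)"
  define C where "C = 1 + 2 * L + N"
  have L: "L \<ge> 0" by (simp add: L_def sum_nonneg)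
  have N: "N \<ge> 0" by (simp add: N_def)
  have C: "C \<ge> 1" "C \<ge> N" using L N by (simp_all add: C_def)
  define K where "K = L * C + N + 1"
  have K: "K > 0" using L N C by (auto simp: K_def intro!: add_nonneg_pos add_nonneg_nonneg)
  \<comment> \<open>The estimate makes \<open>r\<close> of the order of the square root of
    \<open>\<eta>\<close>, so \<open>\<eta> = s\<^sup>2\<close> is used. The bound
    \<open>1 / C\<close> gives \<open>r \<le> s * C\<close>; then every coefficient of
    \<open>e\<close> is at most \<open>s * K\<close>, and the second bound makes this at most half
    of the coefficient at \<open>y\<close>.\<close>
  define s where "s = min (1 / C) (\<epsilon> / (2 * K))"
  have s: "s > 0" "s * C \<le> 1" "s * K \<le> \<epsilon> / 2" "s \<le> 1"
  proof -
    show "s > 0" using C \<epsilon> K by (simp add: s_def)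
    have "s \<le> 1 / C" by (simp add: s_def)
    then show sC: "s * C \<le> 1" using C by (simp add: pos_le_divide_eq)
    have "s \<le> \<epsilon> / (2 * K)" by (simp add: s_def)
    then show "s * K \<le> \<epsilon> / 2" using K by (simp add: field_simps)
    have "s * 1 \<le> s * C" using C \<open>s > 0\<close> by (intro mult_left_mono) auto
    then show "s \<le> 1" using sC by simp
  qed
  obtain r where r: "r \<ge> 0" "r\<^sup>2 \<le> s\<^sup>2 * ((1 + 2 * L) * r + N)" "\<epsilon> \<le> L * r + s\<^sup>2 * N"
    using idempotent_approx[OF e idem tr, of "s\<^sup>2"] s(1) y unfolding L_def N_def \<epsilon>_def by auto
  have rsC: "r \<le> s * C"
  proof (cases "r \<le> 1")
    case True
    have "(1 + 2 * L) * r \<le> (1 + 2 * L) * 1" using True L by (intro mult_left_mono) auto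
    then have "(1 + 2 * L) * r + N \<le> C" by (simp add: C_def)
    then have "s\<^sup>2 * ((1 + 2 * L) * r + N) \<le> s\<^sup>2 * C" by (intro mult_left_mono) auto
    then have "r\<^sup>2 \<le> s\<^sup>2 * C" using r(2) by linarith
    also have "\<dots> \<le> s\<^sup>2 * C\<^sup>2" using C by (intro mult_left_mono) (auto simp: power2_eq_square)
    finally have "r\<^sup>2 \<le> (s * C)\<^sup>2" by (simp add: power_mult_distrib)
    then show ?thesis by (rule power2_le_imp_le) (use s C in simp)
  next
    \<comment> \<open>This case is void: \<open>s * C \<le> 1\<close> and \<open>s \<le> 1\<close>
      force \<open>r \<le> 1\<close>.\<close>
    case False
    have "N * 1 \<le> N * r" using False N by (intro mult_left_mono) auto
    then have "(1 + 2 * L) * r + N \<le> C * r" by (simp add: C_def algebra_simps)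
    then have "s\<^sup>2 * ((1 + 2 * L) * r + N) \<le> s\<^sup>2 * (C * r)" by (intro mult_left_mono) auto
    then have "r * r \<le> (s * (s * C)) * r" using r(2) by (simp add: power2_eq_square mult_ac)
    then have "r \<le> s * (s * C)" using False by simp
    also have "\<dots> \<le> s * 1" using s by (intro mult_left_mono) auto
    finally show ?thesis using False s(4) by simp
  qed
  have "\<epsilon> \<le> L * (s * C) + s * N"
  proof -
    have "L * r \<le> L * (s * C)" using rsC L by (intro mult_left_mono)
    moreover have "s\<^sup>2 \<le> s" using s by (simp add: power2_eq_square)
    then have "s\<^sup>2 * N \<le> s * N" using N by (intro mult_right_mono)
    ultimately show ?thesis using r(3) by linarith
  qed
  also have "\<dots> \<le> s * K" using s(1) by (simp add: K_def algebra_simps)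
  finally show False using s(3) \<epsilon> by linarith
qed

text \<open>The idempotent \<open>e - vu\<close> equals \<open>uv - vu\<close>, whose trace is
  0.\<close>

theorem dedekind_conv_complex: "dedekind_conv G (UNIV :: complex set)"
proof (rule semigroup_on.dedekind_convI[OF is_semigroup_on])
  fix d and e u v z :: "('a, complex) fin_mat"
  assume d: "supp u \<subseteq> block d (carrier G)" "supp v \<subseteq> block d (carrier G)"
    "supp z \<subseteq> block d (carrier G)"
    and r: "conv G u v = e" and z: "z = e - conv G v u" and zz: "conv G z z = z"
  have "cinner (conv G u v) (unit_mat G d) = cinner (conv G v u) (unit_mat G d)"
    using d by (intro trace_commute) auto
  then have "cinner z (unit_mat G d) = 0"
    unfolding z r cinner_unit lookup_minus sum_subtractf by simp
  then show "z = 0" by (rule idempotent_trace_0[OF d(3) zz])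
qed

end

section \<open>Embedding finitely generated domains of characteristic zero into the complex numbers\<close>

text \<open>Models the image of \<open>K\<close> in the product ring: a domain with unit
  \<open>u\<close> inside a type that has zero divisors and another \<open>1\<close>.\<close>

locale subdomain =
  fixes D :: "'a::comm_ring_1 set" and u :: 'a
  assumes D_closed: "x \<in> D \<Longrightarrow> y \<in> D \<Longrightarrow> x + y \<in> D" "x \<in> D \<Longrightarrow> y \<in> D \<Longrightarrow> x * y \<in> D"
      "x \<in> D \<Longrightarrow> - x \<in> D" "u \<in> D"
    and D_unit: "x \<in> D \<Longrightarrow> u * x = x"
    and D_domain: "x \<in> D \<Longrightarrow> y \<in> D \<Longrightarrow> x * y = 0 \<Longrightarrow> x = 0 \<or> y = 0"
    and D_char: "n > 0 \<Longrightarrow> of_nat n * u \<noteq> 0"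

text \<open>The map runs from a subring \<open>B\<close> of the complex numbers into
  \<open>D\<close>, opposite to the embedding it stands for, so that polynomials over the part
  already embedded are ordinary complex polynomials. Countability of \<open>B\<close> leaves room
  for transcendental numbers.\<close>

locale partial_embedding = subdomain D u for D :: "'a::comm_ring_1 set" and u +
  fixes B :: "complex set" and \<psi> :: "complex \<Rightarrow> 'a"
  assumes countable_B: "countable B" and B01: "0 \<in> B" "1 \<in> B"
    and B_closed: "x \<in> B \<Longrightarrow> y \<in> B \<Longrightarrow> x + y \<in> B" "x \<in> B \<Longrightarrow> y \<in> B \<Longrightarrow> x * y \<in> B"
      "x \<in> B \<Longrightarrow> - x \<in> B"
    and \<psi>_add: "x \<in> B \<Longrightarrow> y \<in> B \<Longrightarrow> \<psi> (x + y) = \<psi> x + \<psi> y"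
    and \<psi>_mult: "x \<in> B \<Longrightarrow> y \<in> B \<Longrightarrow> \<psi> (x * y) = \<psi> x * \<psi> y"
    and \<psi>_1: "\<psi> 1 = u"
    and \<psi>_inj: "inj_on \<psi> B" and \<psi>_D: "x \<in> B \<Longrightarrow> \<psi> x \<in> D"
begin

lemma \<psi>_0 [simp]: "\<psi> 0 = 0"
  using \<psi>_add[OF B01(1) B01(1)] by simp

lemma \<psi>_eq_0: "x \<in> B \<Longrightarrow> \<psi> x = 0 \<longleftrightarrow> x = 0"
  using \<psi>_inj B01 \<psi>_0 by (metis inj_onD)

lemma \<psi>_sum: "(\<And>i. i \<in> I \<Longrightarrow> f i \<in> B) \<Longrightarrow> sum f I \<in> B \<and> \<psi> (sum f I) = (\<Sum>i\<in>I. \<psi> (f i))"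
  by (induction I rule: infinite_finite_induct) (auto simp: B01 B_closed \<psi>_add)

section \<open>Polynomials over \<open>B\<close> and their values in \<open>D\<close>\<close>

definition PB :: "complex poly set" where
  "PB = {p. \<forall>i. coeff p i \<in> B}"

lemma PB_closed:
  assumes "p \<in> PB" "q \<in> PB"
  shows "p + q \<in> PB" "p * q \<in> PB" "p - q \<in> PB"
proof -
  show "p + q \<in> PB" using assms by (simp add: PB_def B_closed)
  have "(\<Sum>i\<le>n. coeff p i * coeff q (n - i)) \<in> B" for n
    using \<psi>_sum[of "{..n}" "\<lambda>i. coeff p i * coeff q (n - i)"] assms by (simp add: PB_def B_closed)
  then show "p * q \<in> PB" by (simp add: PB_def coeff_mult)
  have "coeff p n + - coeff q n \<in> B" for n
    using assms by (intro B_closed) (auto simp: PB_def)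
  then show "p - q \<in> PB" by (simp add: PB_def)
qed

lemma PB_smult: "a \<in> B \<Longrightarrow> p \<in> PB \<Longrightarrow> smult a p \<in> PB"
  by (simp add: PB_def B_closed)

lemma PB_monom: "a \<in> B \<Longrightarrow> monom a n \<in> PB"
  by (simp add: PB_def B01)

lemma PB_const: "a \<in> B \<Longrightarrow> [:a:] \<in> PB"
  using PB_monom[of a 0] by (simp add: monom_0)

lemma PB_X: "[:0, 1:] \<in> PB"
  by (auto simp: PB_def B01 coeff_pCons split: nat.splits)

lemma PB_0: "0 \<in> PB"
  by (simp add: PB_def B01)

lemma countable_PB: "countable PB"
proof -
  have "PB \<subseteq> Poly ` lists B"
  proof
    fix p assume "p \<in> PB"
    then have "set (coeffs p) \<subseteq> B" by (auto simp: PB_def coeffs_def)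
    then have "coeffs p \<in> lists B" by (simp add: in_lists_conv_set subset_iff)
    then show "p \<in> Poly ` lists B" by (metis Poly_coeffs imageI)
  qed
  then show ?thesis using countable_B by (meson countable_image countable_lists countable_subset)
qed

definition ev :: "'a \<Rightarrow> complex poly \<Rightarrow> 'a" where
  "ev x p = poly (map_poly \<psi> p) x"

lemma coeff_map [simp]: "coeff (map_poly \<psi> p) n = \<psi> (coeff p n)"
  by (simp add: coeff_map_poly)

lemma ev_add: "p \<in> PB \<Longrightarrow> q \<in> PB \<Longrightarrow> ev x (p + q) = ev x p + ev x q"
proof -
  assume pq: "p \<in> PB" "q \<in> PB"
  have "map_poly \<psi> (p + q) = map_poly \<psi> p + map_poly \<psi> q"
    using pq by (intro poly_eqI) (simp add: \<psi>_add PB_def)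
  then show ?thesis by (simp add: ev_def)
qed

lemma ev_mult: "p \<in> PB \<Longrightarrow> q \<in> PB \<Longrightarrow> ev x (p * q) = ev x p * ev x q"
proof -
  assume pq: "p \<in> PB" "q \<in> PB"
  have "map_poly \<psi> (p * q) = map_poly \<psi> p * map_poly \<psi> q"
  proof (rule poly_eqI)
    fix n
    have "\<psi> (\<Sum>i\<le>n. coeff p i * coeff q (n - i)) = (\<Sum>i\<le>n. \<psi> (coeff p i * coeff q (n - i)))"
      using pq by (intro \<psi>_sum[THEN conjunct2] B_closed) (auto simp: PB_def)
    also have "\<dots> = (\<Sum>i\<le>n. \<psi> (coeff p i) * \<psi> (coeff q (n - i)))"
      using pq by (intro sum.cong refl \<psi>_mult) (auto simp: PB_def)
    finally show "coeff (map_poly \<psi> (p * q)) n = coeff (map_poly \<psi> p * map_poly \<psi> q) n"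
      by (simp add: coeff_mult)
  qed
  then show ?thesis by (simp add: ev_def)
qed

lemma ev_const: "ev x [:a:] = \<psi> a"
  by (simp add: ev_def map_poly_pCons)

lemma ev_0: "ev x 0 = 0"
  by (simp add: ev_def)

lemma ev_smult: "a \<in> B \<Longrightarrow> p \<in> PB \<Longrightarrow> ev x (smult a p) = \<psi> a * ev x p"
  using ev_mult[OF PB_const, of a p x] by (simp add: ev_const)

lemma ev_X: "x \<in> D \<Longrightarrow> ev x [:0, 1:] = x"
  using D_unit[of x] by (simp add: ev_def map_poly_pCons \<psi>_1 mult.commute[of x u])

text \<open>The factor \<open>c\<close> takes care of \<open>n = 0\<close>, where
  \<open>x ^ 0\<close> is the \<open>1\<close> of the type and not the unit of
  \<open>D\<close>.\<close>

lemma D_power: "c \<in> D \<Longrightarrow> x \<in> D \<Longrightarrow> c * x ^ n \<in> D"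
proof (induction n)
  case (Suc n)
  then have "(c * x ^ n) * x \<in> D" by (simp add: D_closed(2))
  then show ?case by (simp add: mult_ac)
qed simp

lemma D_0: "0 \<in> D"
  using \<psi>_D[OF B01(1)] by simp

lemma ev_in_D: "p \<in> PB \<Longrightarrow> x \<in> D \<Longrightarrow> ev x p \<in> D"
proof -
  assume p: "p \<in> PB" "x \<in> D"
  have "(\<Sum>i\<in>I. \<psi> (coeff p i) * x ^ i) \<in> D" for I
    using p by (induction I rule: infinite_finite_induct)
      (auto simp: D_0 PB_def intro!: D_closed D_power \<psi>_D)
  then show ?thesis by (simp add: ev_def poly_altdef)
qed

lemma ev_diff: "p \<in> PB \<Longrightarrow> q \<in> PB \<Longrightarrow> ev x (p - q) = ev x p - ev x q"
  using ev_add[of "p - q" q x] by (simp add: PB_closed)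

text \<open>\<open>B\<close> is not a field, so instead of dividing by the leading coefficient of
  \<open>f\<close> the dividend is multiplied by it. The accumulated factor \<open>a\<close> is
  nonzero and can be cancelled in a domain.\<close>

lemma pseudo_division:
  assumes f: "f \<in> PB" "f \<noteq> 0" and g: "g \<in> PB"
  shows "\<exists>a q r. a \<in> B \<and> a \<noteq> 0 \<and> q \<in> PB \<and> r \<in> PB \<and> smult a g = q * f + r \<and> (r = 0 \<or> degree r < degree f)"
  using g
proof (induction "degree g" arbitrary: g rule: less_induct)
  case less
  show ?case
  proof (cases "g = 0 \<or> degree g < degree f")
    case True
    then show ?thesis using less.prems B01 PB_0 by (intro exI[of _ 1] exI[of _ 0] exI[of _ g]) auto
  next
    case False
    define m where "m = monom (lead_coeff g) (degree g - degree f)"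
    define g' where "g' = smult (lead_coeff f) g - m * f"
    have lB: "lead_coeff f \<in> B" "lead_coeff g \<in> B" using f less.prems by (auto simp: PB_def)
    have m: "m \<in> PB" unfolding m_def using lB by (intro PB_monom)
    have g': "g' \<in> PB" unfolding g'_def using m f less.prems lB by (intro PB_closed PB_smult)
    have dm: "degree (m * f) \<le> degree g"
    proof -
      have "degree m \<le> degree g - degree f" by (simp add: m_def degree_monom_le)
      then show ?thesis using degree_mult_le[of m f] False by linarith
    qed
    have d: "degree g' \<le> degree g"
      unfolding g'_def using dm by (intro degree_diff_le) (auto intro: degree_smult_le)
    have c: "coeff g' (degree g) = 0"
      using False by (simp add: g'_def m_def coeff_monom_mult mult.commute[of "lead_coeff f" "lead_coeff g"])
    have *: "\<exists>a q r. a \<in> B \<and> a \<noteq> 0 \<and> q \<in> PB \<and> r \<in> PB \<and> smult a g' = q * f + r \<and> (r = 0 \<or> degree r < degree f)"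
    proof (cases "g' = 0")
      case True
      then show ?thesis using B01 PB_0 by (intro exI[of _ 1] exI[of _ 0]) auto
    next
      case False
      then have "degree g' \<noteq> degree g" using c by (metis leading_coeff_0_iff)
      then show ?thesis using d less.hyps[of g'] g' by simp
    qed
    then obtain a q r where aqr: "a \<in> B" "a \<noteq> 0" "q \<in> PB" "r \<in> PB" "smult a g' = q * f + r"
      "r = 0 \<or> degree r < degree f" by blast
    have "smult (a * lead_coeff f) g = smult a g' + smult a (m * f)"
      by (simp add: g'_def smult_diff_right)
    also have "\<dots> = (q + smult a m) * f + r"
      unfolding aqr(5) by (simp add: algebra_simps)
    finally have "smult (a * lead_coeff f) g = (q + smult a m) * f + r" .
    moreover have "a * lead_coeff f \<in> B" "a * lead_coeff f \<noteq> 0" "q + smult a m \<in> PB"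
      using aqr lB f m by (auto intro: B_closed PB_closed PB_smult)
    ultimately show ?thesis using aqr by blast
  qed
qed

text \<open>Evaluation at \<open>\<xi>\<close> and evaluation at \<open>x\<close> are to have the
  same kernel. If \<open>x\<close> is transcendental over \<open>B\<close>, any \<open>\<xi>\<close>
  avoiding the countably many roots of nonzero polynomials over \<open>B\<close> will do. Otherwise
  take a root of a polynomial \<open>f\<close> of least degree that vanishes at \<open>x\<close>;
  since \<open>f\<close> divides, up to a scalar, everything that vanishes at \<open>x\<close>, one
  inclusion is immediate.\<close>

lemma exists_generic_point:
  assumes x: "x \<in> D"
  shows "\<exists>\<xi>. \<forall>p\<in>PB. poly p \<xi> = 0 \<longleftrightarrow> ev x p = 0"
proof (cases "\<exists>p\<in>PB. p \<noteq> 0 \<and> ev x p = 0")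
  case False
  let ?R = "\<Union>p\<in>PB - {0}. {z. poly p z = 0}"
  have "countable ?R"
    using countable_PB by (intro countable_UN) (auto intro: countable_finite poly_roots_finite)
  \<comment> \<open>A real \<open>\<xi>\<close> can be chosen, which reduces the claim to the
    uncountability of the reals.\<close>
  then have "countable (complex_of_real ` {r. complex_of_real r \<in> ?R})"
    by (rule countable_subset[rotated]) auto
  then have "countable {r. complex_of_real r \<in> ?R}"
    by (rule countable_image_inj_on) (simp add: inj_on_def)
  then have "{r. complex_of_real r \<in> ?R} \<noteq> UNIV"
    using uncountable_UNIV_real by metis
  then obtain r where "complex_of_real r \<notin> ?R" by blast
  then have "\<forall>p\<in>PB. poly p (complex_of_real r) = 0 \<longleftrightarrow> ev x p = 0"
    using False by (auto simp: ev_0)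
  then show ?thesis by blast
next
  case True
  define P where "P n \<longleftrightarrow> (\<exists>p\<in>PB. p \<noteq> 0 \<and> ev x p = 0 \<and> degree p = n)" for n
  have "\<exists>n. P n" using True by (auto simp: P_def)
  then obtain f where f: "f \<in> PB" "f \<noteq> 0" "ev x f = 0" and fmin: "\<And>n. P n \<Longrightarrow> degree f \<le> n"
    using LeastI_ex[of P] Least_le[of P] unfolding P_def[of "Least P"] by metis
  have fmin': "degree f \<le> degree p" if "p \<in> PB" "p \<noteq> 0" "ev x p = 0" for p
    using that by (intro fmin) (auto simp: P_def)
  have "degree f \<noteq> 0"
  proof
    assume "degree f = 0"
    then obtain c where c: "f = [:c:]" by (metis degree_eq_zeroE)
    then have "c \<in> B" using f(1) by (auto simp: PB_def dest: spec[of _ 0])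
    then show False using f c \<psi>_eq_0 by (simp add: ev_const)
  qed
  then obtain \<xi> where \<xi>: "poly f \<xi> = 0"
    using fundamental_theorem_of_algebra constant_degree by metis
  have 1: "poly p \<xi> = 0" if p: "p \<in> PB" "ev x p = 0" for p
  proof -
    obtain a q r where aqr: "a \<in> B" "a \<noteq> 0" "q \<in> PB" "r \<in> PB" "smult a p = q * f + r"
      "r = 0 \<or> degree r < degree f" using pseudo_division[OF f(1,2) p(1)] by blast
    have "ev x (smult a p) = ev x q * ev x f + ev x r"
      unfolding aqr(5) using aqr f by (simp add: ev_add ev_mult PB_closed)
    then have "ev x r = 0" using aqr(1) p f by (simp add: ev_smult)
    then have "r = 0" using aqr(4,6) fmin'[of r] by (metis not_le)
    then have "a * poly p \<xi> = 0" using arg_cong[OF aqr(5), of "\<lambda>p. poly p \<xi>"] \<xi> by simp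
    then show ?thesis using aqr(2) by simp
  qed
  \<comment> \<open>For the other inclusion irreducibility of \<open>f\<close> is bypassed: a
    polynomial \<open>h\<close> of least degree vanishing at \<open>\<xi>\<close> divides
    \<open>f\<close> up to a scalar, and its cofactor has smaller degree than \<open>f\<close>, so
    the cofactor does not vanish at \<open>x\<close>. Since \<open>D\<close> is a domain,
    \<open>h\<close> does.\<close>
  define Q where "Q n \<longleftrightarrow> (\<exists>p\<in>PB. p \<noteq> 0 \<and> poly p \<xi> = 0 \<and> degree p = n)" for n
  have "\<exists>n. Q n" using f \<xi> by (auto simp: Q_def)
  then obtain h where h: "h \<in> PB" "h \<noteq> 0" "poly h \<xi> = 0" and hmin: "\<And>n. Q n \<Longrightarrow> degree h \<le> n"
    using LeastI_ex[of Q] Least_le[of Q] unfolding Q_def[of "Least Q"] by metis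
  have hmin': "degree h \<le> degree p" if "p \<in> PB" "p \<noteq> 0" "poly p \<xi> = 0" for p
    using that by (intro hmin) (auto simp: Q_def)
  have dh: "degree h \<noteq> 0"
  proof
    assume "degree h = 0"
    then obtain c where "h = [:c:]" by (metis degree_eq_zeroE)
    then show False using h by simp
  qed
  have div_h: "\<exists>a q. a \<in> B \<and> a \<noteq> 0 \<and> q \<in> PB \<and> smult a p = q * h" if p: "p \<in> PB" "poly p \<xi> = 0" for p
  proof -
    obtain a q r where aqr: "a \<in> B" "a \<noteq> 0" "q \<in> PB" "r \<in> PB" "smult a p = q * h + r"
      "r = 0 \<or> degree r < degree h" using pseudo_division[OF h(1,2) p(1)] by blast
    have "poly r \<xi> = 0" using arg_cong[OF aqr(5), of "\<lambda>p. poly p \<xi>"] p h by simp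
    then have "r = 0" using aqr(4,6) hmin'[of r] by (metis not_le)
    then show ?thesis using aqr by auto
  qed
  have evh: "ev x h = 0"
  proof -
    obtain a q where aq: "a \<in> B" "a \<noteq> 0" "q \<in> PB" "smult a f = q * h" using div_h[OF f(1) \<xi>] by blast
    have "ev x q * ev x h = ev x (smult a f)" unfolding aq(4) using aq h by (simp add: ev_mult)
    also have "\<dots> = 0" using aq(1) f by (simp add: ev_smult)
    finally have "ev x q = 0 \<or> ev x h = 0" using D_domain ev_in_D x aq h by blast
    moreover have "ev x q \<noteq> 0"
    proof
      assume q0: "ev x q = 0"
      have "q \<noteq> 0" using aq f by auto
      then have "degree f = degree q + degree h"
        using arg_cong[OF aq(4), of degree] aq(2) h(2) by (simp add: degree_mult_eq)
      moreover have "degree f \<le> degree q" by (rule fmin'[OF aq(3) \<open>q \<noteq> 0\<close> q0])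
      ultimately show False using dh by simp
    qed
    ultimately show ?thesis by blast
  qed
  have 2: "ev x p = 0" if p: "p \<in> PB" "poly p \<xi> = 0" for p
  proof -
    obtain a q where aq: "a \<in> B" "a \<noteq> 0" "q \<in> PB" "smult a p = q * h" using div_h[OF p] by blast
    have "\<psi> a * ev x p = ev x (q * h)" unfolding aq(4)[symmetric] using aq(1) p by (simp add: ev_smult)
    also have "\<dots> = 0" using aq h evh by (simp add: ev_mult)
    finally have "\<psi> a = 0 \<or> ev x p = 0" using D_domain \<psi>_D[OF aq(1)] ev_in_D p x by blast
    then show ?thesis using aq \<psi>_eq_0 by auto
  qed
  show ?thesis using 1 2 by blast
qed

text \<open>The new subring is generated by \<open>B\<close> and a generic point
  \<open>\<xi>\<close>, which is sent to \<open>x\<close>. Equality of the two kernels makes the map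
  well defined as well as injective.\<close>

lemma extend:
  assumes x: "x \<in> D"
  shows "\<exists>B' \<psi>'. partial_embedding D u B' \<psi>' \<and> x \<in> \<psi>' ` B' \<and> \<psi> ` B \<subseteq> \<psi>' ` B'"
proof -
  obtain \<xi> where \<xi>: "\<And>p. p \<in> PB \<Longrightarrow> poly p \<xi> = 0 \<longleftrightarrow> ev x p = 0"
    using exists_generic_point[OF x] by blast
  define B' where "B' = (\<lambda>p. poly p \<xi>) ` PB"
  define \<psi>' where "\<psi>' z = ev x (SOME p. p \<in> PB \<and> poly p \<xi> = z)" for z
  have \<psi>': "\<psi>' (poly p \<xi>) = ev x p" if p: "p \<in> PB" for p
  proof -
    define q where "q = (SOME q. q \<in> PB \<and> poly q \<xi> = poly p \<xi>)"
    have q: "q \<in> PB \<and> poly q \<xi> = poly p \<xi>" unfolding q_def by (rule someI[of _ p]) (simp add: p)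
    then have "ev x (q - p) = 0" using \<xi>[of "q - p"] p by (simp add: PB_closed)
    then show ?thesis using q p by (simp add: \<psi>'_def q_def[symmetric] ev_diff)
  qed
  have inB': "poly p \<xi> \<in> B'" if "p \<in> PB" for p using that by (auto simp: B'_def)
  have "partial_embedding D u B' \<psi>'"
  proof unfold_locales
    show "countable B'" unfolding B'_def using countable_PB by simp
    show "0 \<in> B'" "1 \<in> B'" using inB'[OF PB_const[OF B01(1)]] inB'[OF PB_const[OF B01(2)]] by simp_all
    show "\<psi>' 1 = u" using \<psi>'[OF PB_const[OF B01(2)]] by (simp add: ev_const \<psi>_1)
    show "inj_on \<psi>' B'"
    proof (rule inj_onI)
      fix y z assume "y \<in> B'" "z \<in> B'" and eq: "\<psi>' y = \<psi>' z"
      then obtain p q where pq: "p \<in> PB" "y = poly p \<xi>" "q \<in> PB" "z = poly q \<xi>" by (auto simp: B'_def)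
      then have "ev x (p - q) = 0" using eq by (simp add: \<psi>' ev_diff)
      then show "y = z" using \<xi>[of "p - q"] pq by (simp add: PB_closed)
    qed
    fix y assume "y \<in> B'"
    then obtain p where p: "p \<in> PB" "y = poly p \<xi>" by (auto simp: B'_def)
    show "\<psi>' y \<in> D" using p x by (simp add: \<psi>' ev_in_D)
    show "- y \<in> B'" using inB'[OF PB_closed(3)[OF PB_0 p(1)]] p by simp
    fix z assume "z \<in> B'"
    then obtain q where q: "q \<in> PB" "z = poly q \<xi>" by (auto simp: B'_def)
    have "y + z = poly (p + q) \<xi>" "y * z = poly (p * q) \<xi>" using p q by simp_all
    then show "y + z \<in> B'" "y * z \<in> B'" "\<psi>' (y + z) = \<psi>' y + \<psi>' z" "\<psi>' (y * z) = \<psi>' y * \<psi>' z"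
      using p q by (simp_all add: \<psi>' PB_closed ev_add ev_mult inB' del: poly_add poly_mult)
  qed
  moreover have "x \<in> \<psi>' ` B'"
    using \<psi>'[OF PB_X] inB'[OF PB_X] ev_X[OF x] by (metis imageI)
  moreover have "\<psi> ` B \<subseteq> \<psi>' ` B'"
  proof
    fix y assume "y \<in> \<psi> ` B"
    then obtain b where b: "b \<in> B" "y = \<psi> b" by blast
    then show "y \<in> \<psi>' ` B'" using \<psi>'[OF PB_const[OF b(1)]] inB'[OF PB_const[OF b(1)]] by (metis ev_const imageI)
  qed
  ultimately show ?thesis by blast
qed

end

section \<open>Embedding finitely many elements and transferring Dedekind finiteness\<close>

context subdomain
begin

text \<open>The base of the induction. Rounding down the real part recovers the integer from its
  complex image, and characteristic zero gives injectivity.\<close>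

lemma int_embedding:
  "partial_embedding D u (range of_int) (\<lambda>z. of_int \<lfloor>Re z\<rfloor> * u)"
proof unfold_locales
  have u: "u * u = u" using D_unit D_closed(4) by blast
  have nat_D: "of_nat n * u \<in> D" if "n > 0" for n
    using that by (induction n rule: nat_induct_non_zero) (auto simp: distrib_right intro: D_closed)
  have int_D: "of_int k * u \<in> D" for k
  proof -
    have "0 \<in> D" using D_closed(1)[OF D_closed(4) D_closed(3)[OF D_closed(4)]] by simp
    consider "k = 0" | "k > 0" | "k < 0" by linarith
    then show ?thesis
    proof cases
      case 2
      then show ?thesis using nat_D[of "nat k"] by (simp add: of_nat_nat)
    next
      case 3
      then show ?thesis using D_closed(3)[OF nat_D[of "nat (- k)"]] by (simp add: of_nat_nat)
    qed (use \<open>0 \<in> D\<close> in simp)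
  qed
  have inj0: "k = 0" if "of_int k * u = 0" for k
  proof (rule ccontr)
    assume k: "k \<noteq> 0"
    have "of_nat (nat \<bar>k\<bar>) * u = 0"
      using that by (cases "k \<ge> 0") (auto simp: of_nat_nat)
    then show False using D_char[of "nat \<bar>k\<bar>"] k by simp
  qed
  show "countable (range complex_of_int)" by simp
  show "(0::complex) \<in> range of_int" "(1::complex) \<in> range of_int" by (metis of_int_0 rangeI, metis of_int_1 rangeI)
  show "of_int \<lfloor>Re 1\<rfloor> * u = u" by simp
  show "inj_on (\<lambda>z. of_int \<lfloor>Re z\<rfloor> * u) (range complex_of_int)"
  proof (rule inj_onI)
    fix x y assume "x \<in> range complex_of_int" "y \<in> range complex_of_int"
      and eq: "of_int \<lfloor>Re x\<rfloor> * u = of_int \<lfloor>Re y\<rfloor> * u"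
    then obtain k l where kl: "x = of_int k" "y = of_int l" by auto
    then have "of_int (k - l) * u = 0" using eq by (simp add: left_diff_distrib)
    then show "x = y" using inj0 kl by fastforce
  qed
  fix x assume "x \<in> range complex_of_int"
  then obtain k where k: "x = of_int k" by auto
  show "- x \<in> range complex_of_int" using k by (metis of_int_minus rangeI)
  show "of_int \<lfloor>Re x\<rfloor> * u \<in> D" using int_D by simp
  fix y assume "y \<in> range complex_of_int"
  then obtain l where l: "y = of_int l" by auto
  show "x + y \<in> range complex_of_int" "x * y \<in> range complex_of_int"
    unfolding k l by (metis of_int_add rangeI, metis of_int_mult rangeI)
  show "of_int \<lfloor>Re (x + y)\<rfloor> * u = of_int \<lfloor>Re x\<rfloor> * u + of_int \<lfloor>Re y\<rfloor> * u"
    "of_int \<lfloor>Re (x * y)\<rfloor> * u = of_int \<lfloor>Re x\<rfloor> * u * (of_int \<lfloor>Re y\<rfloor> * u)"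
  proof -
    have fl: "\<lfloor>Re (x + y)\<rfloor> = k + l" "\<lfloor>Re (x * y)\<rfloor> = k * l" "\<lfloor>Re x\<rfloor> = k" "\<lfloor>Re y\<rfloor> = l"
      by (simp_all add: k l flip: of_int_add of_int_mult)
    have "of_int k * u * (of_int l * u) = of_int k * of_int l * (u * u)" by (simp only: mult_ac)
    then show "of_int \<lfloor>Re (x + y)\<rfloor> * u = of_int \<lfloor>Re x\<rfloor> * u + of_int \<lfloor>Re y\<rfloor> * u"
      "of_int \<lfloor>Re (x * y)\<rfloor> * u = of_int \<lfloor>Re x\<rfloor> * u * (of_int \<lfloor>Re y\<rfloor> * u)"
      unfolding fl u by (simp_all add: distrib_right)
  qed
qed

lemma exists_embedding:
  assumes "finite F" "F \<subseteq> D"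
  shows "\<exists>B \<psi>. partial_embedding D u B \<psi> \<and> F \<subseteq> \<psi> ` B"
  using assms
proof (induction F rule: finite_induct)
  case empty
  then show ?case using int_embedding by blast
next
  case (insert x F)
  then obtain B \<psi> where B: "partial_embedding D u B \<psi>" "F \<subseteq> \<psi> ` B" by auto
  have "x \<in> D" using insert.prems by simp
  then obtain B' \<psi>' where B': "partial_embedding D u B' \<psi>'" "x \<in> \<psi>' ` B'" "\<psi> ` B \<subseteq> \<psi>' ` B'"
    using partial_embedding.extend[OF B(1)] by metis
  then have "insert x F \<subseteq> \<psi>' ` B'" using B(2) by (metis insert_subset order.trans)
  then show ?case using B'(1) by metis
qed

text \<open>Only finitely many coefficients occur in \<open>e\<close>, \<open>v\<close> and
  \<open>w\<close>, so these matrices lift along \<open>\<psi>\<close> to matrices over a subring of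
  the complex numbers. The relations lift because \<open>\<psi>\<close> is injective and
  multiplicative on that subring.\<close>

lemma dedekind_conv_subdomain:
  assumes S: "semigroup_on S" and C: "dedekind_conv S (UNIV :: complex set)"
  shows "dedekind_conv S D"
  unfolding dedekind_conv_def
proof (intro ballI impI, elim conjE)
  interpret S: semigroup_on S by (rule S)
  fix e v w
  assume in': "e \<in> fin_mats S D" "v \<in> fin_mats S D" "w \<in> fin_mats S D"
  assume r: "conv S e e = e" "conv S e v = v" "conv S v e = v" "conv S e w = w" "conv S w e = w" "conv S v w = e"
  let ?F = "lkp e ` supp e \<union> lkp v ` supp v \<union> lkp w ` supp w"
  have "finite ?F" "?F \<subseteq> D" using in' by (auto simp: coeffs_in_def)
  then obtain B \<psi> where "partial_embedding D u B \<psi>" and F: "?F \<subseteq> \<psi> ` B"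
    using exists_embedding by metis
  then interpret partial_embedding D u B \<psi> by simp
  have B: "add_mult_closed B" by (simp add: add_mult_closed_def B01 B_closed)
  define push where "push f = Poly_Mapping.map \<psi> f" for f :: "nat \<times> nat \<times> 'b \<Rightarrow>\<^sub>0 complex"
  have push: "lkp (push f) x = \<psi> (lkp f x)" for f x
    by (simp add: push_def Poly_Mapping.map.rep_eq when_def)
  have push_supp: "supp (push f) \<subseteq> supp f" for f by (auto simp: in_keys_iff push)
  have push_conv: "push (conv S f g) = conv S (push f) (push g)"
    if "f \<in> fin_mats S B" "g \<in> fin_mats S B" for f g
  proof (rule poly_mapping_eqI)
    fix x :: "nat \<times> nat \<times> 'b"
    obtain i l t where x: "x = (i, l, t)" by (metis surj_pair)
    have fg: "lkp f y \<in> B" "lkp g y \<in> B" for y using that unfolding coeffs_in_def by blast+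
    let ?c = "\<lambda>y z. fst y = i \<and> fst (snd y) = fst z \<and> fst (snd z) = l \<and> snd (snd y) \<otimes>\<^bsub>S\<^esub> snd (snd z) = t"
    have in1: "(if ?c y z then lkp f y * lkp g z else 0) \<in> B" for y z
      using fg B01 B_closed by auto
    have in2: "(\<Sum>z\<in>supp g. if ?c y z then lkp f y * lkp g z else 0) \<in> B" for y
      by (rule \<psi>_sum[THEN conjunct1], rule in1)
    have "lkp (push (conv S f g)) x = \<psi> (\<Sum>y\<in>supp f. \<Sum>z\<in>supp g. if ?c y z then lkp f y * lkp g z else 0)"
      unfolding push x lookup_conv[OF finite_keys order.refl finite_keys order.refl] ..
    also have "\<dots> = (\<Sum>y\<in>supp f. \<psi> (\<Sum>z\<in>supp g. if ?c y z then lkp f y * lkp g z else 0))"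
      by (rule \<psi>_sum[THEN conjunct2], rule in2)
    also have "\<dots> = (\<Sum>y\<in>supp f. \<Sum>z\<in>supp g. \<psi> (if ?c y z then lkp f y * lkp g z else 0))"
      by (rule sum.cong[OF refl], rule \<psi>_sum[THEN conjunct2], rule in1)
    also have "\<dots> = (\<Sum>y\<in>supp f. \<Sum>z\<in>supp g. if ?c y z then \<psi> (lkp f y) * \<psi> (lkp g z) else 0)"
      by (intro sum.cong refl) (simp add: \<psi>_mult fg)
    also have "\<dots> = lkp (conv S (push f) (push g)) x"
      unfolding x lookup_conv[OF finite_keys push_supp finite_keys push_supp] push ..
    finally show "lkp (push (conv S f g)) x = lkp (conv S (push f) (push g)) x" .
  qed
  have push_inj: "f = g" if "f \<in> fin_mats S B" "g \<in> fin_mats S B" "push f = push g" for f g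
  proof (rule poly_mapping_eqI)
    fix x
    have "lkp f x \<in> B" "lkp g x \<in> B" "\<psi> (lkp f x) = \<psi> (lkp g x)"
      using that push[of f x] push[of g x] unfolding coeffs_in_def by (blast, blast, simp)
    then show "lkp f x = lkp g x" using \<psi>_inj by (auto dest: inj_onD)
  qed
  have lift: "\<exists>f'\<in>fin_mats S B. push f' = f"
    if f: "f \<in> fin_mats S D" "lkp f ` supp f \<subseteq> \<psi> ` B" for f
  proof -
    have i0: "inv_into B \<psi> 0 = 0" using inv_into_f_f[OF \<psi>_inj B01(1)] by simp
    define f' where "f' = Poly_Mapping.map (inv_into B \<psi>) f"
    have f': "lkp f' x = inv_into B \<psi> (lkp f x)" for x
      by (simp add: f'_def Poly_Mapping.map.rep_eq when_def i0)
    have im: "lkp f x \<in> \<psi> ` B" for x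
    proof (cases "x \<in> supp f")
      case False
      then show ?thesis using B01(1) \<psi>_0 by (metis imageI in_keys_iff)
    qed (use f(2) in blast)
    have "push f' = f" by (intro poly_mapping_eqI) (simp add: push f' f_inv_into_f[OF im])
    moreover have "supp f' \<subseteq> supp f" by (auto simp: in_keys_iff f' i0)
    then have "f' \<in> fin_mats S B" using f(1) inv_into_into[OF im] by (auto simp: coeffs_in_def f')
    ultimately show ?thesis by blast
  qed
  obtain e' v' w' where e': "e' \<in> fin_mats S B" "push e' = e"
    and v': "v' \<in> fin_mats S B" "push v' = v" and w': "w' \<in> fin_mats S B" "push w' = w"
    using lift[OF in'(1)] lift[OF in'(2)] lift[OF in'(3)] F by auto
  have trans: "conv S f g = h"
    if "f \<in> fin_mats S B" "g \<in> fin_mats S B" "h \<in> fin_mats S B"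
      "conv S (push f) (push g) = push h" for f g h
    using push_inj[OF S.conv_closed[OF B that(1,2)] that(3)] push_conv[OF that(1,2)] that(4) by simp
  have UN: "fin_mats S B \<subseteq> fin_mats S UNIV" by (intro coeffs_in_mono) auto
  have "conv S w' v' = e'"
    by (rule C[unfolded dedekind_conv_def, rule_format])
      (use e' v' w' r UN in \<open>auto intro!: trans\<close>)
  then show "conv S w v = e" using push_conv[OF w'(1) v'(1)] e' v' w' by simp
qed

end

lemma (in cring) subdomain_embed:
  assumes "domain R" "char_zero R"
  shows "subdomain (embed R ` carrier R) (embed R \<one>)"
proof -
  interpret domain R by fact
  have add_pow: "of_nat n * embed R \<one> = embed R ([n] \<cdot> \<one>)" for n :: nat
    by (induction n) (simp_all add: embed_ops distrib_right add.nat_pow_Suc add.commute)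
  have eq0: "embed R c = 0 \<longleftrightarrow> c = \<zero>" if "c \<in> carrier R" for c
    using inj_embed embed_ops(1) that by (metis inj_onD zero_closed)
  show ?thesis
  proof
    fix x y assume "x \<in> embed R ` carrier R" "y \<in> embed R ` carrier R"
    then obtain a b where ab: "a \<in> carrier R" "b \<in> carrier R" "x = embed R a" "y = embed R b" by blast
    show "x + y \<in> embed R ` carrier R" "x * y \<in> embed R ` carrier R"
      using ab by (simp_all flip: embed_ops)
    show "x = 0 \<or> y = 0" if "x * y = 0"
      using that ab integral[of a b] by (simp add: eq0 flip: embed_ops(3))
  next
    fix x assume "x \<in> embed R ` carrier R"
    then obtain a where a: "a \<in> carrier R" "x = embed R a" by blast
    show "- x \<in> embed R ` carrier R" "embed R \<one> * x = x"
      using a by (simp_all flip: embed_ops(3,4))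
  next
    fix n :: nat assume "n > 0"
    then have "[n] \<cdot> \<one> \<noteq> \<zero>" using assms(2) by (simp add: char_zero_def)
    then show "of_nat n * embed R \<one> \<noteq> 0" by (simp add: add_pow eq0)
  qed simp
qed

section \<open>The Schuetzenberger representations of an inverse semigroup\<close>

sublocale inverse_semigroup \<subseteq> semigroup_on
  by unfold_locales (auto intro: m_closed m_assoc)

section \<open>Calculus in inverse semigroups and their maximal subgroups\<close>

context inverse_semigroup
begin

abbreviation st :: "'a \<Rightarrow> 'a" (\<open>_\<^sup>\<star>\<close> [1000] 1000) where "s\<^sup>\<star> \<equiv> star S s"

lemma star_props:
  assumes "s \<in> carrier S"
  shows "s\<^sup>\<star> \<in> carrier S" "s \<otimes> s\<^sup>\<star> \<otimes> s = s" "s\<^sup>\<star> \<otimes> s \<otimes> s\<^sup>\<star> = s\<^sup>\<star>"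
  using theI'[OF ex1_star[OF assms]] unfolding star_def by auto

lemma star_eqI:
  assumes "s \<in> carrier S" "t \<in> carrier S" "s \<otimes> t \<otimes> s = s" "t \<otimes> s \<otimes> t = t"
  shows "s\<^sup>\<star> = t"
  using ex1_star[OF assms(1)] star_props[OF assms(1)] assms by blast

lemmas star_closed [simp] = star_props(1)
declare m_closed [simp]

lemma assoc_rules:
  assumes "s \<in> carrier S"
  shows "s \<otimes> (s\<^sup>\<star> \<otimes> s) = s" "s\<^sup>\<star> \<otimes> (s \<otimes> s\<^sup>\<star>) = s\<^sup>\<star>"
    "x \<in> carrier S \<Longrightarrow> s \<otimes> (s\<^sup>\<star> \<otimes> (s \<otimes> x)) = s \<otimes> x"
    "x \<in> carrier S \<Longrightarrow> s\<^sup>\<star> \<otimes> (s \<otimes> (s\<^sup>\<star> \<otimes> x)) = s\<^sup>\<star> \<otimes> x"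
  using star_props[OF assms] assms by (simp_all add: m_assoc[symmetric])

lemma star_star [simp]: "s \<in> carrier S \<Longrightarrow> s\<^sup>\<star>\<^sup>\<star> = s"
  by (rule star_eqI) (simp_all add: star_props)

lemma idempotentsD: "e \<in> idempotents S \<Longrightarrow> e \<in> carrier S" "e \<in> idempotents S \<Longrightarrow> e \<otimes> e = e"
  by (auto simp: idempotents_def)

lemma idem_absorb: "e \<in> idempotents S \<Longrightarrow> x \<in> carrier S \<Longrightarrow> e \<otimes> (e \<otimes> x) = e \<otimes> x"
  by (simp add: idempotents_def m_assoc[symmetric])

lemma star_idem: "e \<in> idempotents S \<Longrightarrow> e\<^sup>\<star> = e"
  by (rule star_eqI) (auto simp: idempotents_def)

lemma star_mult_idem [simp]:
  assumes "s \<in> carrier S"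
  shows "s\<^sup>\<star> \<otimes> s \<in> idempotents S" "s \<otimes> s\<^sup>\<star> \<in> idempotents S"
  using assms by (simp_all add: idempotents_def m_assoc assoc_rules)

text \<open>The inverse \<open>x\<close> of \<open>ef\<close> equals \<open>fxe\<close> by
  uniqueness of inverses, and this form makes \<open>x\<close> idempotent. Idempotents are their own
  inverses, so \<open>ef\<close>, the inverse of \<open>x\<close>, is \<open>x\<close>
  itself.\<close>

lemma idem_mult:
  assumes e: "e \<in> idempotents S" and f: "f \<in> idempotents S"
  shows "e \<otimes> f \<in> idempotents S"
proof -
  note [simp] = idempotentsD[OF e] idempotentsD[OF f] idem_absorb[OF e] idem_absorb[OF f]
  define x where "x = (e \<otimes> f)\<^sup>\<star>"
  have x [simp]: "x \<in> carrier S" by (simp add: x_def)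
  have 1: "(e \<otimes> f) \<otimes> x \<otimes> (e \<otimes> f) = e \<otimes> f" "x \<otimes> (e \<otimes> f) \<otimes> x = x"
    unfolding x_def by (rule star_props; simp)+
  have 2: "e \<otimes> (f \<otimes> (x \<otimes> (e \<otimes> f))) = e \<otimes> f" "x \<otimes> (e \<otimes> (f \<otimes> x)) = x"
    using 1 by (simp_all add: m_assoc)
  have 3: "x \<otimes> (e \<otimes> (f \<otimes> (x \<otimes> e))) = x \<otimes> e"
    using arg_cong[OF 2(2), of "\<lambda>z. z \<otimes> e"] by (simp add: m_assoc)
  have "(e \<otimes> f)\<^sup>\<star> = f \<otimes> (x \<otimes> e)"
    by (rule star_eqI) (simp_all add: m_assoc 2 3)
  then have xe: "x = f \<otimes> (x \<otimes> e)" by (simp add: x_def)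
  have "x \<otimes> x = (f \<otimes> (x \<otimes> e)) \<otimes> (f \<otimes> (x \<otimes> e))" using xe by simp
  also have "\<dots> = f \<otimes> (x \<otimes> (e \<otimes> (f \<otimes> (x \<otimes> e))))" by (simp add: m_assoc)
  also have "\<dots> = x" unfolding 3 by (rule xe[symmetric])
  finally have "x \<in> idempotents S" by (simp add: idempotents_def)
  moreover have "x\<^sup>\<star> = e \<otimes> f" by (simp add: x_def)
  ultimately show ?thesis using star_idem by simp
qed

text \<open>Both \<open>fe\<close> and the idempotent \<open>ef\<close> are inverses of
  \<open>ef\<close>, so uniqueness identifies them.\<close>

lemma idem_commute:
  assumes e: "e \<in> idempotents S" and f: "f \<in> idempotents S"
  shows "e \<otimes> f = f \<otimes> e"
proof -
  note [simp] = idempotentsD[OF e] idempotentsD[OF f] idem_absorb[OF e] idem_absorb[OF f]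
  have ef: "e \<otimes> (f \<otimes> (e \<otimes> f)) = e \<otimes> f" "f \<otimes> (e \<otimes> (f \<otimes> e)) = f \<otimes> e"
    using idempotentsD(2)[OF idem_mult[OF e f]] idempotentsD(2)[OF idem_mult[OF f e]]
    by (simp_all add: m_assoc)
  have "(e \<otimes> f)\<^sup>\<star> = f \<otimes> e" by (rule star_eqI) (simp_all add: m_assoc ef)
  then show ?thesis using star_idem[OF idem_mult[OF e f]] by simp
qed

lemma star_mult:
  assumes s: "s \<in> carrier S" and t: "t \<in> carrier S"
  shows "(s \<otimes> t)\<^sup>\<star> = t\<^sup>\<star> \<otimes> s\<^sup>\<star>"
proof (rule star_eqI)
  note [simp] = s t
  have c: "(t \<otimes> t\<^sup>\<star>) \<otimes> (s\<^sup>\<star> \<otimes> s) = (s\<^sup>\<star> \<otimes> s) \<otimes> (t \<otimes> t\<^sup>\<star>)"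
    by (rule idem_commute) simp_all
  have "s \<otimes> t \<otimes> (t\<^sup>\<star> \<otimes> s\<^sup>\<star>) \<otimes> (s \<otimes> t) = s \<otimes> ((t \<otimes> t\<^sup>\<star>) \<otimes> (s\<^sup>\<star> \<otimes> s)) \<otimes> t"
    by (simp add: m_assoc)
  also have "\<dots> = s \<otimes> t" unfolding c by (simp add: m_assoc assoc_rules)
  finally show "s \<otimes> t \<otimes> (t\<^sup>\<star> \<otimes> s\<^sup>\<star>) \<otimes> (s \<otimes> t) = s \<otimes> t" .
  have "t\<^sup>\<star> \<otimes> s\<^sup>\<star> \<otimes> (s \<otimes> t) \<otimes> (t\<^sup>\<star> \<otimes> s\<^sup>\<star>) = t\<^sup>\<star> \<otimes> ((s\<^sup>\<star> \<otimes> s) \<otimes> (t \<otimes> t\<^sup>\<star>)) \<otimes> s\<^sup>\<star>"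
    by (simp add: m_assoc)
  also have "\<dots> = t\<^sup>\<star> \<otimes> s\<^sup>\<star>" unfolding c[symmetric] by (simp add: m_assoc assoc_rules)
  finally show "t\<^sup>\<star> \<otimes> s\<^sup>\<star> \<otimes> (s \<otimes> t) \<otimes> (t\<^sup>\<star> \<otimes> s\<^sup>\<star>) = t\<^sup>\<star> \<otimes> s\<^sup>\<star>" .
qed (use s t in simp_all)

lemma maximal_subgroup_simps:
  "carrier (maximal_subgroup S e) = {s \<in> carrier S. s \<otimes> s\<^sup>\<star> = e \<and> s\<^sup>\<star> \<otimes> s = e}"
  "mult (maximal_subgroup S e) = mult S" "one (maximal_subgroup S e) = e"
  by (simp_all add: maximal_subgroup_def)

lemma in_maximal_subgroupD:
  assumes "g \<in> carrier (maximal_subgroup S e)"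
  shows "g \<in> carrier S" "g \<otimes> g\<^sup>\<star> = e" "g\<^sup>\<star> \<otimes> g = e" "e \<otimes> g = g" "g \<otimes> e = g"
proof -
  show g: "g \<in> carrier S" "g \<otimes> g\<^sup>\<star> = e" "g\<^sup>\<star> \<otimes> g = e"
    using assms by (auto simp: maximal_subgroup_simps)
  show "e \<otimes> g = g" using g(1) star_props(2)[of g] unfolding g(2)[symmetric] by simp
  show "g \<otimes> e = g" using g(1) assoc_rules(1)[of g] unfolding g(3)[symmetric] by simp
qed

lemma maximal_subgroup_mult:
  assumes g: "g \<in> carrier (maximal_subgroup S e)" and h: "h \<in> carrier (maximal_subgroup S e)"
  shows "g \<otimes> h \<in> carrier (maximal_subgroup S e)"
proof -
  note G = in_maximal_subgroupD[OF g] and H = in_maximal_subgroupD[OF h]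
  have "g \<otimes> h \<otimes> (g \<otimes> h)\<^sup>\<star> = g \<otimes> (h \<otimes> h\<^sup>\<star>) \<otimes> g\<^sup>\<star>"
    using G(1) H(1) by (simp add: star_mult m_assoc)
  also have "\<dots> = e" using G(2,5) H(2) by simp
  finally have 1: "g \<otimes> h \<otimes> (g \<otimes> h)\<^sup>\<star> = e" .
  have "(g \<otimes> h)\<^sup>\<star> \<otimes> (g \<otimes> h) = h\<^sup>\<star> \<otimes> ((g\<^sup>\<star> \<otimes> g) \<otimes> h)"
    using G(1) H(1) by (simp add: star_mult m_assoc)
  also have "\<dots> = e" using G(3) H(3,4) by simp
  finally show ?thesis using 1 G(1) H(1) by (simp add: maximal_subgroup_simps)
qed

lemma group_maximal_subgroup:
  assumes e: "e \<in> idempotents S"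
  shows "group (maximal_subgroup S e)" (is "group ?G")
proof (rule groupI)
  show "x \<otimes>\<^bsub>?G\<^esub> y \<in> carrier ?G"
    if "x \<in> carrier ?G" "y \<in> carrier ?G" for x y
    using maximal_subgroup_mult[OF that] by (simp add: maximal_subgroup_simps(2))
  show "\<one>\<^bsub>?G\<^esub> \<in> carrier ?G"
    using e star_idem[OF e] by (simp add: maximal_subgroup_simps idempotents_def)
  show "\<exists>y\<in>carrier ?G. y \<otimes>\<^bsub>?G\<^esub> x = \<one>\<^bsub>?G\<^esub>"
    if "x \<in> carrier ?G" for x
    using in_maximal_subgroupD[OF that] by (intro bexI[of _ "x\<^sup>\<star>"]) (simp_all add: maximal_subgroup_simps)
  show "x \<otimes>\<^bsub>?G\<^esub> y \<otimes>\<^bsub>?G\<^esub> z =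
      x \<otimes>\<^bsub>?G\<^esub> (y \<otimes>\<^bsub>?G\<^esub> z)"
    if "x \<in> carrier ?G" "y \<in> carrier ?G"
      "z \<in> carrier ?G" for x y z
    unfolding maximal_subgroup_simps(2) by (intro m_assoc in_maximal_subgroupD(1)[of _ e] that)
  show "\<one>\<^bsub>?G\<^esub> \<otimes>\<^bsub>?G\<^esub> x = x"
    if "x \<in> carrier ?G" for x
    unfolding maximal_subgroup_simps by (rule in_maximal_subgroupD(4)[OF that])
qed

end

text \<open>The left action of \<open>S\<close> on the \<open>\<L>\<close>-class of \<open>e\<close>, a free right \<open>G\<^sub>e\<close>-set: \<open>x f\<close> represents
  the orbit of elements with range \<open>f\<close>, and \<open>s \<otimes> x f' = x f \<otimes> \<gamma>\<close> says that \<open>s\<close> moves the orbit of \<open>f'\<close>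
  to that of \<open>f\<close> with cocycle \<open>\<gamma>\<close>.\<close>
locale schutzenberger = inverse_semigroup +
  fixes e :: 'a and x :: "'a \<Rightarrow> 'a" and \<iota> :: "'a \<Rightarrow> nat" and Fs :: "'a set"
  assumes e: "e \<in> idempotents S"
    and Fs: "Fs = {f \<in> idempotents S. D_equivalent S e f}" and fin: "finite Fs"
    and x: "f \<in> Fs \<Longrightarrow> x f \<in> carrier S" "f \<in> Fs \<Longrightarrow> star S (x f) \<otimes> x f = e"
      "f \<in> Fs \<Longrightarrow> x f \<otimes> star S (x f) = f"
    and inj: "inj_on \<iota> Fs"
begin

abbreviation G :: "'a monoid" where "G \<equiv> maximal_subgroup S e"

definition moves :: "'a \<Rightarrow> 'a \<Rightarrow> 'a \<Rightarrow> bool" where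
  "moves f s f' \<longleftrightarrow> (\<exists>g\<in>carrier G. s \<otimes> x f' = x f \<otimes> g)"

text \<open>Meaningful only where \<open>moves f s f'\<close> holds; there the left factor cancels
  \<open>x f\<close>, so the value is the group element from the definition of
  \<open>moves\<close>.\<close>

definition \<gamma> :: "'a \<Rightarrow> 'a \<Rightarrow> 'a \<Rightarrow> 'a" where
  "\<gamma> f s f' = (x f)\<^sup>\<star> \<otimes> (s \<otimes> x f')"

lemma x_e: "f \<in> Fs \<Longrightarrow> x f \<otimes> e = x f"
  using assoc_rules(1)[OF x(1)] x(2) by simp

lemma movesD:
  assumes "f \<in> Fs" "moves f s f'"
  shows "\<gamma> f s f' \<in> carrier G" "s \<otimes> x f' = x f \<otimes> \<gamma> f s f'"
proof -
  obtain g where g: "g \<in> carrier G" "s \<otimes> x f' = x f \<otimes> g" using assms by (auto simp: moves_def)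
  have "\<gamma> f s f' = ((x f)\<^sup>\<star> \<otimes> x f) \<otimes> g"
    using g x(1)[OF assms(1)] in_maximal_subgroupD(1)[OF g(1)] by (simp add: \<gamma>_def m_assoc)
  also have "\<dots> = g" using x[OF assms(1)] in_maximal_subgroupD[OF g(1)] by simp
  finally show "\<gamma> f s f' \<in> carrier G" "s \<otimes> x f' = x f \<otimes> \<gamma> f s f'" using g by auto
qed

lemma moves_mult:
  assumes F: "f \<in> Fs" "f' \<in> Fs" "f'' \<in> Fs" and s: "s \<in> carrier S" "t \<in> carrier S"
    and m: "moves f s f'" "moves f' t f''"
  shows "moves f (s \<otimes> t) f''" "\<gamma> f (s \<otimes> t) f'' = \<gamma> f s f' \<otimes> \<gamma> f' t f''"
proof -
  note a = movesD[OF F(1) m(1)] and b = movesD[OF F(2) m(2)]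
  note c = in_maximal_subgroupD[OF a(1)] in_maximal_subgroupD[OF b(1)]
  have "(s \<otimes> t) \<otimes> x f'' = s \<otimes> (x f' \<otimes> \<gamma> f' t f'')" using b(2) s x(1) F by (simp add: m_assoc)
  also have "\<dots> = (s \<otimes> x f') \<otimes> \<gamma> f' t f''" using s x(1) F c(1,6) by (simp add: m_assoc)
  also have "\<dots> = x f \<otimes> (\<gamma> f s f' \<otimes> \<gamma> f' t f'')"
    using a(2) x(1) F c(1,6) by (simp add: m_assoc)
  finally have eq: "(s \<otimes> t) \<otimes> x f'' = x f \<otimes> (\<gamma> f s f' \<otimes> \<gamma> f' t f'')" .
  have g: "\<gamma> f s f' \<otimes> \<gamma> f' t f'' \<in> carrier G" using maximal_subgroup_mult[OF a(1) b(1)] .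
  show "moves f (s \<otimes> t) f''" using eq g by (auto simp: moves_def)
  have "\<gamma> f (s \<otimes> t) f'' = ((x f)\<^sup>\<star> \<otimes> x f) \<otimes> (\<gamma> f s f' \<otimes> \<gamma> f' t f'')"
    unfolding \<gamma>_def[of f "s \<otimes> t"] eq using x(1) F c(1,6) by (simp add: m_assoc)
  also have "\<dots> = \<gamma> f s f' \<otimes> \<gamma> f' t f''" using x F in_maximal_subgroupD(4)[OF g] by simp
  finally show "\<gamma> f (s \<otimes> t) f'' = \<gamma> f s f' \<otimes> \<gamma> f' t f''" .
qed

text \<open>The target orbit can be read off: any \<open>y\<close> in the orbit of
  \<open>x f\<close> satisfies \<open>y \<otimes> y\<^sup>\<star> = f\<close>.\<close>

lemma moves_unique:
  assumes F: "f \<in> Fs" "f' \<in> Fs" and m: "moves f t f''" "moves f' t f''"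
  shows "f = f'"
proof -
  have range: "(x f \<otimes> g) \<otimes> (x f \<otimes> g)\<^sup>\<star> = f" if "f \<in> Fs" "g \<in> carrier G" for f g
  proof -
    note g = in_maximal_subgroupD[OF that(2)]
    have "(x f \<otimes> g) \<otimes> (x f \<otimes> g)\<^sup>\<star> = x f \<otimes> ((g \<otimes> g\<^sup>\<star>) \<otimes> (x f)\<^sup>\<star>)"
      using x(1)[OF that(1)] g(1) by (simp add: star_mult m_assoc)
    also have "\<dots> = x f \<otimes> (((x f)\<^sup>\<star> \<otimes> x f) \<otimes> (x f)\<^sup>\<star>)" using x[OF that(1)] g by simp
    also have "\<dots> = x f \<otimes> (x f)\<^sup>\<star>" using x(1)[OF that(1)] by (simp add: star_props)
    also have "\<dots> = f" by (rule x(3)[OF that(1)])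
    finally show ?thesis .
  qed
  show ?thesis
    using range[OF F(1) movesD(1)[OF F(1) m(1)]] range[OF F(2) movesD(1)[OF F(2) m(2)]]
      movesD(2)[OF F(1) m(1)] movesD(2)[OF F(2) m(2)] by simp
qed

text \<open>The element \<open>y = t \<otimes> x f'\<close> is still in the \<L>-class of
  \<open>e\<close>, hence in the orbit indexed by its range. It differs from the representative of
  that orbit by the group element obtained on cancelling it.\<close>

lemma moves_if_domain:
  assumes F: "f' \<in> Fs" and t: "t \<in> carrier S" and dom: "(t \<otimes> x f')\<^sup>\<star> \<otimes> (t \<otimes> x f') = e"
  shows "\<exists>f\<in>Fs. moves f t f'"
proof -
  define y where "y = t \<otimes> x f'"
  have y: "y \<in> carrier S" "y\<^sup>\<star> \<otimes> y = e" using F t x dom by (auto simp: y_def)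
  define f where "f = y \<otimes> y\<^sup>\<star>"
  have f: "f \<in> Fs" using y by (auto simp: Fs f_def D_equivalent_def)
  define g where "g = (x f)\<^sup>\<star> \<otimes> y"
  have "g\<^sup>\<star> \<otimes> g = y\<^sup>\<star> \<otimes> ((x f \<otimes> (x f)\<^sup>\<star>) \<otimes> y)"
    using y(1) x(1)[OF f] by (simp add: g_def star_mult m_assoc)
  also have "\<dots> = y\<^sup>\<star> \<otimes> y" unfolding x(3)[OF f] using y(1) by (simp add: f_def m_assoc assoc_rules)
  finally have 1: "g\<^sup>\<star> \<otimes> g = e" using y by simp
  have "g \<otimes> g\<^sup>\<star> = (x f)\<^sup>\<star> \<otimes> ((y \<otimes> y\<^sup>\<star>) \<otimes> x f)"
    using y(1) x(1)[OF f] by (simp add: g_def star_mult m_assoc)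
  also have "\<dots> = (x f)\<^sup>\<star> \<otimes> ((x f \<otimes> (x f)\<^sup>\<star>) \<otimes> x f)" using x(3)[OF f] by (simp add: f_def)
  also have "\<dots> = (x f)\<^sup>\<star> \<otimes> x f" using x(1)[OF f] by (simp add: m_assoc assoc_rules)
  also have "\<dots> = e" by (rule x(2)[OF f])
  finally have g: "g \<in> carrier G" using 1 y(1) x(1)[OF f] by (simp add: maximal_subgroup_simps g_def)
  have "x f \<otimes> g = (x f \<otimes> (x f)\<^sup>\<star>) \<otimes> y" using x(1)[OF f] y(1) by (simp add: g_def m_assoc)
  also have "\<dots> = y" unfolding x(3)[OF f] using y(1) by (simp add: f_def star_props)
  finally show ?thesis using f g unfolding y_def moves_def by (metis)
qed

text \<open>The domain of a product can only shrink. If it is still \<open>e\<close> after applying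
  \<open>s \<otimes> t\<close>, it was \<open>e\<close> after applying \<open>t\<close> alone, so
  there is an intermediate orbit. This makes zero entries compatible with matrix
  multiplication.\<close>

lemma moves_multD:
  assumes F: "f \<in> Fs" "f'' \<in> Fs" and s: "s \<in> carrier S" "t \<in> carrier S" and m: "moves f (s \<otimes> t) f''"
  shows "\<exists>f'\<in>Fs. moves f s f' \<and> moves f' t f''"
proof -
  note [simp] = s x(1)[OF F(1)] x(1)[OF F(2)]
  define g where "g = \<gamma> f (s \<otimes> t) f''"
  have g: "g \<in> carrier G" "s \<otimes> t \<otimes> x f'' = x f \<otimes> g" using movesD[OF F(1) m] by (auto simp: g_def)
  note gd = in_maximal_subgroupD[OF g(1)]
  define y where "y = t \<otimes> x f''"
  have y [simp]: "y \<in> carrier S" by (simp add: y_def)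
  have "(s \<otimes> y)\<^sup>\<star> \<otimes> (s \<otimes> y) = (x f \<otimes> g)\<^sup>\<star> \<otimes> (x f \<otimes> g)"
    using g(2) by (simp add: y_def m_assoc)
  also have "\<dots> = g\<^sup>\<star> \<otimes> (((x f)\<^sup>\<star> \<otimes> x f) \<otimes> g)"
    using gd(1) by (simp add: star_mult m_assoc)
  also have "\<dots> = e" unfolding x(2)[OF F(1)] using gd by simp
  finally have sy: "(s \<otimes> y)\<^sup>\<star> \<otimes> (s \<otimes> y) = e" .
  have ye: "y \<otimes> e = y" using x_e[OF F(2)] idempotentsD(1)[OF e] by (simp add: y_def m_assoc)
  \<comment> \<open>This says that \<open>e\<close> lies below the domain idempotent of
    \<open>y\<close>; the relation \<open>y \<otimes> e = y\<close> provides the opposite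
    inequality.\<close>
  have "e = e \<otimes> (y\<^sup>\<star> \<otimes> y)"
    using arg_cong[OF sy, of "\<lambda>z. z \<otimes> (y\<^sup>\<star> \<otimes> y)"] sy by (simp add: star_mult m_assoc assoc_rules)
  also have "\<dots> = (y\<^sup>\<star> \<otimes> y) \<otimes> e" using e by (intro idem_commute) simp_all
  also have "\<dots> = y\<^sup>\<star> \<otimes> y" using ye idempotentsD(1)[OF e] by (simp add: m_assoc)
  finally obtain f' where f': "f' \<in> Fs" "moves f' t f''"
    using moves_if_domain[OF F(2) s(2)] unfolding y_def by auto
  note h = movesD[OF f'(1) f'(2)] and hd = in_maximal_subgroupD[OF movesD(1)[OF f'(1) f'(2)]]
  define h where "h = \<gamma> f' t f''"
  have hs: "h\<^sup>\<star> \<in> carrier G" using hd unfolding h_def by (simp add: maximal_subgroup_simps)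
  have "s \<otimes> x f' = s \<otimes> (x f' \<otimes> (h \<otimes> h\<^sup>\<star>))"
    using hd x_e[OF f'(1)] unfolding h_def by simp
  also have "\<dots> = (s \<otimes> t \<otimes> x f'') \<otimes> h\<^sup>\<star>"
    using h(2) hd(1) x(1)[OF f'(1)] unfolding h_def by (simp add: m_assoc)
  also have "\<dots> = x f \<otimes> (g \<otimes> h\<^sup>\<star>)"
    using hs g gd(1) by (simp add: m_assoc in_maximal_subgroupD(1))
  finally have "moves f s f'"
    using maximal_subgroup_mult[OF g(1) hs] by (auto simp: moves_def)
  then show ?thesis using f' by blast
qed

end

section \<open>The matrix representation over the group algebra of a maximal subgroup\<close>

context schutzenberger
begin

text \<open>Indices of finitary matrices are natural numbers, so the pair of an old index and an
  orbit is encoded as one.\<close>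

definition enc :: "nat \<Rightarrow> 'a \<Rightarrow> nat" where
  "enc p f = prod_encode (p, \<iota> f)"

lemma enc_eq_iff: "f \<in> Fs \<Longrightarrow> f' \<in> Fs \<Longrightarrow> enc p f = enc q f' \<longleftrightarrow> p = q \<and> f = f'"
  using inj by (auto simp: enc_def inj_on_def)

fun rep_entry :: "nat \<times> nat \<times> 'a \<Rightarrow> 'c::comm_ring_1 \<Rightarrow> ('a, 'c) fin_mat" where
  "rep_entry (p, q, s) c = (\<Sum>f\<in>Fs. \<Sum>f'\<in>Fs. if moves f s f' then sng (enc p f, enc q f', \<gamma> f s f') c else 0)"

definition rep :: "('a, 'c::comm_ring_1) fin_mat \<Rightarrow> ('a, 'c) fin_mat" where
  "rep = lin_ext rep_entry"

lemma rep_entry_0 [simp]: "rep_entry z 0 = 0"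
  by (cases z) (simp cong: if_cong)

lemma rep_entry_add: "rep_entry z (c + d) = rep_entry z c + rep_entry z d"
proof (cases z)
  case (fields p q s)
  show ?thesis unfolding fields rep_entry.simps sum.distrib[symmetric]
    by (intro sum.cong refl) (simp add: single_add)
qed

lemma rep_single: "rep (sng z c) = rep_entry z c"
  unfolding rep_def by (rule lin_ext_single) simp

lemma rep_sum: "rep (\<Sum>i\<in>I. h i) = (\<Sum>i\<in>I. rep (h i))"
  unfolding rep_def by (rule lin_ext_sum) (simp_all add: rep_entry_add)

lemma rep_diff: "rep (f - g) = rep f - rep g"
  unfolding rep_def by (rule lin_ext_diff) (simp_all add: rep_entry_add)

text \<open>For given outer orbits the middle orbit is unique by \<open>moves_unique\<close>, and it
  exists exactly when the product moves one outer orbit to the other; the cocycle rule takes care of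
  the group element.\<close>

lemma rep_entry_mult:
  assumes s: "s \<in> carrier S" "t \<in> carrier S"
  shows "conv G (rep_entry (p, q, s) c) (rep_entry (q', r, t) d) =
    (if q = q' then rep_entry (p, r, s \<otimes> t) (c * d) else 0)"
proof -
  let ?h = "\<lambda>f l. sng (enc p f, enc r l, \<gamma> f (s \<otimes> t) l) (c * d)"
  have "conv G (rep_entry (p, q, s) c) (rep_entry (q', r, t) d) =
    (\<Sum>f\<in>Fs. \<Sum>f'\<in>Fs. \<Sum>k\<in>Fs. \<Sum>l\<in>Fs.
      if q = q' \<and> f' = k \<and> moves f s f' \<and> moves k t l then ?h f l else 0)"
    unfolding rep_entry.simps conv_sum_left
    unfolding conv_sum_right
  proof (intro sum.cong refl)
    fix f f' k l assume F: "f \<in> Fs" "f' \<in> Fs" "k \<in> Fs" "l \<in> Fs"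
    show "conv G (if moves f s f' then sng (enc p f, enc q f', \<gamma> f s f') c else 0)
        (if moves k t l then sng (enc q' k, enc r l, \<gamma> k t l) d else 0) =
      (if q = q' \<and> f' = k \<and> moves f s f' \<and> moves k t l then ?h f l else 0)"
      using moves_mult(2)[OF F(1,2,4) s] F(2,3)
      by (auto simp: enc_eq_iff maximal_subgroup_simps)
  qed
  also have "\<dots> = (if q = q' then rep_entry (p, r, s \<otimes> t) (c * d) else 0)"
  proof (cases "q = q'")
    case True
    have "(\<Sum>f\<in>Fs. \<Sum>f'\<in>Fs. \<Sum>k\<in>Fs. \<Sum>l\<in>Fs.
        if q = q' \<and> f' = k \<and> moves f s f' \<and> moves k t l then ?h f l else 0)
      = (\<Sum>f\<in>Fs. \<Sum>l\<in>Fs. \<Sum>k\<in>Fs. \<Sum>f'\<in>Fs.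
        if f' = k then (if moves f s k \<and> moves k t l then ?h f l else 0) else 0)"
    proof (rule sum.cong[OF refl])
      fix f
      have swap3: "(\<Sum>f'\<in>Fs. \<Sum>k\<in>Fs. \<Sum>l\<in>Fs. h f' k l) = (\<Sum>l\<in>Fs. \<Sum>k\<in>Fs. \<Sum>f'\<in>Fs. h f' k l)"
        for h :: "'a \<Rightarrow> 'a \<Rightarrow> 'a \<Rightarrow> ('a, 'c) fin_mat"
      proof -
        have "(\<Sum>f'\<in>Fs. \<Sum>k\<in>Fs. \<Sum>l\<in>Fs. h f' k l) = (\<Sum>f'\<in>Fs. \<Sum>l\<in>Fs. \<Sum>k\<in>Fs. h f' k l)"
          by (intro sum.cong refl sum.swap)
        also have "\<dots> = (\<Sum>l\<in>Fs. \<Sum>f'\<in>Fs. \<Sum>k\<in>Fs. h f' k l)" by (rule sum.swap)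
        also have "\<dots> = (\<Sum>l\<in>Fs. \<Sum>k\<in>Fs. \<Sum>f'\<in>Fs. h f' k l)" by (intro sum.cong refl sum.swap)
        finally show ?thesis .
      qed
      show "(\<Sum>f'\<in>Fs. \<Sum>k\<in>Fs. \<Sum>l\<in>Fs.
          if q = q' \<and> f' = k \<and> moves f s f' \<and> moves k t l then ?h f l else 0)
        = (\<Sum>l\<in>Fs. \<Sum>k\<in>Fs. \<Sum>f'\<in>Fs.
          if f' = k then (if moves f s k \<and> moves k t l then ?h f l else 0) else 0)"
        by (subst swap3, intro sum.cong refl) (auto simp: True)
    qed
    also have "\<dots> = (\<Sum>f\<in>Fs. \<Sum>l\<in>Fs. \<Sum>k\<in>Fs.
        if moves f s k \<and> moves k t l then ?h f l else 0)"
      using fin by (intro sum.cong refl) (simp add: sum.delta')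
    also have "\<dots> = (\<Sum>f\<in>Fs. \<Sum>l\<in>Fs. if moves f (s \<otimes> t) l then ?h f l else 0)"
    proof (intro sum.cong refl)
      fix f l assume F: "f \<in> Fs" "l \<in> Fs"
      show "(\<Sum>k\<in>Fs. if moves f s k \<and> moves k t l then ?h f l else 0) = (if moves f (s \<otimes> t) l then ?h f l else 0)"
      proof (cases "moves f (s \<otimes> t) l")
        case True
        then obtain k0 where k0: "k0 \<in> Fs" "moves f s k0" "moves k0 t l"
          using moves_multD[OF F s] by blast
        have "(\<Sum>k\<in>Fs. if moves f s k \<and> moves k t l then ?h f l else 0) = (\<Sum>k\<in>Fs. if k = k0 then ?h f l else 0)"
        proof (rule sum.cong[OF refl])
          fix k assume k: "k \<in> Fs"
          show "(if moves f s k \<and> moves k t l then ?h f l else 0) = (if k = k0 then ?h f l else 0)"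
          proof (cases "k = k0")
            case False
            then have "\<not> moves k t l" using moves_unique[OF k k0(1) _ k0(3)] by blast
            then show ?thesis using False by simp
          qed (simp add: k0)
        qed
        then show ?thesis using True fin k0 by (simp add: sum.delta')
      next
        case False
        then have "\<not> (moves f s k \<and> moves k t l)" if "k \<in> Fs" for k
          using moves_mult(1)[OF F(1) that F(2) s] by blast
        then show ?thesis using False by (auto intro!: sum.neutral)
      qed
    qed
    finally show ?thesis using True by simp
  qed simp
  finally show ?thesis .
qed

lemma rep_conv:
  assumes "supp f \<subseteq> entries S" "supp g \<subseteq> entries S"
  shows "rep (conv S f g) = conv G (rep f) (rep g)"
proof -
  let ?f = "\<lambda>x. sng x (lkp f x)" and ?g = "\<lambda>x. sng x (lkp g x)"
  have e: "f = sum ?f (supp f)" "g = sum ?g (supp g)"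
    by (rule sum_single_lookup; simp)+
  have *: "rep (conv S (?f x) (?g y)) = conv G (rep (?f x)) (rep (?g y))"
    if "x \<in> supp f" "y \<in> supp g" for x y
  proof -
    obtain i j s k l t where [simp]: "x = (i,j,s)" "y = (k,l,t)" by (metis surj_pair)
    have "s \<in> carrier S" "t \<in> carrier S" using that assms by auto
    then show ?thesis
      unfolding rep_single \<open>x = (i,j,s)\<close> \<open>y = (k,l,t)\<close>
      by (simp only: rep_entry_mult) (simp add: rep_single[symmetric] rep_def del: rep_entry.simps)
  qed
  have "rep (conv S (sum ?f (supp f)) (sum ?g (supp g))) = conv G (rep (sum ?f (supp f))) (rep (sum ?g (supp g)))"
    unfolding conv_sum_left conv_sum_right rep_sum
    by (rule sum.cong[OF refl])+ (simp add: *)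
  then show ?thesis using e by simp
qed

lemma rep_closed:
  assumes D: "add_mult_closed D" and f: "f \<in> fin_mats S D"
  shows "rep f \<in> fin_mats G D"
  unfolding rep_def lin_ext_def
proof (rule coeffs_in_sum[OF D])
  fix z assume "z \<in> supp f"
  have 0: "0 \<in> D" using D by (simp add: add_mult_closed_def)
  obtain p q s where [simp]: "z = (p, q, s)" by (metis surj_pair)
  have "lkp f z \<in> D" using f by (simp add: coeffs_in_def)
  then have "(if moves g s g' then sng (enc p g, enc q g', \<gamma> g s g') (lkp f z) else 0) \<in> fin_mats G D"
    if "g \<in> Fs" "g' \<in> Fs" for g g'
    using movesD(1)[OF that(1)] 0 by (auto intro!: coeffs_in_single coeffs_in_0)
  then show "rep_entry z (lkp f z) \<in> fin_mats G D"
    unfolding \<open>z = (p, q, s)\<close> rep_entry.simps by (intro coeffs_in_sum[OF D])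
qed

lemma e_in_Fs: "e \<in> Fs"
  using e star_idem[OF e] idempotentsD[OF e] by (auto simp: Fs D_equivalent_def intro!: bexI[of _ e])

text \<open>A maximal element \<open>s\<close> of the support with \<open>s\<^sup>\<star>s = e\<close> is detected by \<open>rep\<close>, because
  every \<open>t\<close> acting like \<open>s\<close> on the orbit of \<open>e\<close> lies above \<open>s\<close>.\<close>
lemma rep_nonzero:
  fixes f :: "('a, 'c::comm_ring_1) fin_mat"
  assumes f: "supp f \<subseteq> entries S" and s: "(p, q, s) \<in> supp f" "s\<^sup>\<star> \<otimes> s = e"
    and max: "\<And>t. (p, q, t) \<in> supp f \<Longrightarrow> t \<otimes> e = s \<Longrightarrow> t = s"
  shows "rep f \<noteq> 0"
proof -
  have sS [simp]: "s \<in> carrier S" using f s by auto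
  note xe = x[OF e_in_Fs]
  have se: "s \<otimes> e = s" using assoc_rules(1)[OF sS] s(2) by simp
  \<comment> \<open>The range of the representative \<open>x e\<close> is \<open>e\<close>, the
    domain of \<open>s\<close>, so applying \<open>s\<close> to it loses nothing and
    \<open>s\<close> moves the orbit of \<open>e\<close>.\<close>
  have "(s \<otimes> x e)\<^sup>\<star> \<otimes> (s \<otimes> x e) = (x e)\<^sup>\<star> \<otimes> ((s\<^sup>\<star> \<otimes> s) \<otimes> x e)"
    using xe(1) by (simp add: star_mult m_assoc)
  also have "\<dots> = (x e)\<^sup>\<star> \<otimes> ((x e \<otimes> (x e)\<^sup>\<star>) \<otimes> x e)" unfolding s(2) xe(3) ..
  also have "\<dots> = (x e)\<^sup>\<star> \<otimes> x e" using xe(1) by (simp add: star_props)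
  finally obtain F where F: "F \<in> Fs" "moves F s e"
    using moves_if_domain[OF e_in_Fs sS] xe(2) by auto
  let ?y = "(enc p F, enc q e, \<gamma> F s e)"
  have entry: "lkp (rep_entry z (lkp f z)) ?y = (if z = (p, q, s) then lkp f z else 0)" if z: "z \<in> supp f" for z
  proof -
    obtain p' q' t where zt: "z = (p', q', t)" by (metis surj_pair)
    have t: "t \<in> carrier S" using z f zt by auto
    have "lkp (rep_entry z (lkp f z)) ?y = (\<Sum>g\<in>Fs. \<Sum>g'\<in>Fs. if g = F then (if g' = e then
        (if z = (p, q, s) then lkp f z else 0) else 0) else 0)"
      unfolding zt rep_entry.simps lookup_sum
    proof (intro sum.cong refl)
      fix g g' assume g: "g \<in> Fs" "g' \<in> Fs"
      \<comment> \<open>Equal target orbit and equal cocycle mean that \<open>t\<close> and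
        \<open>s\<close> agree on \<open>x e\<close>, hence after right multiplication by its range
        \<open>e\<close>; maximality then identifies them.\<close>
      have "t = s" if m: "moves F t e" "\<gamma> F t e = \<gamma> F s e" "p' = p" "q' = q"
      proof -
        have "t \<otimes> x e = s \<otimes> x e" using movesD(2)[OF F(1) m(1)] movesD(2)[OF F] m(2) by simp
        then have "t \<otimes> x e \<otimes> (x e)\<^sup>\<star> = s \<otimes> x e \<otimes> (x e)\<^sup>\<star>" by simp
        then have "t \<otimes> (x e \<otimes> (x e)\<^sup>\<star>) = s \<otimes> (x e \<otimes> (x e)\<^sup>\<star>)" using xe(1) t by (simp add: m_assoc)
        then have "t \<otimes> e = s" unfolding xe(3) se .
        then show ?thesis using max z m(3,4) zt by auto
      qed
      then show "lkp (if moves g t g' then sng (enc p' g, enc q' g', \<gamma> g t g') (lkp f (p', q', t)) else 0) ?y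
        = (if g = F then (if g' = e then (if (p', q', t) = (p, q, s) then lkp f (p', q', t) else 0) else 0) else 0)"
        using F enc_eq_iff[OF g(1) F(1), of p' p] enc_eq_iff[OF g(2) e_in_Fs, of q' q]
        by (auto simp: lookup_single when_def)
    qed
    also have "\<dots> = (if z = (p, q, s) then lkp f z else 0)"
    proof -
      have "(\<Sum>g'\<in>Fs. if g = F then (if g' = e then c else 0) else 0) = (if g = F then c else 0)" for g and c :: 'c
        using e_in_Fs fin by (simp add: sum.delta')
      then show ?thesis using F(1) by (simp only: sum.delta[OF fin] if_True)
    qed
    finally show ?thesis .
  qed
  have "lkp (rep f) ?y = (\<Sum>z\<in>supp f. if z = (p, q, s) then lkp f z else 0)"
    unfolding rep_def lin_ext_def lookup_sum by (intro sum.cong refl entry)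
  also have "\<dots> = lkp f (p, q, s)" using s(1) by (simp add: sum.delta')
  also have "\<dots> \<noteq> 0" using s(1) by (simp add: in_keys_iff)
  finally show ?thesis by auto
qed

end

section \<open>The natural partial order and the passage from maximal subgroups to
  \<open>S\<close>\<close>

context inverse_semigroup
begin

lemma exists_schutzenberger:
  assumes "e \<in> idempotents S" "finite {f \<in> idempotents S. D_equivalent S e f}"
  shows "\<exists>x \<iota>. schutzenberger S e x \<iota> {f \<in> idempotents S. D_equivalent S e f}"
proof -
  let ?F = "{f \<in> idempotents S. D_equivalent S e f}"
  have "\<forall>f\<in>?F. \<exists>y. y \<in> carrier S \<and> y\<^sup>\<star> \<otimes> y = e \<and> y \<otimes> y\<^sup>\<star> = f"
    by (auto simp: D_equivalent_def)
  then obtain x where x: "\<forall>f\<in>?F. x f \<in> carrier S \<and> (x f)\<^sup>\<star> \<otimes> x f = e \<and> x f \<otimes> (x f)\<^sup>\<star> = f"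
    by (rule bchoice[THEN exE])
  obtain \<iota> :: "'a \<Rightarrow> nat" where "inj_on \<iota> ?F"
    using finite_imp_inj_to_nat_seg[OF assms(2)] by blast
  then have "schutzenberger S e x \<iota> ?F"
    using assms x by unfold_locales auto
  then show ?thesis by blast
qed

text \<open>The relation \<open>t \<otimes> (s\<^sup>\<star> \<otimes> s) = s\<close> is the natural
  partial order, with \<open>s\<close> below \<open>t\<close>. Once it is known to be antisymmetric
  and transitive, finiteness yields a maximal element.\<close>

lemma exists_maximal_in_support:
  assumes T: "finite T" "T \<noteq> {}" "T \<subseteq> carrier S"
  shows "\<exists>s\<in>T. \<forall>t\<in>T. t \<otimes> (s\<^sup>\<star> \<otimes> s) = s \<longrightarrow> t = s"
proof -
  define R where "R s t \<longleftrightarrow> s \<noteq> t \<and> t \<otimes> (s\<^sup>\<star> \<otimes> s) = s" for s t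
  \<comment> \<open>Passing to domain idempotents is monotone; both antisymmetry and transitivity
    rest on it.\<close>
  have dom: "s\<^sup>\<star> \<otimes> s = (t\<^sup>\<star> \<otimes> t) \<otimes> (s\<^sup>\<star> \<otimes> s)"
    if "s \<in> carrier S" "t \<in> carrier S" "t \<otimes> (s\<^sup>\<star> \<otimes> s) = s" for s t
  proof -
    have st: "s\<^sup>\<star> = (s\<^sup>\<star> \<otimes> s) \<otimes> t\<^sup>\<star>"
    proof -
      have "s\<^sup>\<star> = (t \<otimes> (s\<^sup>\<star> \<otimes> s))\<^sup>\<star>" by (simp only: that(3))
      also have "\<dots> = (s\<^sup>\<star> \<otimes> s)\<^sup>\<star> \<otimes> t\<^sup>\<star>" using that(1,2) by (intro star_mult) simp_all
      finally show ?thesis using that(1) by (simp only: star_idem star_mult_idem)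
    qed
    have "s\<^sup>\<star> \<otimes> s = ((s\<^sup>\<star> \<otimes> s) \<otimes> t\<^sup>\<star>) \<otimes> (t \<otimes> (s\<^sup>\<star> \<otimes> s))"
      by (subst st[symmetric], subst that(3)) simp
    also have "\<dots> = (s\<^sup>\<star> \<otimes> s) \<otimes> ((t\<^sup>\<star> \<otimes> t) \<otimes> (s\<^sup>\<star> \<otimes> s))" using that(1,2) by (simp add: m_assoc)
    also have "(t\<^sup>\<star> \<otimes> t) \<otimes> (s\<^sup>\<star> \<otimes> s) = (s\<^sup>\<star> \<otimes> s) \<otimes> (t\<^sup>\<star> \<otimes> t)"
      using that(1,2) by (intro idem_commute) simp_all
    also have "(s\<^sup>\<star> \<otimes> s) \<otimes> ((s\<^sup>\<star> \<otimes> s) \<otimes> (t\<^sup>\<star> \<otimes> t)) = (s\<^sup>\<star> \<otimes> s) \<otimes> (t\<^sup>\<star> \<otimes> t)"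
      using that(1,2) by (intro idem_absorb) simp_all
    also have "\<dots> = (t\<^sup>\<star> \<otimes> t) \<otimes> (s\<^sup>\<star> \<otimes> s)"
      using that(1,2) by (intro idem_commute) simp_all
    finally show ?thesis .
  qed
  have antisym: "s = t" if "s \<in> carrier S" "t \<in> carrier S" "t \<otimes> (s\<^sup>\<star> \<otimes> s) = s" "s \<otimes> (t\<^sup>\<star> \<otimes> t) = t" for s t
  proof -
    have "s\<^sup>\<star> \<otimes> s = (t\<^sup>\<star> \<otimes> t) \<otimes> (s\<^sup>\<star> \<otimes> s)" using dom that by blast
    also have "\<dots> = (s\<^sup>\<star> \<otimes> s) \<otimes> (t\<^sup>\<star> \<otimes> t)" using that(1,2) by (intro idem_commute) simp_all
    also have "\<dots> = t\<^sup>\<star> \<otimes> t" using dom[OF that(2,1,4)] by simp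
    finally have "s = t \<otimes> (t\<^sup>\<star> \<otimes> t)" using that(3) by simp
    then show ?thesis using assoc_rules(1)[OF that(2)] by simp
  qed
  have trans: "u \<otimes> (s\<^sup>\<star> \<otimes> s) = s"
    if "s \<in> carrier S" "t \<in> carrier S" "u \<in> carrier S" "t \<otimes> (s\<^sup>\<star> \<otimes> s) = s" "u \<otimes> (t\<^sup>\<star> \<otimes> t) = t" for s t u
  proof -
    have "u \<otimes> (s\<^sup>\<star> \<otimes> s) = u \<otimes> ((t\<^sup>\<star> \<otimes> t) \<otimes> (s\<^sup>\<star> \<otimes> s))" using dom[OF that(1,2,4)] by simp
    also have "\<dots> = (u \<otimes> (t\<^sup>\<star> \<otimes> t)) \<otimes> (s\<^sup>\<star> \<otimes> s)" using that(1-3) by (simp add: m_assoc)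
    finally show ?thesis using that by simp
  qed
  have "asymp_on T R" 
  proof (rule asymp_onI, rule notI)
    fix a b assume "a \<in> T" "b \<in> T" "R a b" "R b a"
    then have *: "a \<in> carrier S" "b \<in> carrier S" "b \<otimes> (a\<^sup>\<star> \<otimes> a) = a" "a \<otimes> (b\<^sup>\<star> \<otimes> b) = b" "a \<noteq> b"
      using T(3) by (auto simp: R_def)
    show False using antisym[OF *(1-4)] *(5) by contradiction
  qed
  moreover have "transp_on T R"
  proof (rule transp_onI)
    fix a b c assume "a \<in> T" "b \<in> T" "c \<in> T" "R a b" "R b c"
    then have *: "a \<in> carrier S" "b \<in> carrier S" "c \<in> carrier S" "b \<otimes> (a\<^sup>\<star> \<otimes> a) = a" "c \<otimes> (b\<^sup>\<star> \<otimes> b) = b" "a \<noteq> b"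
      using T(3) by (auto simp: R_def)
    have "c \<otimes> (a\<^sup>\<star> \<otimes> a) = a" by (rule trans[OF *(1-5)])
    moreover have "a \<noteq> c" using antisym[OF *(1,2,4)] * by metis
    ultimately show "R a c" by (simp add: R_def)
  qed
  ultimately obtain m where "m \<in> T" "\<forall>t\<in>T. \<not> R m t"
    using Finite_Set.bex_max_element[OF T(1) _ _ T(2), of R] unfolding R_def by metis
  then show ?thesis unfolding R_def by metis
qed

text \<open>A counterexample gives a nonzero \<open>z = vu - e0\<close>. One of its entries has a
  maximal semigroup element \<open>s\<close>, and the representation at the domain idempotent of
  that \<open>s\<close> does not kill \<open>z\<close>; yet it carries the relations to a Dedekind
  finite ring, where they force the image of \<open>z\<close> to vanish.\<close>

theorem dedekind_conv_if_maximal_subgroups: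
  assumes fin: "\<And>e. e \<in> idempotents S \<Longrightarrow> finite {f \<in> idempotents S. D_equivalent S e f}"
    and D: "add_mult_closed D"
    and sub: "\<And>e. e \<in> idempotents S \<Longrightarrow> dedekind_conv (maximal_subgroup S e) D"
  shows "dedekind_conv S D"
  unfolding dedekind_conv_def
proof (intro ballI impI, elim conjE, rule ccontr)
  fix e0 u v
  assume in': "e0 \<in> fin_mats S D" "u \<in> fin_mats S D" "v \<in> fin_mats S D"
  assume r: "conv S e0 e0 = e0" "conv S e0 u = u" "conv S u e0 = u" "conv S e0 v = v" "conv S v e0 = v"
    "conv S u v = e0" and ne: "conv S v u \<noteq> e0"
  have supps: "supp e0 \<subseteq> entries S" "supp u \<subseteq> entries S" "supp v \<subseteq> entries S"
    using in' by (auto simp: coeffs_in_def)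
  define z where "z = conv S v u - e0"
  have sz: "supp z \<subseteq> entries S"
    using keys_diff[of "conv S v u" e0] supps conv_closed[OF D in'(3,2)] by (auto simp: z_def coeffs_in_def)
  have "z \<noteq> 0" using ne by (simp add: z_def)
  then obtain p q s0 where s0: "(p, q, s0) \<in> supp z" by (metis keys_eq_empty ex_in_conv surj_pair)
  define T where "T = {s. (p, q, s) \<in> supp z}"
  have "T \<subseteq> (snd \<circ> snd) ` supp z" by (force simp: T_def)
  then have "finite T" by (rule finite_subset) simp
  moreover have "T \<noteq> {}" "T \<subseteq> carrier S" using s0 sz by (auto simp: T_def)
  ultimately obtain s where s: "s \<in> T" "\<forall>t\<in>T. t \<otimes> (s\<^sup>\<star> \<otimes> s) = s \<longrightarrow> t = s"
    using exists_maximal_in_support by blast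
  have sS: "s \<in> carrier S" using s sz by (auto simp: T_def)
  define e where "e = s\<^sup>\<star> \<otimes> s"
  have e: "e \<in> idempotents S" using sS by (simp add: e_def)
  obtain x \<iota> where "schutzenberger S e x \<iota> {f \<in> idempotents S. D_equivalent S e f}"
    using exists_schutzenberger[OF e fin[OF e]] by blast
  then interpret schutzenberger S e x \<iota> "{f \<in> idempotents S. D_equivalent S e f}" .
  have "rep z \<noteq> 0"
    by (rule rep_nonzero[OF sz, of p q s]) (use s in \<open>auto simp: T_def e_def\<close>)
  moreover have "conv G (rep v) (rep u) = rep e0"
    by (rule sub[OF e, unfolded dedekind_conv_def, rule_format])
      (use in' in \<open>simp_all add: rep_closed[OF D] rep_conv[symmetric] supps r\<close>)
  then have "rep z = 0" unfolding z_def rep_diff using rep_conv[OF supps(3,2)] by simp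
  ultimately show False by simp
qed

end

theorem corollary4p7:
  fixes S :: "('s, 'm) monoid_scheme" and K :: "('k, 'n) ring_scheme"
  assumes "inverse_semigroup S"
    and "\<And>e. e \<in> idempotents S \<Longrightarrow> finite {f \<in> idempotents S. D_equivalent S e f}"
    and "cring K"
  shows "(stably_finite (semigroup_algebra K S) \<longleftrightarrow>
      (\<forall>e\<in>idempotents S. stably_finite (semigroup_algebra K (maximal_subgroup S e)))) \<and>
    ((domain K \<and> char_zero K) \<or> (\<forall>e\<in>idempotents S. sofic (maximal_subgroup S e)) \<longrightarrow>
      stably_finite (semigroup_algebra K S))"
proof -
  interpret inverse_semigroup S by fact
  interpret cring K by fact
  let ?D = "embed K ` carrier K"
  have KS: "stably_finite (semigroup_algebra K S) \<longleftrightarrow> dedekind_conv S ?D"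
    by (rule algebra_setup.stably_finite_iff) (simp add: algebra_setup_def is_cring semigroup_on_axioms)
  have gr: "group (maximal_subgroup S e)" if "e \<in> idempotents S" for e
    by (rule group_maximal_subgroup[OF that])
  have KG: "stably_finite (semigroup_algebra K (maximal_subgroup S e)) \<longleftrightarrow> dedekind_conv (maximal_subgroup S e) ?D"
    if "e \<in> idempotents S" for e
    by (rule algebra_setup.stably_finite_iff)
      (simp add: algebra_setup_def is_cring group.is_semigroup_on[OF gr[OF that]])
  have sub: "dedekind_conv (maximal_subgroup S e) ?D" if "dedekind_conv S ?D" for e
    using that by (rule dedekind_conv_subsemigroup) (auto simp: maximal_subgroup_def)
  have iff: "dedekind_conv S ?D \<longleftrightarrow> (\<forall>e\<in>idempotents S. dedekind_conv (maximal_subgroup S e) ?D)"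
    using sub dedekind_conv_if_maximal_subgroups[OF assms(2) add_mult_closed_embed] by blast
  \<comment> \<open>This case has to be run for \<open>?D\<close> itself, since the ambient product
    ring is not a domain.\<close>
  have char0: "dedekind_conv (maximal_subgroup S e) ?D"
    if "domain K" "char_zero K" "e \<in> idempotents S" for e
    by (rule subdomain.dedekind_conv_subdomain[OF subdomain_embed[OF that(1,2)]
          group.is_semigroup_on[OF gr[OF that(3)]] group.dedekind_conv_complex[OF gr[OF that(3)]]])
  \<comment> \<open>The sofic theorem is valid over every commutative ring, so it is applied to the
    whole ambient ring and then restricted to \<open>?D\<close>.\<close>
  have sof: "dedekind_conv (maximal_subgroup S e) ?D"
    if "sofic (maximal_subgroup S e)" "e \<in> idempotents S" for e
    using group.sofic_dedekind_conv[OF gr[OF that(2)] that(1)] by (rule dedekind_conv_mono) simp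
  show ?thesis using KS KG iff char0 sof by auto
qed

end
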